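(* Let $\mathcal P=\{P_{\theta,G}:\theta\in\Theta,G\in\mathcal G\}$ be a semiparametric model with $\Theta\subset\mathbb R^k$ open and $\mathcal G$ arbitrary, and let $X_1,X_2,\dots$ be i.i.d. Assume that for every $G\in\mathcal G$ the submodel $\mathcal P_1(G)=\{P_{\theta,G}:\theta\in\Theta\}$ is a regular parametric model, and that the efficient influence function $\tilde\ell(x;\theta;G)=(E\,\ell_1^*\ell_1^{*T})^{-1}\ell_1^*(x)$ is well defined (with $\ell_1^*$ the efficient score at $P_{\theta,G}$ and expectation under $P_{\theta,G}$). Assume: (a) there is an estimator $\tilde\theta_n=t_n(X_1,\dots,X_n)$ with $\lim_{M\to\infty}\limsup_n P_{\theta_n,G}(|\sqrt n(\tilde\theta_n-\theta_n)|>M)=0$ for all $(\theta,G)\in\Theta\times\mathcal G$ and all $\theta_n=\theta+O(n^{-1/2})$; (b) there is an estimator $\tilde\ell_n(\cdot;\theta;\underline X)=\tilde\ell_n(\cdot;\theta;X_1,\dots,X_n)$ of $\tilde\ell(\cdot;\theta;G)$ such that for all $(\theta,G)$ and all $\theta_n=\theta+O(n^{-1/2})$, $$\int|\tilde\ell_n(x;\theta_n;\underline X)-\tilde\ell(x;\theta_n;G)|^2\,dP_{\theta_n,G}(x)=o_{\theta_n,G}(1),\qquad \sqrt n\int\tilde\ell_n(x;\theta_n;\underline X)\,dP_{\theta_n,G}(x)=o_{\theta_n,G}(1);$$ (c) for every $(\theta,G)$ and all $\theta_n=\theta+O(n^{-1/2})$, $$\sqrt n\Big(\theta_n-\theta+\frac1n\sum_{i=1}^n\tilde\ell(X_i;\theta_n;G)-\frac1n\sum_{i=1}^n\tilde\ell(X_i;\theta;G)\Big)=o_{\theta,G}(1).$$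 Let $0<\lambda_n<\mu_n<\nu_n<n$ be integers with $\lambda_n/n\to\lambda$, $\mu_n/n\to\mu$, $\nu_n/n\to\nu$, $0<\lambda<\mu<\nu<1$, and define $\tilde\theta_{n1}=t_{\lambda_n}(X_1,\dots,X_{\lambda_n})$, $\tilde\theta_{n2}=t_{\nu_n-\mu_n}(X_{\mu_n+1},\dots,X_{\nu_n})$, $\tilde\ell_{n1}(x;\theta)=\tilde\ell_{\mu_n-\lambda_n}(x;\theta;X_{\lambda_n+1},\dots,X_{\mu_n})$, $\tilde\ell_{n2}(x;\theta)=\tilde\ell_{n-\nu_n}(x;\theta;X_{\nu_n+1},\dots,X_n)$, and $$\hat\theta_n=\frac{\mu_n}{n}\Big(\tilde\theta_{n2}+\frac1{\mu_n}\sum_{i=1}^{\mu_n}\tilde\ell_{n2}(X_i;\tilde\theta_{n2})\Big)+\frac{n-\mu_n}{n}\Big(\tilde\theta_{n1}+\frac1{n-\mu_n}\sum_{i=\mu_n+1}^n\tilde\ell_{n1}(X_i;\tilde\theta_{n1})\Big).$$ Then for every $(\theta,G)\in\Theta\times\mathcal G$ and every sequence $\theta_n=\theta+O(n^{-1/2})$, $$\sqrt n\Big(\hat\theta_n-\theta_n-\frac1n\sum_{i=1}^n\tilde\ell(X_i;\theta_n;G)\Big)=o_{\theta_n,G}(1).$$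
   Context: $o_{\theta,G}(1)$ denotes convergence to $0$ in probability when $X_1,X_2,\dots$ are i.i.d. $P_{\theta,G}$. Regular parametric model $\{P_\theta\}$: $\Theta$ open, dominated by $\mu$, $s(\theta)=(dP_\theta/d\mu)^{1/2}$, score $\dot\ell(\theta_0)\in\mathcal L_2^k(P_{\theta_0})$ with $s(\theta)=s(\theta_0)+\tfrac12(\theta-\theta_0)^T\dot\ell(\theta_0)s(\theta_0)+o(|\theta-\theta_0|)$ in $\mathcal L_2(\mu)$, nonsingular $I(\theta_0)=\int\dot\ell\dot\ell^T\,dP_{\theta_0}$, and $\theta\mapsto\dot\ell(\theta)s(\theta)$ continuous into $\mathcal L_2^k(\mu)$. Efficient score at $P_0=P_{\theta,G}$: $\ell_1^*=\dot\ell_1-\Pi(\dot\ell_1\mid\dot{\mathcal P}_2)$, where $\dot\ell_1$ is the score of $\mathcal P_1(G)$ at $\theta$, $\dot{\mathcal P}_2$ is the tangent space at $P_0$ of $\{P_{\theta,G'}:G'\in\mathcal G\}$ (the closed linear span in $\mathcal L_2(P_0)$ of the scores at $P_0$ of all one-dimensional regular parametric submodels through $P_0$ of that model), and $\Pi$ is componentwise orthogonal projection in $\mathcal L_2^0(P_0)$. *)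

theory Defs
  imports "HOL-Probability.Probability"
begin

definition L2 :: "'a measure \<Rightarrow> ('a \<Rightarrow> real) \<Rightarrow> bool" where
  "L2 N f \<longleftrightarrow> f \<in> borel_measurable N \<and> (\<integral>\<^sup>+x. ennreal ((f x)\<^sup>2) \<partial>N) < \<infinity>"

definition L2v :: "'a measure \<Rightarrow> ('a \<Rightarrow> 'b::euclidean_space) \<Rightarrow> bool" where
  "L2v N f \<longleftrightarrow> f \<in> borel_measurable N \<and> (\<integral>\<^sup>+x. ennreal ((norm (f x))\<^sup>2) \<partial>N) < \<infinity>"

definition regular_param ::
  "'a measure \<Rightarrow> ('p::euclidean_space) set \<Rightarrow> ('p \<Rightarrow> 'a measure) \<Rightarrow> ('p \<Rightarrow> 'a \<Rightarrow> 'p) \<Rightarrow> bool" where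
  "regular_param M Th P sc \<longleftrightarrow>
     open Th \<and>
     (\<exists>(mu :: 'a measure) (p :: 'p \<Rightarrow> 'a \<Rightarrow> real).
        sigma_finite_measure mu \<and> sets mu = sets M \<and>
        (\<forall>th\<in>Th. p th \<in> borel_measurable mu \<and> (\<forall>x. 0 \<le> p th x) \<and>
                  P th = density mu (\<lambda>x. ennreal (p th x)) \<and> prob_space (P th)) \<and>
        \<comment> \<open>score in L2^k(P th)\<close>
        (\<forall>th\<in>Th. L2v (P th) (sc th)) \<and>
        \<comment> \<open>Hellinger differentiability in L2(mu)\<close>
        (\<forall>th0\<in>Th. \<forall>e>0. \<exists>d>0. \<forall>h. norm h < d \<and> th0 + h \<in> Th \<longrightarrow>
            (\<integral>\<^sup>+x. ennreal ((sqrt (p (th0 + h) x) - sqrt (p th0 x)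
                     - (1/2) * (h \<bullet> sc th0 x) * sqrt (p th0 x))\<^sup>2) \<partial>mu)
              \<le> ennreal ((e * norm h)\<^sup>2)) \<and>
        \<comment> \<open>nonsingular Fisher information I(th) = int sc sc^T dP th (as a linear map)\<close>
        (\<forall>th\<in>Th. inj (\<lambda>v. \<integral>x. (v \<bullet> sc th x) *\<^sub>R sc th x \<partial>(P th))) \<and>
        \<comment> \<open>th |-> sc(th) s(th) continuous into L2^k(mu)\<close>
        (\<forall>th0\<in>Th. \<forall>e>0. \<exists>d>0. \<forall>th\<in>Th. dist th th0 < d \<longrightarrow>
            (\<integral>\<^sup>+x. ennreal ((norm (sqrt (p th x) *\<^sub>R sc th x - sqrt (p th0 x) *\<^sub>R sc th0 x))\<^sup>2) \<partial>mu)
              < ennreal e))"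

definition submodel_scores :: "'a measure \<Rightarrow> 'a measure set \<Rightarrow> 'a measure \<Rightarrow> ('a \<Rightarrow> real) set" where
  "submodel_scores M Ps P0 =
     {f. \<exists>(U :: real set) (Q :: real \<Rightarrow> 'a measure) (sc :: real \<Rightarrow> 'a \<Rightarrow> real) eta0.
           open U \<and> eta0 \<in> U \<and> (\<forall>eta\<in>U. Q eta \<in> Ps) \<and> Q eta0 = P0 \<and>
           regular_param M U Q sc \<and> f = sc eta0}"

definition L2_closed_span :: "'a measure \<Rightarrow> ('a \<Rightarrow> real) set \<Rightarrow> ('a \<Rightarrow> real) set" where
  "L2_closed_span N T =
     {f. L2 N f \<and> (\<forall>e>0. \<exists>F c. finite F \<and> F \<subseteq> T \<and>
            (\<integral>\<^sup>+x. ennreal ((f x - (\<Sum>h\<in>F. c h * h x))\<^sup>2) \<partial>N) < ennreal e)}"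

text \<open>ls is (a version of) the efficient score at P0: ls = sc0 - Pi(sc0 | tangent space),
componentwise, where the orthogonal projection g = Pi(f | closed span T) is characterised by
g in the closed span and f - g orthogonal to T.\<close>

definition eff_score ::
  "'a measure \<Rightarrow> 'a measure set \<Rightarrow> 'a measure \<Rightarrow> ('a \<Rightarrow> real^'k) \<Rightarrow> ('a \<Rightarrow> real^'k) \<Rightarrow> bool" where
  "eff_score M Ps P0 sc0 ls \<longleftrightarrow>
     L2v P0 ls \<and>
     (\<forall>i. (\<lambda>x. sc0 x $ i - ls x $ i) \<in> L2_closed_span P0 (submodel_scores M Ps P0) \<and>
          (\<forall>h\<in>submodel_scores M Ps P0. (\<integral>x. ls x $ i * h x \<partial>P0) = 0))"

definition eff_infl ::
  "'a measure \<Rightarrow> 'a measure set \<Rightarrow> 'a measure \<Rightarrow> ('a \<Rightarrow> real^'k) \<Rightarrow> ('a \<Rightarrow> real^'k) \<Rightarrow> bool" where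
  "eff_infl M Ps P0 sc0 eif \<longleftrightarrow>
     (\<exists>ls. eff_score M Ps P0 sc0 ls \<and>
        (let Istar = (\<chi> i j. \<integral>x. ls x $ i * ls x $ j \<partial>P0) :: real^'k^'k in
           invertible Istar \<and> (\<forall>x\<in>space M. eif x = matrix_inv Istar *v ls x)))"

abbreviation iid :: "'a measure \<Rightarrow> (nat \<Rightarrow> 'a) measure" where
  "iid Q \<equiv> \<Pi>\<^sub>M i\<in>(UNIV::nat set). Q"

definition oP :: "(nat \<Rightarrow> 'a measure) \<Rightarrow> (nat \<Rightarrow> (nat \<Rightarrow> 'a) \<Rightarrow> 'b::real_normed_vector) \<Rightarrow> bool" where
  "oP Q Z \<longleftrightarrow> (\<forall>e>0. (\<lambda>n. measure (iid (Q n)) {X \<in> space (iid (Q n)). e < norm (Z n X)}) \<longlonglongrightarrow> 0)"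

definition oP_enn :: "(nat \<Rightarrow> 'a measure) \<Rightarrow> (nat \<Rightarrow> (nat \<Rightarrow> 'a) \<Rightarrow> ennreal) \<Rightarrow> bool" where
  "oP_enn Q Z \<longleftrightarrow> (\<forall>e>0. (\<lambda>n. measure (iid (Q n)) {X \<in> space (iid (Q n)). ennreal e < Z n X}) \<longlonglongrightarrow> 0)"

definition root_n_seq :: "'p::real_normed_vector set \<Rightarrow> 'p \<Rightarrow> (nat \<Rightarrow> 'p) \<Rightarrow> bool" where
  "root_n_seq Th th ths \<longleftrightarrow> (\<forall>n. ths n \<in> Th) \<and> (\<exists>C. \<forall>n. sqrt (real n) * norm (ths n - th) \<le> C)"

text \<open>Observations X_1, X_2, ... are X 0, X 1, ...; t n and ell n use only X 0 .. X (n-1).\<close>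

definition theta_hat ::
  "(nat \<Rightarrow> (nat \<Rightarrow> 'a) \<Rightarrow> 'v::real_vector) \<Rightarrow> (nat \<Rightarrow> 'a \<Rightarrow> 'v \<Rightarrow> (nat \<Rightarrow> 'a) \<Rightarrow> 'v)
   \<Rightarrow> (nat \<Rightarrow> nat) \<Rightarrow> (nat \<Rightarrow> nat) \<Rightarrow> (nat \<Rightarrow> nat) \<Rightarrow> nat \<Rightarrow> (nat \<Rightarrow> 'a) \<Rightarrow> 'v" where
  "theta_hat t ell lam mu nu n X =
     (let th1 = t (lam n) X;
          th2 = t (nu n - mu n) (\<lambda>i. X (mu n + i));
          ell1 = (\<lambda>x th. ell (mu n - lam n) x th (\<lambda>i. X (lam n + i)));
          ell2 = (\<lambda>x th. ell (n - nu n) x th (\<lambda>i. X (nu n + i)))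
      in (real (mu n) / real n) *\<^sub>R
            (th2 + (1 / real (mu n)) *\<^sub>R (\<Sum>i<mu n. ell2 (X i) th2))
       + (real (n - mu n) / real n) *\<^sub>R
            (th1 + (1 / real (n - mu n)) *\<^sub>R (\<Sum>i\<in>{mu n..<n}. ell1 (X i) th1)))"

end

theory Submission
  imports Defs
begin

text \<open>
  The preliminary estimators are independent of the data they are plugged into, so they may be
  treated as fixed sequences \<open>\<theta>'\<^sub>n\<close> at distance \<open>O(n\<^sup>-\<^sup>1\<^sup>/\<^sup>2)\<close>; pointwise control along all
  such sequences gives uniform control over balls of that radius. For a fixed sequence the error
  splits into two parts. The drift, with the true influence function at \<open>\<theta>'\<^sub>n\<close>, is handled by (c)
  under \<open>P\<^sub>\<theta>\<close>. The noise, the effect of estimating the influence function, is by (b) and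
  conditional Chebyshev negligible under \<open>P\<^sub>\<theta>\<^sub>'\<close> with \<open>\<theta>' = \<theta>'\<^sub>n\<close>, because the efficient
  influence function has mean zero there. Both bounds move to \<open>\<theta>\<^sub>n\<close> by contiguity of product
  measures at root-n neighbours. Contiguity needs no central limit theorem: with
  \<open>s = sqrt p\<close>, \<open>r = sqrt q\<close> the event that some \<open>p(X\<^sub>i) > 4 q(X\<^sub>i)\<close> has vanishing probability by
  Hellinger differentiability, and off that event the second moment of the likelihood ratio is at
  most \<open>(1 + 9 \<parallel>s - r\<parallel>\<^sup>2)\<^sup>n = O(1)\<close>.
\<close>

section \<open>Independent and identically distributed sequences\<close>

text \<open>Each ingredient is available under a different law: (b), and the mean zero of the
  influence function, under the parameter that is plugged in; (c) under the fixed limit; the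
  conclusion under the true sequence. Hence the split into drift and noise, and the need for
  contiguity between arbitrary pairs of root-n sequences.

  Two held-out blocks serve each half of the sample because (b) evaluates the estimated influence
  function at a deterministic parameter: the preliminary estimate must be independent of the summed
  observations and also of the data from which that function is estimated.

  In the contiguity bound the event that some \<open>p(X_i) > 4 q(X_i)\<close> costs
  \<open>n\<close> times a one-observation probability, so this probability must be o(1/n). The
  remainder in Hellinger differentiability is that small, but the linear term only gives O(1/n). The
  gain comes from the bad set itself: its mass under the limit density vanishes and the squared
  score is integrable.

  Mean zero of the efficient influence function is not part of its definition. It is derived from
  the fact that scores, including those spanning the tangent space, have mean zero.\<close>

lemma space_iid: "space (iid Q) = {X. \<forall>i. X i \<in> space Q}"
  by (auto simp: space_PiM PiE_def Pi_def)

lemma sets_iid_cong: "sets Q = sets M \<Longrightarrow> sets (iid Q) = sets (iid M)"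
  by (rule sets_PiM_cong) auto

lemma distr_iid_shift:
  assumes "prob_space Q"
  shows "distr (iid Q) (iid Q) (\<lambda>X i. X (a + i :: nat)) = iid Q"
  using distr_PiM_reindex[of UNIV "\<lambda>_. Q" "\<lambda>i. a + i" UNIV] assms
  by (simp add: restrict_UNIV inj_def)

lemma measurable_iid_shift: "(\<lambda>X i. X (a + i :: nat)) \<in> measurable (iid Q) (iid Q)"
  by (rule measurable_PiM_single') (auto simp: space_PiM PiE_def Pi_def)

lemma measure_iid_shift:
  assumes "prob_space Q" and A: "Measurable.pred (iid Q) A"
  shows "measure (iid Q) {X \<in> space (iid Q). A (\<lambda>i. X (a + i))} = measure (iid Q) {X \<in> space (iid Q). A X}"
proof -
  have "measure (iid Q) {X \<in> space (iid Q). A X}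
      = measure (distr (iid Q) (iid Q) (\<lambda>X i. X (a + i))) {X \<in> space (iid Q). A X}"
    by (simp add: distr_iid_shift[OF assms(1)])
  also have "\<dots> = measure (iid Q) ((\<lambda>X i. X (a + i)) -` {X \<in> space (iid Q). A X} \<inter> space (iid Q))"
    using A by (intro measure_distr measurable_iid_shift predE)
  also have "(\<lambda>X i. X (a + i)) -` {X \<in> space (iid Q). A X} \<inter> space (iid Q)
      = {X \<in> space (iid Q). A (\<lambda>i. X (a + i))}"
    by (auto simp: space_iid)
  finally show ?thesis ..
qed

section \<open>Decoupling of disjoint blocks of observations\<close>

lemma measurable_iid_merge:
  "(\<lambda>(X, Y) i. if i \<in> K then Y i else X i) \<in> measurable (iid Q \<Otimes>\<^sub>M iid Q) (iid Q)"
  unfolding split_beta'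
  by (rule measurable_PiM_single') (auto simp: space_PiM PiE_def Pi_def space_pair_measure)

text \<open>This is the form in which independence of blocks enters: resampling the coordinates in
  \<open>K\<close> from an independent copy does not change the law. On a cylinder over
  \<open>J\<close> the product of probabilities simply factors over \<open>J - K\<close> and
  \<open>J \<inter> K\<close>.\<close>

lemma distr_iid_merge:
  fixes K :: "nat set"
  assumes "prob_space Q"
  shows "distr (iid Q \<Otimes>\<^sub>M iid Q) (iid Q) (\<lambda>(X, Y) i. if i \<in> K then Y i else X i) = iid Q"
    (is "distr ?S _ ?f = _")
proof -
  interpret Q: prob_space Q by fact
  interpret S: product_prob_space "\<lambda>_. Q" UNIV ..
  interpret P: prob_space "iid Q" by (intro prob_space_PiM assms)
  show ?thesis
  proof (rule S.PiM_eq)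
    fix J :: "nat set" and E assume J: "finite J" "J \<subseteq> UNIV" "\<And>j. j \<in> J \<Longrightarrow> E j \<in> sets Q"
    let ?X = "prod_emb UNIV (\<lambda>_. Q) J (Pi\<^sub>E J E)"
    have sub: "\<And>j x. j \<in> J \<Longrightarrow> x \<in> E j \<Longrightarrow> x \<in> space Q"
      using J(3)[THEN sets.sets_into_space] by auto
    have "?f -` ?X \<inter> space ?S =
        prod_emb UNIV (\<lambda>_. Q) (J - K) (Pi\<^sub>E (J - K) E) \<times> prod_emb UNIV (\<lambda>_. Q) (J \<inter> K) (Pi\<^sub>E (J \<inter> K) E)"
      (is "_ = ?E \<times> ?F")
      using sub by (auto simp: space_pair_measure space_PiM prod_emb_def PiE_iff split: if_splits)
    then have "emeasure (distr ?S (iid Q) ?f) ?X = emeasure ?S (?E \<times> ?F)"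
      using J by (subst emeasure_distr) (auto intro!: sets_PiM_I simp: measurable_iid_merge)
    also have "\<dots> = emeasure (iid Q) ?E * emeasure (iid Q) ?F"
      using J by (intro S.P.emeasure_pair_measure_Times) (auto intro!: sets_PiM_I)
    also have "emeasure (iid Q) ?E = (\<Prod>j\<in>J - K. emeasure Q (E j))"
      using J by (intro emeasure_PiM_emb assms) auto
    also have "emeasure (iid Q) ?F = (\<Prod>j\<in>J \<inter> K. emeasure Q (E j))"
      using J by (intro emeasure_PiM_emb assms) auto
    also have "(\<Prod>j\<in>J - K. emeasure Q (E j)) * (\<Prod>j\<in>J \<inter> K. emeasure Q (E j)) = (\<Prod>j\<in>J. emeasure Q (E j))"
      using J(1) by (subst prod.union_disjoint[symmetric]) (auto intro!: prod.cong)
    finally show "emeasure (distr ?S (iid Q) ?f) ?X = (\<Prod>j\<in>J. emeasure Q (E j))" .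
  qed simp
qed

text \<open>Replaces conditioning on a block. By the two locality assumptions, merging two
  independent copies turns the event \<open>A X (T X)\<close> into \<open>A X (T Y)\<close> with
  \<open>X\<close> and \<open>Y\<close> independent, and Fubini applies the bound for each fixed
  value \<open>T Y\<close>. The target space \<open>N\<close> is left general because the lemma is
  used twice: with a whole data block as value, and with a parameter estimate as value.\<close>

lemma measure_iid_plugin:
  fixes A :: "(nat \<Rightarrow> 'a) \<Rightarrow> 'b \<Rightarrow> bool"
  assumes Q: "prob_space Q"
    and A: "Measurable.pred (iid Q \<Otimes>\<^sub>M N) (\<lambda>(X, y). A X y)"
    and T: "T \<in> measurable (iid Q) N"
    and B: "Measurable.pred N B"
    and A_local: "\<And>X X' y. (\<And>i. i \<notin> K \<Longrightarrow> X i = X' i) \<Longrightarrow> A X y = A X' y"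
    and T_local: "\<And>X X'. (\<And>i. i \<in> K \<Longrightarrow> X i = X' i) \<Longrightarrow> T X = T X'"
    and bound: "\<And>y. y \<in> space N \<Longrightarrow> B y \<Longrightarrow> measure (iid Q) {X \<in> space (iid Q). A X y} \<le> d"
    and d: "0 \<le> d"
  shows "measure (iid Q) {X \<in> space (iid Q). A X (T X)}
       \<le> d + measure (iid Q) {X \<in> space (iid Q). \<not> B (T X)}"
proof -
  interpret Q: prob_space Q by fact
  interpret P: prob_space "iid Q" by (intro prob_space_PiM Q)
  interpret PP: pair_prob_space "iid Q" "iid Q"
    by (intro pair_prob_space.intro pair_sigma_finite.intro P.sigma_finite_measure_axioms P.prob_space_axioms)
  let ?f = "\<lambda>(X, Y) i. if i \<in> K then Y i else X i"
  have meas2: "{Z \<in> space (iid Q \<Otimes>\<^sub>M iid Q). A (fst Z) (T (snd Z))} \<in> sets (iid Q \<Otimes>\<^sub>M iid Q)"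
  proof -
    have "(\<lambda>Z. (fst Z, T (snd Z))) \<in> measurable (iid Q \<Otimes>\<^sub>M iid Q) (iid Q \<Otimes>\<^sub>M N)"
      using T by (intro measurable_Pair measurable_fst measurable_snd measurable_ident_sets
        measurable_compose[OF measurable_snd T] refl measurable_ident)
    from predE[OF measurable_compose[OF this A]] show ?thesis by (simp only: prod.case)
  qed
  have meas1: "{X \<in> space (iid Q). A X (T X)} \<in> sets (iid Q)"
  proof -
    have "(\<lambda>X. (X, T X)) \<in> measurable (iid Q) (iid Q \<Otimes>\<^sub>M N)"
      using T by (intro measurable_Pair measurable_fst measurable_snd measurable_ident_sets
        measurable_compose[OF measurable_snd T] refl measurable_ident)
    from predE[OF measurable_compose[OF this A]] show ?thesis by (simp only: prod.case)
  qed
  have measB: "{X \<in> space (iid Q). \<not> B (T X)} \<in> sets (iid Q)"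
    by (rule predE[OF pred_intros_logic(2)[OF measurable_compose[OF T B]]])
  define C where "C = {X \<in> space (iid Q). A X (T X)}"
  define D where "D = {Z \<in> space (iid Q \<Otimes>\<^sub>M iid Q). A (fst Z) (T (snd Z))}"
  define E where "E = {X \<in> space (iid Q). \<not> B (T X)}"
  have sets: "C \<in> sets (iid Q)" "D \<in> sets (iid Q \<Otimes>\<^sub>M iid Q)" "E \<in> sets (iid Q)"
    using meas1 meas2 measB by (simp_all only: C_def D_def E_def)
  have eq: "?f -` C \<inter> space (iid Q \<Otimes>\<^sub>M iid Q) = D"
  proof -
    have "A (?f Z) (T (?f Z)) = A (fst Z) (T (snd Z))" for Z
    proof -
      have "T (?f Z) = T (snd Z)" by (rule T_local) (simp add: split_beta)
      moreover have "A (?f Z) y = A (fst Z) y" for y by (rule A_local) (simp add: split_beta)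
      ultimately show ?thesis by simp
    qed
    moreover have "?f Z \<in> space (iid Q)" if "Z \<in> space (iid Q \<Otimes>\<^sub>M iid Q)" for Z
      using that by (auto simp: space_pair_measure space_iid)
    ultimately show ?thesis unfolding C_def D_def by blast
  qed
  \<comment> \<open>A value outside \<open>B\<close> is charged in full, since a probability is at
    most 1. This is what becomes the second term of the bound after integration over
    \<open>Y\<close>.\<close>
  have slice: "emeasure (iid Q) ((\<lambda>X. (X, Y)) -` D) \<le> ennreal d + indicator E Y"
    if Y: "Y \<in> space (iid Q)" for Y
  proof (cases "B (T Y)")
    case True
    have "(\<lambda>X. (X, Y)) -` D = {X \<in> space (iid Q). A X (T Y)}"
      using Y by (auto simp: D_def space_pair_measure)
    then have "measure (iid Q) ((\<lambda>X. (X, Y)) -` D) \<le> d"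
      using bound[OF measurable_space[OF T Y] True] by simp
    then show ?thesis
      by (simp add: P.emeasure_eq_measure d add_increasing2)
  next
    case False
    then show ?thesis using Y by (simp add: E_def add_increasing P.emeasure_le_1)
  qed
  have "emeasure (iid Q) C = emeasure (distr (iid Q \<Otimes>\<^sub>M iid Q) (iid Q) ?f) C"
    by (simp add: distr_iid_merge[OF Q])
  also have "\<dots> = emeasure (iid Q \<Otimes>\<^sub>M iid Q) D"
    using emeasure_distr[OF measurable_iid_merge sets(1), of K] by (simp only: eq)
  also have "\<dots> = (\<integral>\<^sup>+Y. emeasure (iid Q) ((\<lambda>X. (X, Y)) -` D) \<partial>iid Q)"
    by (rule PP.emeasure_pair_measure_alt2[OF sets(2)])
  also have "\<dots> \<le> (\<integral>\<^sup>+Y. ennreal d + indicator E Y \<partial>iid Q)"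
    by (intro nn_integral_mono slice)
  also have "\<dots> = ennreal d + emeasure (iid Q) E"
    using sets(3) by (subst nn_integral_add) (simp_all add: P.emeasure_space_1)
  also have "\<dots> = ennreal (d + measure (iid Q) E)"
    by (simp add: P.emeasure_eq_measure d)
  finally have "measure (iid Q) C \<le> d + measure (iid Q) E"
    using d by (simp add: P.emeasure_eq_measure del: ennreal_plus)
  then show ?thesis by (simp only: C_def E_def)
qed

section \<open>Second moments of sums of i.i.d. terms\<close>

lemma indep_vars_iid_coordinates:
  assumes "prob_space Q"
  shows "prob_space.indep_vars (iid Q) (\<lambda>_. Q) (\<lambda>i X. X i) UNIV"
proof -
  interpret P: prob_space "iid Q" by (intro prob_space_PiM assms)
  show ?thesis
    by (subst P.indep_vars_iff_distr_eq_PiM')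
       (auto simp: distr_PiM_component[where I=UNIV and M="\<lambda>_. Q"] assms restrict_UNIV distr_id2)
qed

lemma
  fixes f :: "'a \<Rightarrow> 'b::{banach, second_countable_topology}"
  assumes Q: "prob_space Q" and [measurable]: "f \<in> borel_measurable Q"
  shows integrable_iid_coordinate: "integrable (iid Q) (\<lambda>X. f (X i)) \<longleftrightarrow> integrable Q f"
    and integral_iid_coordinate: "(\<integral>X. f (X i) \<partial>iid Q) = (\<integral>x. f x \<partial>Q)"
proof -
  have d: "distr (iid Q) Q (\<lambda>X. X i) = Q"
    by (rule distr_PiM_component) (auto simp: Q)
  have "integrable (distr (iid Q) Q (\<lambda>X. X i)) f = integrable (iid Q) (\<lambda>X. f (X i))"
    by (rule integrable_distr_eq) auto
  then show "integrable (iid Q) (\<lambda>X. f (X i)) \<longleftrightarrow> integrable Q f" by (simp add: d)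
  have "integral\<^sup>L (distr (iid Q) Q (\<lambda>X. X i)) f = (\<integral>X. f (X i) \<partial>iid Q)"
    by (rule integral_distr) auto
  then show "(\<integral>X. f (X i) \<partial>iid Q) = (\<integral>x. f x \<partial>Q)" by (simp add: d)
qed

text \<open>Independence turns each off-diagonal product into the squared mean. Charging the squared
  mean on the diagonal as well gives the factor \<open>card I\<close> squared, at the price of
  equality.\<close>

lemma
  fixes f :: "'a \<Rightarrow> real"
  assumes Q: "prob_space Q" and f [measurable]: "f \<in> borel_measurable Q"
    and f2: "integrable Q (\<lambda>x. (f x)\<^sup>2)" and I: "finite I"
  shows integrable_iid_sum_sq: "integrable (iid Q) (\<lambda>X. (\<Sum>i\<in>I. f (X i))\<^sup>2)" (is ?A)
    and integral_iid_sum_sq_le: "(\<integral>X. (\<Sum>i\<in>I. f (X i))\<^sup>2 \<partial>iid Q)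
      \<le> real (card I) * (\<integral>x. (f x)\<^sup>2 \<partial>Q) + (real (card I))\<^sup>2 * (\<integral>x. f x \<partial>Q)\<^sup>2" (is ?B)
proof -
  interpret Q: prob_space Q by fact
  interpret P: prob_space "iid Q" by (intro prob_space_PiM Q)
  have f1: "integrable Q f"
    by (rule Q.square_integrable_imp_integrable) (auto simp: f2)
  have ind: "P.indep_vars (\<lambda>_. borel) (\<lambda>i X. f (X i)) J" for J :: "nat set"
    by (rule P.indep_vars_subset[OF P.indep_vars_compose2[OF indep_vars_iid_coordinates[OF Q]]]) auto
  have off: "integrable (iid Q) (\<lambda>X. f (X i) * f (X j))"
      "(\<integral>X. f (X i) * f (X j) \<partial>iid Q) = (\<integral>x. f x \<partial>Q)\<^sup>2" if "i \<noteq> j" for i j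
    using P.indep_vars_integrable[OF _ ind, of "{i, j}"] P.indep_vars_lebesgue_integral[OF _ ind, of "{i, j}"] that f1
    by (simp_all add: integrable_iid_coordinate[OF Q] integral_iid_coordinate[OF Q] power2_eq_square)
  have diag: "integrable (iid Q) (\<lambda>X. f (X i) * f (X i))"
      "(\<integral>X. f (X i) * f (X i) \<partial>iid Q) = (\<integral>x. (f x)\<^sup>2 \<partial>Q)" for i
    using integrable_iid_coordinate[OF Q, of "\<lambda>x. (f x)\<^sup>2" i] integral_iid_coordinate[OF Q, of "\<lambda>x. (f x)\<^sup>2" i] f2
    by (simp_all add: power2_eq_square)
  have int: "integrable (iid Q) (\<lambda>X. f (X i) * f (X j))" for i j
    using off(1) diag(1) by (cases "i = j") auto
  have sq: "(\<Sum>i\<in>I. f (X i))\<^sup>2 = (\<Sum>i\<in>I. \<Sum>j\<in>I. f (X i) * f (X j))" for X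
    by (simp add: power2_eq_square sum_product)
  show ?A unfolding sq by (intro Bochner_Integration.integrable_sum int)
  have "(\<integral>X. (\<Sum>i\<in>I. f (X i))\<^sup>2 \<partial>iid Q) = (\<Sum>i\<in>I. \<Sum>j\<in>I. \<integral>X. f (X i) * f (X j) \<partial>iid Q)"
    unfolding sq by (simp add: Bochner_Integration.integral_sum int Bochner_Integration.integrable_sum)
  also have "\<dots> \<le> (\<Sum>i\<in>I. \<Sum>j\<in>I. (if i = j then \<integral>x. (f x)\<^sup>2 \<partial>Q else 0) + (\<integral>x. f x \<partial>Q)\<^sup>2)"
    by (intro sum_mono) (auto simp: diag off)
  also have "\<dots> = real (card I) * (\<integral>x. (f x)\<^sup>2 \<partial>Q) + (real (card I))\<^sup>2 * (\<integral>x. f x \<partial>Q)\<^sup>2"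
    using I by (simp add: sum.distrib sum.delta power2_eq_square algebra_simps)
  finally show ?B .
qed

text \<open>Chebyshev's inequality, coordinate by coordinate and without centring. The summands will
  be estimated minus true influence functions, whose mean need not vanish; if it is small against
  \<open>n\<close> to the power -1/2, the quadratic term is still small against
  \<open>n\<close>.\<close>

lemma measure_iid_norm_sum_gt_le:
  fixes f :: "'a \<Rightarrow> 'b::euclidean_space"
  assumes Q: "prob_space Q" and f [measurable]: "f \<in> borel_measurable Q"
    and f2: "integrable Q (\<lambda>x. (norm (f x))\<^sup>2)" and I: "finite I" and e: "0 < e"
  shows "measure (iid Q) {X \<in> space (iid Q). e < norm (\<Sum>i\<in>I. f (X i))}
    \<le> (real (card I) * (\<integral>x. (norm (f x))\<^sup>2 \<partial>Q) + (real (card I))\<^sup>2 * (norm (\<integral>x. f x \<partial>Q))\<^sup>2) / e\<^sup>2"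
proof -
  interpret Q: prob_space Q by fact
  interpret P: prob_space "iid Q" by (intro prob_space_PiM Q)
  have nrm: "(norm v)\<^sup>2 = (\<Sum>b\<in>Basis. (v \<bullet> b)\<^sup>2)" for v :: 'b
    by (simp add: norm_eq_sqrt_inner euclidean_inner[of v v] power2_eq_square sum_nonneg)
  have f2b: "integrable Q (\<lambda>x. (f x \<bullet> b)\<^sup>2)" if "b \<in> Basis" for b
    using f2 by (rule Bochner_Integration.integrable_bound)
      (use that in \<open>auto simp: abs_le_square_iff[symmetric] Basis_le_norm\<close>)
  have f1: "integrable Q f"
  proof -
    have "integrable Q (\<lambda>x. norm (f x))"
      by (rule Q.square_integrable_imp_integrable) (auto simp: f2)
    then show ?thesis by (rule integrable_norm_cancel) simp
  qed
  let ?S = "\<lambda>X. \<Sum>i\<in>I. f (X i)"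
  have sq: "(norm (?S X))\<^sup>2 = (\<Sum>b\<in>Basis. (\<Sum>i\<in>I. f (X i) \<bullet> b)\<^sup>2)" for X
    by (simp add: nrm inner_sum_left)
  have int: "integrable (iid Q) (\<lambda>X. (norm (?S X))\<^sup>2)"
    unfolding sq by (intro Bochner_Integration.integrable_sum integrable_iid_sum_sq[OF Q _ f2b I]) auto
  have "(\<integral>X. (norm (?S X))\<^sup>2 \<partial>iid Q) = (\<Sum>b\<in>Basis. \<integral>X. (\<Sum>i\<in>I. f (X i) \<bullet> b)\<^sup>2 \<partial>iid Q)"
    unfolding sq by (intro Bochner_Integration.integral_sum integrable_iid_sum_sq[OF Q _ f2b I]) auto
  also have "\<dots> \<le> (\<Sum>b\<in>Basis. real (card I) * (\<integral>x. (f x \<bullet> b)\<^sup>2 \<partial>Q) + (real (card I))\<^sup>2 * (\<integral>x. f x \<bullet> b \<partial>Q)\<^sup>2)"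
    by (intro sum_mono integral_iid_sum_sq_le[OF Q _ f2b I]) auto
  also have "\<dots> = real (card I) * (\<Sum>b\<in>Basis. \<integral>x. (f x \<bullet> b)\<^sup>2 \<partial>Q) + (real (card I))\<^sup>2 * (\<Sum>b\<in>Basis. ((\<integral>x. f x \<partial>Q) \<bullet> b)\<^sup>2)"
    by (simp add: sum.distrib sum_distrib_left f1)
  also have "(\<Sum>b\<in>Basis. \<integral>x. (f x \<bullet> b)\<^sup>2 \<partial>Q) = (\<integral>x. (norm (f x))\<^sup>2 \<partial>Q)"
    unfolding nrm by (intro Bochner_Integration.integral_sum[symmetric] f2b)
  also have "(\<Sum>b\<in>Basis. ((\<integral>x. f x \<partial>Q) \<bullet> b)\<^sup>2) = (norm (\<integral>x. f x \<partial>Q))\<^sup>2"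
    by (simp add: nrm)
  finally have bnd: "(\<integral>X. (norm (?S X))\<^sup>2 \<partial>iid Q)
    \<le> real (card I) * (\<integral>x. (norm (f x))\<^sup>2 \<partial>Q) + (real (card I))\<^sup>2 * (norm (\<integral>x. f x \<partial>Q))\<^sup>2" .
  have "measure (iid Q) {X \<in> space (iid Q). e < norm (?S X)}
      \<le> measure (iid Q) {X \<in> space (iid Q). e\<^sup>2 \<le> (norm (?S X))\<^sup>2}"
    using e by (intro P.finite_measure_mono) (auto intro!: power_mono)
  also have "\<dots> \<le> (\<integral>X. (norm (?S X))\<^sup>2 \<partial>iid Q) / e\<^sup>2"
    by (rule integral_Markov_inequality_measure[OF int]) (use e in auto)
  also have "\<dots> \<le> (real (card I) * (\<integral>x. (norm (f x))\<^sup>2 \<partial>Q) + (real (card I))\<^sup>2 * (norm (\<integral>x. f x \<partial>Q))\<^sup>2) / e\<^sup>2"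
    using bnd by (intro divide_right_mono) auto
  finally show ?thesis .
qed

section \<open>Contiguity of product measures\<close>

text \<open>The density \<open>g\<close> need not have mass one: the application is to laws
  restricted to a set on which the likelihood ratio is bounded, which are only finite
  measures.\<close>

lemma density_PiM:
  fixes g :: "'a \<Rightarrow> ennreal"
  assumes Q: "prob_space Q" and I: "finite I" and g [measurable]: "g \<in> borel_measurable Q"
    and fin: "finite_measure (density Q g)"
  shows "density (PiM I (\<lambda>_. Q)) (\<lambda>X. \<Prod>i\<in>I. g (X i)) = PiM I (\<lambda>_. density Q g)"
proof -
  interpret Q: prob_space Q by fact
  interpret D: finite_measure "density Q g" by fact
  interpret PQ: product_sigma_finite "\<lambda>_. Q"
    by (intro product_sigma_finite.intro Q.sigma_finite_measure_axioms)
  interpret PD: product_sigma_finite "\<lambda>_. density Q g"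
    by (intro product_sigma_finite.intro D.sigma_finite_measure_axioms)
  show ?thesis
  proof (rule PD.PiM_eqI[OF I])
    show "sets (density (PiM I (\<lambda>_. Q)) (\<lambda>X. \<Prod>i\<in>I. g (X i))) = sets (PiM I (\<lambda>_. density Q g))"
      by (simp cong: sets_PiM_cong)
    fix A assume A: "\<And>i. i \<in> I \<Longrightarrow> A i \<in> sets (density Q g)"
    have "emeasure (density (PiM I (\<lambda>_. Q)) (\<lambda>X. \<Prod>i\<in>I. g (X i))) (Pi\<^sub>E I A)
        = (\<integral>\<^sup>+X. (\<Prod>i\<in>I. g (X i)) * indicator (Pi\<^sub>E I A) X \<partial>PiM I (\<lambda>_. Q))"
      using A I by (intro emeasure_density) (auto intro!: sets_PiM_I_finite)
    also have "\<dots> = (\<integral>\<^sup>+X. (\<Prod>i\<in>I. g (X i) * indicator (A i) (X i)) \<partial>PiM I (\<lambda>_. Q))"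
    proof (rule nn_integral_cong)
      fix X assume X: "X \<in> space (PiM I (\<lambda>_. Q))"
      have "indicator (Pi\<^sub>E I A) X = (\<Prod>i\<in>I. indicator (A i) (X i) :: ennreal)"
      proof (cases "X \<in> Pi\<^sub>E I A")
        case True
        then have "\<And>i. i \<in> I \<Longrightarrow> X i \<in> A i" by auto
        with True show ?thesis by simp
      next
        case False
        then obtain i where "i \<in> I" "X i \<notin> A i"
          using X by (auto simp: space_PiM PiE_iff)
        with I False show ?thesis by (auto simp: prod_zero_iff intro!: bexI[of _ i])
      qed
      then show "(\<Prod>i\<in>I. g (X i)) * indicator (Pi\<^sub>E I A) X = (\<Prod>i\<in>I. g (X i) * indicator (A i) (X i))"
        by (simp add: prod.distrib)
    qed
    also have "\<dots> = (\<Prod>i\<in>I. \<integral>\<^sup>+x. g x * indicator (A i) x \<partial>Q)"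
      using A I by (intro PQ.product_nn_integral_prod) auto
    also have "\<dots> = (\<Prod>i\<in>I. emeasure (density Q g) (A i))"
      using A by (intro prod.cong refl emeasure_density[symmetric]) auto
    finally show "emeasure (density (PiM I (\<lambda>_. Q)) (\<lambda>X. \<Prod>i\<in>I. g (X i))) (Pi\<^sub>E I A)
        = (\<Prod>i\<in>I. emeasure (density Q g) (A i))" .
  qed
qed

text \<open>For distinct laws the infinite products are mutually singular, so likelihood ratios
  exist only for finitely many coordinates. An event about the first \<open>n\<close> observations
  is moved there; \<open>c\<close> is an arbitrary filler for the other coordinates, which
  \<open>A_local\<close> makes irrelevant.\<close>

lemma measure_iid_prefix:
  assumes Q: "prob_space Q" and A: "Measurable.pred (iid Q) A"
    and A_local: "\<And>X Y. (\<And>i. i < n \<Longrightarrow> X i = Y i) \<Longrightarrow> A X = A Y"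
    and c: "c \<in> space Q"
  shows "{X \<in> space (PiM {..<n} (\<lambda>_. Q)). A (\<lambda>i. if i < n then X i else c)} \<in> sets (PiM {..<n} (\<lambda>_. Q))"
    and "emeasure (iid Q) {X \<in> space (iid Q). A X} =
      emeasure (PiM {..<n} (\<lambda>_. Q)) {X \<in> space (PiM {..<n} (\<lambda>_. Q)). A (\<lambda>i. if i < n then X i else c)}"
      (is "_ = emeasure _ ?A")
proof -
  have ext: "(\<lambda>X i. if i < n then X i else c) \<in> measurable (PiM {..<n} (\<lambda>_. Q)) (iid Q)"
  proof (rule measurable_PiM_single')
    show "(\<lambda>X. if i < n then X i else c) \<in> measurable (PiM {..<n} (\<lambda>_. Q)) Q" for i
      using c by (cases "i < n") auto
  qed (use c in \<open>auto simp: space_PiM PiE_def Pi_def\<close>)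
  show sets: "?A \<in> sets (PiM {..<n} (\<lambda>_. Q))"
    by (rule predE[OF measurable_compose[OF ext A]])
  have "distr (iid Q) (PiM {..<n} (\<lambda>_. Q)) (\<lambda>X. restrict X {..<n}) = PiM {..<n} (\<lambda>_. Q)"
    using distr_PiM_reindex[of UNIV "\<lambda>_. Q" "\<lambda>i. i" "{..<n}"] Q by simp
  then have "emeasure (PiM {..<n} (\<lambda>_. Q)) ?A
      = emeasure (distr (iid Q) (PiM {..<n} (\<lambda>_. Q)) (\<lambda>X. restrict X {..<n})) ?A"
    by simp
  also have "\<dots> = emeasure (iid Q) ((\<lambda>X. restrict X {..<n}) -` ?A \<inter> space (iid Q))"
    by (rule emeasure_distr[OF measurable_restrict_subset sets]) auto
  also have "(\<lambda>X. restrict X {..<n}) -` ?A \<inter> space (iid Q) = {X \<in> space (iid Q). A X}"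
  proof -
    have "A (\<lambda>i. if i < n then restrict X {..<n} i else c) = A X" for X
      by (rule A_local) simp
    then show ?thesis by (auto simp: space_PiM)
  qed
  finally show "emeasure (iid Q) {X \<in> space (iid Q). A X} = emeasure (PiM {..<n} (\<lambda>_. Q)) ?A" ..
qed

text \<open>The origin of the constants 4 and 9. With \<open>s = sqrt p\<close> and
  \<open>r = sqrt q\<close>, the left side equals
  \<open>(s - r)^2 (s + r)^2 / r^2 + 2 p - q\<close>, and \<open>p \<le> 4 * q\<close> means
  \<open>s \<le> 2 * r\<close>, so that \<open>(s + r)^2\<close> is at most \<open>9 r^2\<close>.
  Since \<open>p\<close> and \<open>q\<close> both integrate to one, \<open>2 p - q\<close>
  contributes exactly 1 to the integral.\<close>

lemma likelihood_ratio_sq_le: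
  fixes p q :: real
  assumes "0 \<le> p" "0 \<le> q" "p \<le> 4 * q"
  shows "q * (p / q)\<^sup>2 \<le> 9 * (sqrt p - sqrt q)\<^sup>2 + 2 * p - q"
proof (cases "q = 0")
  case True
  then show ?thesis using assms by simp
next
  case False
  then have q: "q > 0" using assms by simp
  define s r where "s = sqrt p" and "r = sqrt q"
  have sr: "p = s\<^sup>2" "q = r\<^sup>2" "0 \<le> s" "0 < r" using assms q by (auto simp: s_def r_def)
  have "sqrt p \<le> sqrt (4 * q)"
    using assms(3) by (rule real_sqrt_le_mono)
  then have "s \<le> 2 * r" by (simp add: s_def r_def real_sqrt_mult)
  then have "(s + r)\<^sup>2 \<le> (3 * r)\<^sup>2" using sr(3,4) by (intro power_mono) auto
  then have "(s - r)\<^sup>2 * (s + r)\<^sup>2 \<le> (s - r)\<^sup>2 * (9 * r\<^sup>2)"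
    by (intro mult_left_mono) (auto simp: power_mult_distrib)
  moreover have "(s\<^sup>2 - r\<^sup>2)\<^sup>2 = (s - r)\<^sup>2 * (s + r)\<^sup>2"
    by (simp add: power2_eq_square algebra_simps)
  ultimately have "((s\<^sup>2 - r\<^sup>2)\<^sup>2) / r\<^sup>2 \<le> 9 * (s - r)\<^sup>2"
    using sr(4) by (simp add: divide_le_eq mult_ac)
  moreover have "r\<^sup>2 * (s\<^sup>2 / r\<^sup>2)\<^sup>2 = (s\<^sup>2 - r\<^sup>2)\<^sup>2 / r\<^sup>2 + 2 * s\<^sup>2 - r\<^sup>2"
    using sr(4) by (simp add: field_simps power2_eq_square)
  moreover have "(s - r)\<^sup>2 = (sqrt p - sqrt q)\<^sup>2" by (simp add: s_def r_def)
  ultimately show ?thesis unfolding sr(1,2) by linarith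
qed

text \<open>A truncated change of measure. The first term is a union bound for leaving the set where
  \<open>p \<le> 4 * q\<close>. On that set the likelihood ratio \<open>z\<close> of the
  \<open>n\<close> observations satisfies \<open>z \<le> K + z^2 / K\<close>, since either
  \<open>z \<le> K\<close> or \<open>K z \<le> z^2\<close>; this yields the other two terms. The
  level \<open>K\<close> stays free, to be fixed independently of \<open>n\<close>.\<close>

lemma measure_iid_le_of_hellinger:
  fixes p q :: "'a \<Rightarrow> real"
  assumes [measurable]: "p \<in> borel_measurable N" "q \<in> borel_measurable N"
    and nonneg: "\<And>x. 0 \<le> p x" "\<And>x. 0 \<le> q x"
    and P_def: "P = density N (\<lambda>x. ennreal (p x))" and Q_def: "Q = density N (\<lambda>x. ennreal (q x))"
    and P: "prob_space P" and Q: "prob_space Q"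
    and H: "(\<integral>\<^sup>+x. ennreal ((sqrt (p x) - sqrt (q x))\<^sup>2) \<partial>N) \<le> ennreal H" "0 \<le> H"
    and A: "Measurable.pred (iid Q) A"
    and A_local: "\<And>X Y. (\<And>i. i < n \<Longrightarrow> X i = Y i) \<Longrightarrow> A X = A Y"
    and K: "0 < K"
  shows "measure (iid P) {X \<in> space (iid P). A X}
    \<le> real n * measure P {x \<in> space P. 4 * q x < p x}
      + K * measure (iid Q) {X \<in> space (iid Q). A X} + (1 + 9 * H) ^ n / K"
proof -
  interpret P: prob_space P by fact
  interpret Q: prob_space Q by fact
  interpret IP: prob_space "iid P" by (intro prob_space_PiM P)
  interpret IQ: prob_space "iid Q" by (intro prob_space_PiM Q)
  have sets_PQ [measurable_cong, simp]: "sets P = sets N" "sets Q = sets N"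
    and space_PQ [simp]: "space P = space N" "space Q = space N"
    by (auto simp: P_def Q_def)
  interpret PP: product_sigma_finite "\<lambda>_. P"
    by (intro product_sigma_finite.intro P.sigma_finite_measure_axioms)
  interpret QQ: product_sigma_finite "\<lambda>_. Q"
    by (intro product_sigma_finite.intro Q.sigma_finite_measure_axioms)
  define Pn where "Pn = PiM {..<n} (\<lambda>_. P)"
  define Qn where "Qn = PiM {..<n} (\<lambda>_. Q)"
  interpret Pn: prob_space Pn unfolding Pn_def by (intro prob_space_PiM P)
  interpret Qn: prob_space Qn unfolding Qn_def by (intro prob_space_PiM Q)
  define good where "good x \<longleftrightarrow> p x \<le> 4 * q x" for x
  have [measurable]: "Measurable.pred N good" unfolding good_def by measurable
  define phi where "phi x = (if good x then p x / q x else 0)" for x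
  have phi_meas [measurable]: "phi \<in> borel_measurable N" unfolding phi_def by measurable
  have phi_nonneg: "0 \<le> phi x" for x using nonneg by (simp add: phi_def)
  define ind where "ind x = (if good x then 1 else 0 :: ennreal)" for x
  have ind_meas [measurable]: "ind \<in> borel_measurable N" unfolding ind_def by measurable

  have measPQ: "ind \<in> borel_measurable P" "(\<lambda>x. ennreal (phi x)) \<in> borel_measurable Q"
    "(\<lambda>x. ennreal ((phi x)\<^sup>2)) \<in> borel_measurable Q" "Measurable.pred N (\<lambda>x. \<not> good x)"
    by measurable

  \<comment> \<open>On the good set \<open>q x = 0\<close> forces \<open>p x = 0\<close>, so the
    value 0 given to \<open>p x / q x\<close> there is the correct one.\<close>
  have dens: "density P ind = density Q (\<lambda>x. ennreal (phi x))"
  proof -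
    have "ennreal (p x) * ind x = ennreal (q x) * ennreal (phi x)" for x
      using nonneg[of x] by (cases "q x = 0")
        (auto simp: ind_def phi_def good_def ennreal_mult[symmetric])
    then show ?thesis
      unfolding P_def Q_def by (simp add: density_density_eq)
  qed
  have fin: "finite_measure (density P ind)"
  proof
    have "emeasure (density P ind) (space P) = (\<integral>\<^sup>+x. ind x * indicator (space P) x \<partial>P)"
      by (intro emeasure_density) auto
    also have "\<dots> \<le> (\<integral>\<^sup>+x. 1 \<partial>P)"
      by (intro nn_integral_mono) (auto simp: ind_def indicator_def)
    finally have "emeasure (density P ind) (space P) \<le> (\<integral>\<^sup>+x. 1 \<partial>P)" .
    then show "emeasure (density P ind) (space (density P ind)) \<noteq> \<infinity>"
      by (auto simp: P.emeasure_space_1 top_unique)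
  qed

  obtain c where c: "c \<in> space N" using P.not_empty by auto
  define E where "E = {X \<in> space Pn. A (\<lambda>i. if i < n then X i else c)}"
  have A': "Measurable.pred (iid P) A"
    using A by (simp cong: measurable_cong_sets sets_PiM_cong)
  have spn: "space Pn = space Qn" "sets Pn = sets Qn"
    by (auto simp: Pn_def Qn_def space_PiM intro!: sets_PiM_cong)
  have E: "E \<in> sets Pn" "emeasure (iid P) {X \<in> space (iid P). A X} = emeasure Pn E"
    using measure_iid_prefix[OF P A' A_local, of n c] c by (simp_all add: E_def Pn_def)
  have EQ: "E \<in> sets Qn" "emeasure (iid Q) {X \<in> space (iid Q). A X} = emeasure Qn E"
    using measure_iid_prefix[OF Q A A_local, of n c] c spn by (simp_all add: E_def Qn_def Pn_def)
  have comp [measurable]: "(\<lambda>X. X i) \<in> measurable Pn N" "(\<lambda>X. X i) \<in> measurable Qn N" if "i < n" for i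
    using that measurable_component_singleton[of i "{..<n}" "\<lambda>_. P"] measurable_component_singleton[of i "{..<n}" "\<lambda>_. Q"]
    by (simp_all add: Pn_def Qn_def measurable_cong_sets[OF refl sets_PQ(1)] measurable_cong_sets[OF refl sets_PQ(2)])

  define F where "F = {X \<in> space Pn. \<exists>i<n. \<not> good (X i)}"
  have Fi: "emeasure Pn {X \<in> space Pn. \<not> good (X i)} = emeasure P {x \<in> space P. \<not> good x}" if "i < n" for i
  proof -
    have "distr Pn P (\<lambda>X. X i) = P"
      unfolding Pn_def using that P by (intro distr_PiM_component) auto
    then have "emeasure P {x \<in> space P. \<not> good x} = emeasure (distr Pn P (\<lambda>X. X i)) {x \<in> space P. \<not> good x}"
      by simp
    also have "\<dots> = emeasure Pn ((\<lambda>X. X i) -` {x \<in> space P. \<not> good x} \<inter> space Pn)"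
      using that predE[OF measPQ(4)] by (intro emeasure_distr) (simp_all add: Pn_def)
    also have "(\<lambda>X. X i) -` {x \<in> space P. \<not> good x} \<inter> space Pn = {X \<in> space Pn. \<not> good (X i)}"
      using measurable_space[OF comp(1)[OF that]] by auto
    finally show ?thesis ..
  qed
  have Fm: "{X \<in> space Pn. \<not> good (X i)} \<in> sets Pn" if "i < n" for i
    by (rule predE[OF measurable_compose[OF comp(1)[OF that] measPQ(4)]])
  have F_un: "F = (\<Union>i<n. {X \<in> space Pn. \<not> good (X i)})" by (auto simp: F_def)
  have F_sets: "F \<in> sets Pn" unfolding F_un using Fm by auto
  have "emeasure Pn F \<le> (\<Sum>i<n. emeasure Pn {X \<in> space Pn. \<not> good (X i)})"
    unfolding F_un using Fm by (intro emeasure_subadditive_finite) auto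
  also have "\<dots> = of_nat n * emeasure P {x \<in> space P. \<not> good x}"
    using Fi by simp
  finally have F_le: "emeasure Pn F \<le> of_nat n * emeasure P {x \<in> space P. \<not> good x}" .

  have "emeasure Pn (E - F) = (\<integral>\<^sup>+X. indicator (E - F) X \<partial>Pn)"
    using E F_sets by (simp add: nn_integral_indicator)
  also have "\<dots> = (\<integral>\<^sup>+X. (\<Prod>i<n. ind (X i)) * indicator E X \<partial>Pn)"
  proof (rule nn_integral_cong)
    fix X assume "X \<in> space Pn"
    show "indicator (E - F) X = (\<Prod>i<n. ind (X i)) * (indicator E X :: ennreal)"
    proof (cases "\<exists>i<n. \<not> good (X i)")
      case True
      then have "(\<Prod>i<n. ind (X i)) = 0" by (auto simp: prod_zero_iff ind_def)
      with True show ?thesis by (auto simp: F_def indicator_def E_def)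
    next
      case False
      then have "(\<Prod>i<n. ind (X i)) = 1" by (auto simp: ind_def intro!: prod.neutral)
      with False show ?thesis by (auto simp: F_def indicator_def)
    qed
  qed
  also have "\<dots> = emeasure (density Pn (\<lambda>X. \<Prod>i<n. ind (X i))) E"
    using E by (intro emeasure_density[symmetric]) (auto simp: comp)
  \<comment> \<open>Both sides are the \<open>n\<close>-fold product of the same finite measure, by
    \<open>dens\<close>: \<open>P\<close> restricted to the good set, written once relative to
    \<open>P\<close> and once relative to \<open>Q\<close>.\<close>
  also have "density Pn (\<lambda>X. \<Prod>i<n. ind (X i)) = density Qn (\<lambda>X. \<Prod>i<n. ennreal (phi (X i)))"
    unfolding Pn_def Qn_def
    using density_PiM[OF P _ measPQ(1) fin, of "{..<n}"] density_PiM[OF Q _ measPQ(2), of "{..<n}"] fin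
    by (simp add: dens)
  also have "emeasure (density Qn (\<lambda>X. \<Prod>i<n. ennreal (phi (X i)))) E
      = (\<integral>\<^sup>+X. (\<Prod>i<n. ennreal (phi (X i))) * indicator E X \<partial>Qn)"
    using EQ by (intro emeasure_density) (auto simp: comp)
  also have "\<dots> \<le> (\<integral>\<^sup>+X. ennreal K * indicator E X + ennreal (1 / K) * (\<Prod>i<n. ennreal ((phi (X i))\<^sup>2)) \<partial>Qn)"
  proof (rule nn_integral_mono)
    fix X
    define z where "z = (\<Prod>i<n. phi (X i))"
    have z: "0 \<le> z" unfolding z_def by (intro prod_nonneg) (auto simp: phi_nonneg)
    have "z \<le> K + 1 / K * z\<^sup>2"
    proof (cases "z \<le> K")
      case True
      moreover have "0 \<le> 1 / K * z\<^sup>2" using K by simp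
      ultimately show ?thesis by linarith
    next
      case False
      then have "K * z \<le> z\<^sup>2" using z by (simp add: power2_eq_square mult_right_mono)
      then have "z \<le> 1 / K * z\<^sup>2" using K by (simp add: field_simps)
      then show ?thesis using K by linarith
    qed
    then have "ennreal z \<le> ennreal K + ennreal (1 / K) * ennreal (z\<^sup>2)"
      using K by (simp add: ennreal_mult[symmetric] ennreal_plus[symmetric] ennreal_leI del: ennreal_plus)
    then show "(\<Prod>i<n. ennreal (phi (X i))) * indicator E X
        \<le> ennreal K * indicator E X + ennreal (1 / K) * (\<Prod>i<n. ennreal ((phi (X i))\<^sup>2))"
      using phi_nonneg by (auto simp: prod_ennreal z_def indicator_def prod_power_distrib)
  qed
  also have "\<dots> = ennreal K * emeasure Qn E + ennreal (1 / K) * (\<integral>\<^sup>+X. (\<Prod>i<n. ennreal ((phi (X i))\<^sup>2)) \<partial>Qn)"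
    using EQ by (subst nn_integral_add) (auto simp: comp nn_integral_cmult)
  also have "(\<integral>\<^sup>+X. (\<Prod>i<n. ennreal ((phi (X i))\<^sup>2)) \<partial>Qn) = (\<integral>\<^sup>+x. ennreal ((phi x)\<^sup>2) \<partial>Q) ^ n"
    unfolding Qn_def using measPQ(3) by (subst QQ.product_nn_integral_prod) simp_all
  also have "\<dots> \<le> (ennreal (1 + 9 * H)) ^ n"
  proof (rule power_mono)
    \<comment> \<open>The term \<open>- q\<close> of \<open>likelihood_ratio_sq_le\<close> is
      carried on the left as \<open>+ 1\<close>, which avoids subtraction in
      \<open>ennreal\<close>.\<close>
    have "(\<integral>\<^sup>+x. ennreal ((phi x)\<^sup>2) \<partial>Q) + 1 = (\<integral>\<^sup>+x. ennreal (q x) * ennreal ((phi x)\<^sup>2) \<partial>N) + (\<integral>\<^sup>+x. ennreal (q x) \<partial>N)"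
      using Q.emeasure_space_1 unfolding Q_def by (simp add: nn_integral_density emeasure_density cong: nn_integral_cong)
    also have "\<dots> = (\<integral>\<^sup>+x. ennreal (q x * (phi x)\<^sup>2 + q x) \<partial>N)"
      using nonneg by (subst nn_integral_add[symmetric]) (auto simp: ennreal_mult)
    also have "\<dots> \<le> (\<integral>\<^sup>+x. ennreal (9 * (sqrt (p x) - sqrt (q x))\<^sup>2 + 2 * p x) \<partial>N)"
    proof (intro nn_integral_mono ennreal_leI)
      fix x
      show "q x * (phi x)\<^sup>2 + q x \<le> 9 * (sqrt (p x) - sqrt (q x))\<^sup>2 + 2 * p x"
      proof (cases "good x")
        case True
        then show ?thesis
          using likelihood_ratio_sq_le[of "p x" "q x"] nonneg[of x] by (simp add: phi_def good_def)
      next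
        case False
        then have "q x \<le> 2 * p x" using nonneg[of x] by (simp add: good_def)
        moreover have "0 \<le> 9 * (sqrt (p x) - sqrt (q x))\<^sup>2" by simp
        ultimately have "q x \<le> 9 * (sqrt (p x) - sqrt (q x))\<^sup>2 + 2 * p x" by linarith
        with False show ?thesis by (simp add: phi_def)
      qed
    qed
    also have "\<dots> = 9 * (\<integral>\<^sup>+x. ennreal ((sqrt (p x) - sqrt (q x))\<^sup>2) \<partial>N) + 2 * (\<integral>\<^sup>+x. ennreal (p x) \<partial>N)"
      using nonneg by (simp add: ennreal_plus ennreal_mult nn_integral_add nn_integral_cmult)
    also have "(\<integral>\<^sup>+x. ennreal (p x) \<partial>N) = 1"
      using P.emeasure_space_1 unfolding P_def by (simp add: emeasure_density cong: nn_integral_cong)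
    also have "9 * (\<integral>\<^sup>+x. ennreal ((sqrt (p x) - sqrt (q x))\<^sup>2) \<partial>N) + 2 * 1 \<le> 9 * ennreal H + 2"
      using H by (intro add_mono mult_left_mono) auto
    also have "\<dots> = ennreal (1 + 9 * H) + 1"
      using H by (simp add: ennreal_plus ennreal_mult add_ac flip: ennreal_numeral) 
    finally show "(\<integral>\<^sup>+x. ennreal ((phi x)\<^sup>2) \<partial>Q) \<le> ennreal (1 + 9 * H)"
      by (simp add: ennreal_add_left_cancel_le add.commute[of _ 1])
  qed simp
  finally have EF_le: "emeasure Pn (E - F) \<le> ennreal K * emeasure Qn E + ennreal (1 / K) * ennreal (1 + 9 * H) ^ n"
    by (simp add: mult_left_mono)

  have "emeasure Pn E \<le> emeasure Pn (F \<union> (E - F))"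
    using E F_sets by (intro emeasure_mono) auto
  also have "\<dots> \<le> emeasure Pn F + emeasure Pn (E - F)"
    using E F_sets by (intro emeasure_subadditive) auto
  also have "\<dots> \<le> of_nat n * emeasure P {x \<in> space P. \<not> good x}
      + (ennreal K * emeasure Qn E + ennreal (1 / K) * ennreal (1 + 9 * H) ^ n)"
    by (intro add_mono F_le EF_le)
  also have "\<dots> = ennreal (real n * measure P {x \<in> space P. \<not> good x}
      + (K * measure Qn E + (1 / K) * (1 + 9 * H) ^ n))"
    using H(2) K by (simp add: P.emeasure_eq_measure Qn.emeasure_eq_measure ennreal_plus[symmetric]
      ennreal_mult[symmetric] ennreal_power ennreal_of_nat_eq_real_of_nat del: ennreal_plus)
  finally have "measure Pn E \<le> real n * measure P {x \<in> space P. \<not> good x}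
      + (K * measure Qn E + (1 / K) * (1 + 9 * H) ^ n)"
    using H(2) K by (simp add: Pn.emeasure_eq_measure del: ennreal_plus)
  moreover have "measure (iid P) {X \<in> space (iid P). A X} = measure Pn E"
    using E(2) by (simp add: measure_def)
  moreover have "measure (iid Q) {X \<in> space (iid Q). A X} = measure Qn E"
    using EQ(2) by (simp add: measure_def)
  ultimately show ?thesis by (simp add: good_def not_le)
qed

section \<open>Hellinger differentiability\<close>

lemma regular_param_expansion:
  fixes P :: "'p::euclidean_space \<Rightarrow> 'a measure"
  assumes reg: "regular_param M Th P sc" and th0: "th0 \<in> Th"
  obtains N :: "'a measure" and p where
    "sets N = sets M"
    "\<And>th. th \<in> Th \<Longrightarrow> p th \<in> borel_measurable N"
    "\<And>th x. th \<in> Th \<Longrightarrow> 0 \<le> p th x"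
    "\<And>th. th \<in> Th \<Longrightarrow> P th = density N (\<lambda>x. ennreal (p th x))"
    "\<And>th. th \<in> Th \<Longrightarrow> prob_space (P th)"
    "\<And>th. th \<in> Th \<Longrightarrow> integrable N (p th)"
    "\<And>th. th \<in> Th \<Longrightarrow> (\<integral>x. p th x \<partial>N) = 1"
    "sc th0 \<in> borel_measurable N"
    "integrable N (\<lambda>x. (norm (sc th0 x))\<^sup>2 * p th0 x)"
    "\<And>e. 0 < e \<Longrightarrow> \<exists>d>0. \<forall>h. norm h < d \<longrightarrow> th0 + h \<in> Th \<longrightarrow>
       integrable N (\<lambda>x. (sqrt (p (th0 + h) x) - sqrt (p th0 x) - (1/2) * (h \<bullet> sc th0 x) * sqrt (p th0 x))\<^sup>2)
       \<and> (\<integral>x. (sqrt (p (th0 + h) x) - sqrt (p th0 x) - (1/2) * (h \<bullet> sc th0 x) * sqrt (p th0 x))\<^sup>2 \<partial>N) \<le> (e * norm h)\<^sup>2"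
proof -
  from reg obtain N :: "'a measure" and p where
    N: "sets N = sets M" and
    p: "\<forall>th\<in>Th. p th \<in> borel_measurable N \<and> (\<forall>x. 0 \<le> p th x) \<and>
                  P th = density N (\<lambda>x. ennreal (p th x)) \<and> prob_space (P th)" and
    sc: "\<forall>th\<in>Th. L2v (P th) (sc th)" and
    diff: "\<forall>th0\<in>Th. \<forall>e>0. \<exists>d>0. \<forall>h. norm h < d \<and> th0 + h \<in> Th \<longrightarrow>
            (\<integral>\<^sup>+x. ennreal ((sqrt (p (th0 + h) x) - sqrt (p th0 x)
                     - (1/2) * (h \<bullet> sc th0 x) * sqrt (p th0 x))\<^sup>2) \<partial>N)
              \<le> ennreal ((e * norm h)\<^sup>2)"
    unfolding regular_param_def by blast
  have meas: "p th \<in> borel_measurable N" and nonneg: "\<And>x. 0 \<le> p th x"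
    and dens: "P th = density N (\<lambda>x. ennreal (p th x))" and prob: "prob_space (P th)" if "th \<in> Th" for th
    using p that by auto
  have mass: "(\<integral>\<^sup>+x. ennreal (p th x) \<partial>N) = 1" if "th \<in> Th" for th
  proof -
    interpret prob_space "P th" by (rule prob[OF that])
    show ?thesis
      using emeasure_space_1 meas[OF that] unfolding dens[OF that]
      by (simp add: emeasure_density cong: nn_integral_cong)
  qed
  have int: "has_bochner_integral N (p th) 1" if "th \<in> Th" for th
    by (rule has_bochner_integral_nn_integral) (use meas[OF that] nonneg[OF that] mass[OF that] in auto)
  have scm: "sc th0 \<in> borel_measurable N"
  proof -
    have "sc th0 \<in> borel_measurable (P th0)" using sc th0 by (auto simp: L2v_def)
    then show ?thesis unfolding dens[OF th0] by simp
  qed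
  have sc2: "integrable N (\<lambda>x. (norm (sc th0 x))\<^sup>2 * p th0 x)"
  proof (rule integrableI_bounded)
    show "(\<lambda>x. (norm (sc th0 x))\<^sup>2 * p th0 x) \<in> borel_measurable N"
      using scm meas[OF th0] by measurable
    have "(\<integral>\<^sup>+x. ennreal (norm ((norm (sc th0 x))\<^sup>2 * p th0 x)) \<partial>N) = (\<integral>\<^sup>+x. ennreal ((norm (sc th0 x))\<^sup>2) \<partial>P th0)"
      unfolding dens[OF th0] using scm meas[OF th0] nonneg[OF th0]
      by (subst nn_integral_density) (auto simp: ennreal_mult[symmetric] mult.commute abs_mult)
    also have "\<dots> < \<infinity>" using sc th0 by (auto simp: L2v_def)
    finally show "(\<integral>\<^sup>+x. ennreal (norm ((norm (sc th0 x))\<^sup>2 * p th0 x)) \<partial>N) < \<infinity>" .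
  qed
  have R: "\<exists>d>0. \<forall>h. norm h < d \<longrightarrow> th0 + h \<in> Th \<longrightarrow>
       integrable N (\<lambda>x. (sqrt (p (th0 + h) x) - sqrt (p th0 x) - (1/2) * (h \<bullet> sc th0 x) * sqrt (p th0 x))\<^sup>2)
       \<and> (\<integral>x. (sqrt (p (th0 + h) x) - sqrt (p th0 x) - (1/2) * (h \<bullet> sc th0 x) * sqrt (p th0 x))\<^sup>2 \<partial>N) \<le> (e * norm h)\<^sup>2"
    if e: "0 < e" for e
  proof -
    from diff th0 e obtain d where d: "d > 0" and dh: "\<And>h. norm h < d \<Longrightarrow> th0 + h \<in> Th \<Longrightarrow>
            (\<integral>\<^sup>+x. ennreal ((sqrt (p (th0 + h) x) - sqrt (p th0 x)
                     - (1/2) * (h \<bullet> sc th0 x) * sqrt (p th0 x))\<^sup>2) \<partial>N)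
              \<le> ennreal ((e * norm h)\<^sup>2)" by blast
    show ?thesis
    proof (intro exI[of _ d] conjI d allI impI)
      fix h assume h: "norm h < d" "th0 + h \<in> Th"
      let ?R = "\<lambda>x. (sqrt (p (th0 + h) x) - sqrt (p th0 x) - (1/2) * (h \<bullet> sc th0 x) * sqrt (p th0 x))\<^sup>2"
      have m: "?R \<in> borel_measurable N"
        using meas[OF th0] meas[OF h(2)] scm by measurable
      show i: "integrable N ?R"
        by (rule integrableI_bounded[OF m]) (use dh[OF h] in \<open>auto intro: le_less_trans\<close>)
      have "ennreal (integral\<^sup>L N ?R) \<le> ennreal ((e * norm h)\<^sup>2)"
        using dh[OF h] nn_integral_eq_integral[OF i] by simp
      then show "integral\<^sup>L N ?R \<le> (e * norm h)\<^sup>2" by simp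
    qed
  qed
  show thesis
    using that[OF N meas nonneg dens prob _ _ scm sc2 R] int by (auto simp: has_bochner_integral_iff)
qed

lemma sq_add3_le: "(a + b + c)\<^sup>2 \<le> 3 * a\<^sup>2 + 3 * b\<^sup>2 + 3 * (c::real)\<^sup>2"
  using sum_squares_bound[of a b] sum_squares_bound[of a c] sum_squares_bound[of b c]
  by (simp add: power2_eq_square algebra_simps)

lemma sq_add2_le: "(a + b)\<^sup>2 \<le> 2 * a\<^sup>2 + 2 * (b::real)\<^sup>2"
  using sum_squares_bound[of a b] by (simp add: power2_eq_square algebra_simps)

text \<open>Dominated convergence along integer levels. With \<open>f\<close> the squared norm of
  the score and \<open>w\<close> the density at \<open>th0\<close>, this bounds the part of the
  second moment of the score that comes from large score values.\<close>

lemma integrable_tail_small: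
  fixes f w :: "'a \<Rightarrow> real"
  assumes "integrable N (\<lambda>x. f x * w x)" and [measurable]: "f \<in> borel_measurable N"
    and "0 < e"
  shows "\<exists>K>0. (\<integral>x. (if f x > K then f x * w x else 0) \<partial>N) < e"
proof -
  have [measurable]: "(\<lambda>x. f x * w x) \<in> borel_measurable N" using assms(1) by simp
  have "(\<lambda>k. \<integral>x. (if f x > real k then f x * w x else 0) \<partial>N) \<longlonglongrightarrow> (\<integral>x. 0 \<partial>N)"
  proof (rule integral_dominated_convergence[where w="\<lambda>x. \<bar>f x * w x\<bar>"])
    show "AE x in N. (\<lambda>k. if f x > real k then f x * w x else 0) \<longlonglongrightarrow> 0"
    proof (rule AE_I2)
      fix x
      have "eventually (\<lambda>k. real k > f x) sequentially"
        using filterlim_real_sequentially by (auto simp: filterlim_at_top_dense)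
      then show "(\<lambda>k. if f x > real k then f x * w x else 0) \<longlonglongrightarrow> 0"
        by (intro tendsto_eventually, eventually_elim) simp
    qed
  qed (use assms(1) in auto)
  then have "eventually (\<lambda>k. (\<integral>x. (if f x > real k then f x * w x else 0) \<partial>N) < e) sequentially"
    using assms(3) by (intro order_tendstoD(2)) auto
  then have "eventually (\<lambda>k. (\<integral>x. (if f x > real k then f x * w x else 0) \<partial>N) < e \<and> k > 0) sequentially"
    using eventually_gt_at_top[of 0] by eventually_elim simp
  then obtain k where "(\<integral>x. (if f x > real k then f x * w x else 0) \<partial>N) < e" "k > 0"
    by (auto simp: eventually_sequentially)
  then show ?thesis by (intro exI[of _ "real k"]) auto
qed

text \<open>The first bound is the triangle inequality through the expansion at \<open>th0\<close>.
  The second must beat the order of the first. On the set \<open>A\<close> where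
  \<open>p(th0 + h) > 4 p(th0 + k)\<close>, the density \<open>p(th0 + h)\<close> is at most four
  times the squared difference of the roots; its remainder part is small by differentiability, and
  its linear part is a multiple of \<open>(norm h + norm k)^2\<close> times the integral of
  \<open>f w\<close> over \<open>A\<close>. That integral is small: where \<open>f > K\<close> by
  integrability of \<open>f w\<close>, and where \<open>f \<le> K\<close> because \<open>A\<close>
  has small mass under \<open>w\<close>, as the roots at \<open>th0 + h\<close> and
  \<open>th0 + k\<close> are both close to \<open>sqrt w\<close> in L2 but far from each other on
  \<open>A\<close>.\<close>

lemma regular_param_hellinger_local:
  fixes P :: "'p::euclidean_space \<Rightarrow> 'a measure"
  assumes reg: "regular_param M Th P sc" and th0: "th0 \<in> Th"
  obtains N :: "'a measure" and p H where
    "sets N = sets M"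
    "\<And>th. th \<in> Th \<Longrightarrow> p th \<in> borel_measurable N"
    "\<And>th x. th \<in> Th \<Longrightarrow> 0 \<le> p th x"
    "\<And>th. th \<in> Th \<Longrightarrow> P th = density N (\<lambda>x. ennreal (p th x))"
    "\<And>th. th \<in> Th \<Longrightarrow> prob_space (P th)"
    "0 \<le> H"
    "\<And>e. 0 < e \<Longrightarrow> \<exists>d>0. \<forall>h k. norm h < d \<longrightarrow> norm k < d \<longrightarrow> th0 + h \<in> Th \<longrightarrow> th0 + k \<in> Th \<longrightarrow>
       (\<integral>\<^sup>+x. ennreal ((sqrt (p (th0 + h) x) - sqrt (p (th0 + k) x))\<^sup>2) \<partial>N)
         \<le> ennreal (H * (norm h + norm k)\<^sup>2) \<and>
       measure (P (th0 + h)) {x \<in> space (P (th0 + h)). 4 * p (th0 + k) x < p (th0 + h) x}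
         \<le> e * (norm h + norm k)\<^sup>2"
proof -
  from regular_param_expansion[OF reg th0] obtain N :: "'a measure" and p where
    N: "sets N = sets M"
    and meas: "\<And>th. th \<in> Th \<Longrightarrow> p th \<in> borel_measurable N"
    and nonneg: "\<And>th x. th \<in> Th \<Longrightarrow> 0 \<le> p th x"
    and dens: "\<And>th. th \<in> Th \<Longrightarrow> P th = density N (\<lambda>x. ennreal (p th x))"
    and prob: "\<And>th. th \<in> Th \<Longrightarrow> prob_space (P th)"
    and int: "\<And>th. th \<in> Th \<Longrightarrow> integrable N (p th)"
    and mass: "\<And>th. th \<in> Th \<Longrightarrow> (\<integral>x. p th x \<partial>N) = 1"
    and scm: "sc th0 \<in> borel_measurable N"
    and sc2: "integrable N (\<lambda>x. (norm (sc th0 x))\<^sup>2 * p th0 x)"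
    and R: "\<And>e. 0 < e \<Longrightarrow> \<exists>d>0. \<forall>h. norm h < d \<longrightarrow> th0 + h \<in> Th \<longrightarrow>
       integrable N (\<lambda>x. (sqrt (p (th0 + h) x) - sqrt (p th0 x) - (1/2) * (h \<bullet> sc th0 x) * sqrt (p th0 x))\<^sup>2)
       \<and> (\<integral>x. (sqrt (p (th0 + h) x) - sqrt (p th0 x) - (1/2) * (h \<bullet> sc th0 x) * sqrt (p th0 x))\<^sup>2 \<partial>N) \<le> (e * norm h)\<^sup>2"
    by (rule regular_param_expansion[OF reg th0], rule that, assumption+)
  define f where "f x = (norm (sc th0 x))\<^sup>2" for x
  define w where "w = p th0"
  define W where "W = (\<integral>x. f x * w x \<partial>N)"
  define D where "D h x = (1/2) * (h \<bullet> sc th0 x) * sqrt (w x)" for h x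
  define S where "S h x = sqrt (p (th0 + h) x)" for h x
  define Rm where "Rm h x = S h x - sqrt (w x) - D h x" for h x
  have w_nonneg: "0 \<le> w x" for x using nonneg[OF th0] by (simp add: w_def)
  have f_nonneg: "0 \<le> f x" for x by (simp add: f_def)
  have [measurable]: "f \<in> borel_measurable N" "w \<in> borel_measurable N"
    using scm meas[OF th0] by (auto simp: f_def[abs_def] w_def)
  have fw: "integrable N (\<lambda>x. f x * w x)" using sc2 by (simp add: f_def w_def)
  have W: "0 \<le> W" unfolding W_def by (intro integral_nonneg_AE) (auto simp: f_nonneg w_nonneg)
  have Dsq: "(D h x)\<^sup>2 \<le> (1/4) * (norm h)\<^sup>2 * (f x * w x)" for h x
  proof -
    have "(h \<bullet> sc th0 x)\<^sup>2 \<le> (norm h)\<^sup>2 * f x"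
      using Cauchy_Schwarz_ineq[of h "sc th0 x"] by (simp add: f_def power2_norm_eq_inner)
    then have "(h \<bullet> sc th0 x)\<^sup>2 * w x \<le> (norm h)\<^sup>2 * f x * w x"
      using w_nonneg by (rule mult_right_mono)
    moreover have "(D h x)\<^sup>2 = (1/4) * ((h \<bullet> sc th0 x)\<^sup>2 * w x)"
      using w_nonneg[of x] by (simp add: D_def power_mult_distrib power_divide)
    ultimately show ?thesis by (simp add: mult.assoc)
  qed
  have R': "\<exists>d>0. \<forall>h. norm h < d \<longrightarrow> th0 + h \<in> Th \<longrightarrow>
       integrable N (\<lambda>x. (Rm h x)\<^sup>2) \<and> (\<integral>x. (Rm h x)\<^sup>2 \<partial>N) \<le> (e * norm h)\<^sup>2" if "0 < e" for e
    using R[OF that] unfolding Rm_def S_def D_def w_def .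
  have diff: "(S h x - S k x)\<^sup>2 \<le> 3 * (Rm h x)\<^sup>2 + 3 * (Rm k x)\<^sup>2 + 3/4 * (norm h + norm k)\<^sup>2 * (f x * w x)" for h k x
  proof -
    have "S h x - S k x = Rm h x + (- Rm k x) + D (h - k) x"
      by (simp add: Rm_def D_def inner_diff_left algebra_simps)
    then have "(S h x - S k x)\<^sup>2 \<le> 3 * (Rm h x)\<^sup>2 + 3 * (Rm k x)\<^sup>2 + 3 * (D (h - k) x)\<^sup>2"
      using sq_add3_le[of "Rm h x" "- Rm k x" "D (h - k) x"] by simp
    moreover have "(norm (h - k))\<^sup>2 * (f x * w x) \<le> (norm h + norm k)\<^sup>2 * (f x * w x)"
      by (intro mult_right_mono power_mono norm_triangle_ineq4) (auto simp: f_nonneg w_nonneg)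
    ultimately show ?thesis using Dsq[of "h - k" x] by simp
  qed
  have near: "(S h x - sqrt (w x))\<^sup>2 \<le> 2 * (Rm h x)\<^sup>2 + 1/2 * (norm h)\<^sup>2 * (f x * w x)" for h x
    using sq_add2_le[of "Rm h x" "D h x"] Dsq[of h x] by (simp add: Rm_def)
  have Smeas: "S h \<in> borel_measurable N" if "th0 + h \<in> Th" for h
    using meas[OF that] unfolding S_def by measurable
  \<comment> \<open>From integrating \<open>diff\<close>: the remainders contribute at most 3 once
    \<open>e1 \<le> 1\<close>, the linear terms at most \<open>3/4 * W\<close>.\<close>
  define H where "H = 3 + W"

  have main: "\<exists>d>0. \<forall>h k. norm h < d \<longrightarrow> norm k < d \<longrightarrow> th0 + h \<in> Th \<longrightarrow> th0 + k \<in> Th \<longrightarrow>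
       (\<integral>\<^sup>+x. ennreal ((sqrt (p (th0 + h) x) - sqrt (p (th0 + k) x))\<^sup>2) \<partial>N)
         \<le> ennreal (H * (norm h + norm k)\<^sup>2) \<and>
       measure (P (th0 + h)) {x \<in> space (P (th0 + h)). 4 * p (th0 + k) x < p (th0 + h) x}
         \<le> e * (norm h + norm k)\<^sup>2" if e: "0 < e" for e
  proof -
    \<comment> \<open>Division of \<open>e\<close>. Four times the bound \<open>diff\<close> gives
      each remainder the factor 12, and \<open>12 * e1^2\<close> is at most \<open>e / 2\<close>.
      The linear part has the factor 3 before the integral of \<open>f w\<close> over
      \<open>A\<close>, which may therefore be \<open>e / 6\<close>: one \<open>e / 12\<close> for
      \<open>f > K\<close> by the choice of \<open>K\<close>, another for \<open>f \<le> K\<close>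
      by the choice of \<open>d\<close>.\<close>
    define e1 where "e1 = min 1 (sqrt (e / 24))"
    have e1: "0 < e1" "e1 \<le> 1" using e by (auto simp: e1_def)
    have "e1\<^sup>2 \<le> (sqrt (e / 24))\<^sup>2" using e1 by (intro power_mono) (auto simp: e1_def)
    then have e1sq: "12 * e1\<^sup>2 \<le> e / 2" using e by simp
    obtain K where K: "K > 0" "(\<integral>x. (if f x > K then f x * w x else 0) \<partial>N) < e / 12"
      using integrable_tail_small[OF fw, of "e / 12"] e by auto
    obtain d1 where d1: "d1 > 0" and Rd: "\<And>h. norm h < d1 \<Longrightarrow> th0 + h \<in> Th \<Longrightarrow>
        integrable N (\<lambda>x. (Rm h x)\<^sup>2) \<and> (\<integral>x. (Rm h x)\<^sup>2 \<partial>N) \<le> (e1 * norm h)\<^sup>2"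
      using R'[OF e1(1)] by blast
    define d where "d = min d1 (sqrt (e / (120 * K * (2 + W))))"
    have pos: "0 < e / (120 * K * (2 + W))" using e K(1) W by (intro divide_pos_pos mult_pos_pos) auto
    have d: "d > 0" "d \<le> d1" using d1 pos by (auto simp: d_def)
    have "d\<^sup>2 \<le> (sqrt (e / (120 * K * (2 + W))))\<^sup>2" using d(1) by (intro power_mono) (auto simp: d_def)
    then have dsq: "K * (10 * (2 + W) * d\<^sup>2) \<le> e / 12"
    proof -
      have "0 < 120 * K * (2 + W)" using K(1) W by (intro mult_pos_pos) auto
      then have "d\<^sup>2 * (120 * K * (2 + W)) \<le> e"
        using \<open>d\<^sup>2 \<le> _\<close> pos by (simp only: real_sqrt_pow2[OF less_imp_le] pos_le_divide_eq)
      moreover have "K * (10 * (2 + W) * d\<^sup>2) = d\<^sup>2 * (120 * K * (2 + W)) / 12" by simp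
      ultimately show ?thesis by linarith
    qed
    show ?thesis
    proof (intro exI[of _ d] conjI d(1) allI impI)
      fix h k :: 'p assume h: "norm h < d" "th0 + h \<in> Th" and k: "norm k < d" "th0 + k \<in> Th"
      have Rh: "integrable N (\<lambda>x. (Rm h x)\<^sup>2)" "(\<integral>x. (Rm h x)\<^sup>2 \<partial>N) \<le> (e1 * norm h)\<^sup>2"
        and Rk: "integrable N (\<lambda>x. (Rm k x)\<^sup>2)" "(\<integral>x. (Rm k x)\<^sup>2 \<partial>N) \<le> (e1 * norm k)\<^sup>2"
        using Rd[of h] Rd[of k] h k d(2) by auto
      have [measurable]: "S h \<in> borel_measurable N" "S k \<in> borel_measurable N"
        using Smeas h k by auto
      have S_nonneg: "0 \<le> S h x" "0 \<le> S k x" for x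
        using nonneg[OF h(2)] nonneg[OF k(2)] by (auto simp: S_def)
      define b where "b x = 3 * (Rm h x)\<^sup>2 + 3 * (Rm k x)\<^sup>2 + 3/4 * (norm h + norm k)\<^sup>2 * (f x * w x)" for x
      have bi: "integrable N b" unfolding b_def using Rh Rk fw by (intro Bochner_Integration.integrable_add) auto
      have hk2: "(norm h)\<^sup>2 + (norm k)\<^sup>2 \<le> (norm h + norm k)\<^sup>2"
        by (simp add: power2_sum)
      have e1le: "(e1 * norm h)\<^sup>2 + (e1 * norm k)\<^sup>2 \<le> e1\<^sup>2 * (norm h + norm k)\<^sup>2"
        using hk2 by (simp add: power_mult_distrib distrib_left[symmetric] mult_left_mono)
      have "e1\<^sup>2 * (norm h + norm k)\<^sup>2 \<le> 1 * (norm h + norm k)\<^sup>2"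
        using e1 by (intro mult_right_mono) (auto simp: power_le_one)
      then have e1le1: "(e1 * norm h)\<^sup>2 + (e1 * norm k)\<^sup>2 \<le> (norm h + norm k)\<^sup>2" using e1le by simp
      have bint: "integral\<^sup>L N b = 3 * (\<integral>x. (Rm h x)\<^sup>2 \<partial>N) + 3 * (\<integral>x. (Rm k x)\<^sup>2 \<partial>N) + 3/4 * (norm h + norm k)\<^sup>2 * W"
        unfolding b_def W_def using Rh Rk fw by simp
      have "integral\<^sup>L N b \<le> 3 * (norm h + norm k)\<^sup>2 + 3/4 * (norm h + norm k)\<^sup>2 * W"
        using bint Rh(2) Rk(2) e1le1 by linarith
      also have "\<dots> \<le> H * (norm h + norm k)\<^sup>2"
        using W by (simp add: H_def algebra_simps mult_left_mono)
      finally have bH: "integral\<^sup>L N b \<le> H * (norm h + norm k)\<^sup>2" .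
      have b_nonneg: "0 \<le> b x" for x unfolding b_def using f_nonneg w_nonneg by auto
      have "(\<integral>\<^sup>+x. ennreal ((S h x - S k x)\<^sup>2) \<partial>N) \<le> (\<integral>\<^sup>+x. ennreal (b x) \<partial>N)"
        using diff[of h _ k] by (intro nn_integral_mono ennreal_leI) (auto simp: b_def)
      also have "\<dots> = ennreal (integral\<^sup>L N b)"
        using bi b_nonneg by (intro nn_integral_eq_integral) auto
      also have "\<dots> \<le> ennreal (H * (norm h + norm k)\<^sup>2)" using bH by (rule ennreal_leI)
      finally show "(\<integral>\<^sup>+x. ennreal ((sqrt (p (th0 + h) x) - sqrt (p (th0 + k) x))\<^sup>2) \<partial>N)
         \<le> ennreal (H * (norm h + norm k)\<^sup>2)" by (simp add: S_def)

      define A where "A x \<longleftrightarrow> 2 * S k x < S h x" for x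
      have [measurable]: "Measurable.pred N A" unfolding A_def by measurable
      have A_iff: "4 * p (th0 + k) x < p (th0 + h) x \<longleftrightarrow> A x" for x
      proof -
        have "A x \<longleftrightarrow> sqrt (4 * p (th0 + k) x) < sqrt (p (th0 + h) x)"
          by (simp add: A_def S_def real_sqrt_mult)
        then show ?thesis by simp
      qed
      have tail: "(\<integral>x. (if A x then f x * w x else 0) \<partial>N) \<le> e / 6"
      proof -
        define c where "c x = 4 * K * (Rm h x)\<^sup>2 + 16 * K * (Rm k x)\<^sup>2
            + K * ((norm h)\<^sup>2 + 4 * (norm k)\<^sup>2) * (f x * w x)" for x
        have c_eq: "c x = K * (2 * (2 * (Rm h x)\<^sup>2 + 1/2 * (norm h)\<^sup>2 * (f x * w x))
            + 8 * (2 * (Rm k x)\<^sup>2 + 1/2 * (norm k)\<^sup>2 * (f x * w x)))" for x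
          by (simp add: c_def algebra_simps)
        have ci: "integrable N c" unfolding c_def using Rh Rk fw
          by (intro Bochner_Integration.integrable_add integrable_mult_right) auto
        have "integral\<^sup>L N c = 4 * K * (\<integral>x. (Rm h x)\<^sup>2 \<partial>N) + 16 * K * (\<integral>x. (Rm k x)\<^sup>2 \<partial>N)
            + K * ((norm h)\<^sup>2 + 4 * (norm k)\<^sup>2) * W"
          unfolding c_def W_def using Rh Rk fw by simp
        then have cint: "integral\<^sup>L N c = K * (2 * (2 * (\<integral>x. (Rm h x)\<^sup>2 \<partial>N) + 1/2 * (norm h)\<^sup>2 * W)
            + 8 * (2 * (\<integral>x. (Rm k x)\<^sup>2 \<partial>N) + 1/2 * (norm k)\<^sup>2 * W))"
          by (simp add: algebra_simps)
        have ti: "integrable N (\<lambda>x. if f x > K then f x * w x else 0)"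
          by (rule Bochner_Integration.integrable_bound[OF fw]) auto
        have tA: "integrable N (\<lambda>x. if A x then f x * w x else 0)"
          by (rule Bochner_Integration.integrable_bound[OF fw]) auto
        have "(\<integral>x. (if A x then f x * w x else 0) \<partial>N) \<le> (\<integral>x. c x + (if f x > K then f x * w x else 0) \<partial>N)"
        proof (rule integral_mono[OF tA Bochner_Integration.integrable_add[OF ci ti]])
          fix x
          have c0: "0 \<le> c x" unfolding c_def using K(1) f_nonneg w_nonneg by (intro add_nonneg_nonneg mult_nonneg_nonneg) auto
          show "(if A x then f x * w x else 0) \<le> c x + (if f x > K then f x * w x else 0)"
          proof (cases "A x \<and> f x \<le> K")
            case True
            \<comment> \<open>Write \<open>u = sqrt (w x)\<close>. If
              \<open>2 * S k x < S h x\<close>, then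
              \<open>u < (S h x - u) - 2 * (S k x - u)\<close>: the two roots cannot both be near
              \<open>u\<close> unless \<open>u\<close> is small. So \<open>w\<close> on
              \<open>A\<close> is controlled by squared deviations, which integrate to the order of
              \<open>d^2\<close>.\<close>
            have "sqrt (w x) \<le> \<bar>S h x - sqrt (w x)\<bar> + 2 * \<bar>S k x - sqrt (w x)\<bar>"
              proof -
              have "u \<le> \<bar>a - u\<bar> + 2 * \<bar>b - u\<bar>" if "2 * b < a" for a b u :: real
                using that by (smt (verit))
              with True show ?thesis unfolding A_def by blast
            qed
            then have "(sqrt (w x))\<^sup>2 \<le> (\<bar>S h x - sqrt (w x)\<bar> + 2 * \<bar>S k x - sqrt (w x)\<bar>)\<^sup>2"
              using w_nonneg by (intro power_mono) auto
            also have "\<dots> \<le> 2 * (S h x - sqrt (w x))\<^sup>2 + 8 * (S k x - sqrt (w x))\<^sup>2"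
              using sq_add2_le[of "\<bar>S h x - sqrt (w x)\<bar>" "2 * \<bar>S k x - sqrt (w x)\<bar>"] by (simp add: power_mult_distrib)
            also have "\<dots> \<le> 2 * (2 * (Rm h x)\<^sup>2 + 1/2 * (norm h)\<^sup>2 * (f x * w x))
              + 8 * (2 * (Rm k x)\<^sup>2 + 1/2 * (norm k)\<^sup>2 * (f x * w x))"
              using near[of h x] near[of k x] by (intro add_mono mult_left_mono) auto
            finally have "K * w x \<le> c x" unfolding c_eq using K(1) w_nonneg[of x] by (intro mult_left_mono) auto
            moreover have "f x * w x \<le> K * w x" using True w_nonneg by (intro mult_right_mono) auto
            ultimately show ?thesis using True by simp
          next
            case False
            then show ?thesis using c0 f_nonneg[of x] w_nonneg[of x] by auto
          qed
        qed
        also have "\<dots> = integral\<^sup>L N c + (\<integral>x. (if f x > K then f x * w x else 0) \<partial>N)"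
          using ci ti by simp
        also have "integral\<^sup>L N c \<le> K * (10 * (2 + W) * d\<^sup>2)"
          unfolding cint
        proof (rule mult_left_mono)
          have hd: "(norm h)\<^sup>2 \<le> d\<^sup>2" "(norm k)\<^sup>2 \<le> d\<^sup>2" using h k by (auto intro!: power_mono)
          have e1d: "(e1 * norm y)\<^sup>2 \<le> d\<^sup>2" if "norm y < d" for y :: 'p
          proof -
            have "e1 * norm y \<le> 1 * norm y" using e1 by (intro mult_right_mono) auto
            then show ?thesis using that e1 by (intro power_mono) auto
          qed
          have "(norm h)\<^sup>2 * W \<le> d\<^sup>2 * W" "(norm k)\<^sup>2 * W \<le> d\<^sup>2 * W"
            using hd W by (auto intro!: mult_right_mono)
          moreover have "0 \<le> d\<^sup>2 * W" using W by simp
          ultimately have "2 * (2 * (\<integral>x. (Rm h x)\<^sup>2 \<partial>N) + 1/2 * (norm h)\<^sup>2 * W)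
            + 8 * (2 * (\<integral>x. (Rm k x)\<^sup>2 \<partial>N) + 1/2 * (norm k)\<^sup>2 * W) \<le> 20 * d\<^sup>2 + 10 * (d\<^sup>2 * W)"
            using Rh(2) Rk(2) e1d[OF h(1)] e1d[OF k(1)] by (simp add: algebra_simps)
          then show "2 * (2 * (\<integral>x. (Rm h x)\<^sup>2 \<partial>N) + 1/2 * (norm h)\<^sup>2 * W)
            + 8 * (2 * (\<integral>x. (Rm k x)\<^sup>2 \<partial>N) + 1/2 * (norm k)\<^sup>2 * W) \<le> 10 * (2 + W) * d\<^sup>2"
            by (simp add: algebra_simps)
        qed (use K in simp)
        finally show ?thesis using dsq K(2) by simp
      qed
      have fA: "integrable N (\<lambda>x. if A x then f x * w x else 0)"
        by (rule Bochner_Integration.integrable_bound[OF fw]) auto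
      define g where "g x = 12 * (Rm h x)\<^sup>2 + 12 * (Rm k x)\<^sup>2
          + 3 * (norm h + norm k)\<^sup>2 * (if A x then f x * w x else 0)" for x
      have gi: "integrable N g" unfolding g_def using Rh Rk fA
        by (intro Bochner_Integration.integrable_add integrable_mult_right) auto
      have gint: "integral\<^sup>L N g = 12 * (\<integral>x. (Rm h x)\<^sup>2 \<partial>N) + 12 * (\<integral>x. (Rm k x)\<^sup>2 \<partial>N)
          + 3 * (norm h + norm k)\<^sup>2 * (\<integral>x. (if A x then f x * w x else 0) \<partial>N)"
        unfolding g_def using Rh Rk fA by simp
      have "3 * (norm h + norm k)\<^sup>2 * (\<integral>x. (if A x then f x * w x else 0) \<partial>N) \<le> 3 * (norm h + norm k)\<^sup>2 * (e / 6)"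
        using tail by (intro mult_left_mono) auto
      moreover have "12 * (e1\<^sup>2 * (norm h + norm k)\<^sup>2) \<le> e / 2 * (norm h + norm k)\<^sup>2"
        using e1sq by (simp add: mult.assoc[symmetric] mult_right_mono)
      ultimately have gle: "integral\<^sup>L N g \<le> e * (norm h + norm k)\<^sup>2"
        using gint Rh(2) Rk(2) e1le by (simp add: algebra_simps)
      have g_nonneg: "0 \<le> g x" for x unfolding g_def using f_nonneg w_nonneg by auto
      have "emeasure (P (th0 + h)) {x \<in> space (P (th0 + h)). 4 * p (th0 + k) x < p (th0 + h) x}
         = (\<integral>\<^sup>+x. ennreal (p (th0 + h) x) * indicator {x \<in> space N. A x} x \<partial>N)"
        unfolding dens[OF h(2)] A_iff using meas[OF h(2)] by (subst emeasure_density) auto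
      also have "\<dots> \<le> (\<integral>\<^sup>+x. ennreal (g x) \<partial>N)"
      proof (rule nn_integral_mono)
        fix x assume x: "x \<in> space N"
        show "ennreal (p (th0 + h) x) * indicator {x \<in> space N. A x} x \<le> ennreal (g x)"
        proof (cases "A x")
          case True
          have "S h x \<le> 2 * (S h x - S k x)" using True by (simp add: A_def)
          then have "(S h x)\<^sup>2 \<le> (2 * (S h x - S k x))\<^sup>2" using S_nonneg by (intro power_mono) auto
          moreover have "(2 * (S h x - S k x))\<^sup>2 = 4 * (S h x - S k x)\<^sup>2"
            by (simp add: power2_eq_square algebra_simps)
          moreover have "(S h x)\<^sup>2 = p (th0 + h) x"
            using nonneg[OF h(2), of x] by (simp add: S_def)
          ultimately have "p (th0 + h) x \<le> 4 * (S h x - S k x)\<^sup>2" by simp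
          then have "p (th0 + h) x \<le> g x" using diff[of h x k] True by (simp add: g_def)
          then show ?thesis using True x by (simp add: ennreal_leI)
        qed simp
      qed
      also have "\<dots> = ennreal (integral\<^sup>L N g)"
        using gi g_nonneg by (intro nn_integral_eq_integral) auto
      also have "\<dots> \<le> ennreal (e * (norm h + norm k)\<^sup>2)" using gle by (rule ennreal_leI)
      finally show "measure (P (th0 + h)) {x \<in> space (P (th0 + h)). 4 * p (th0 + k) x < p (th0 + h) x}
         \<le> e * (norm h + norm k)\<^sup>2"
        using e by (simp add: finite_measure.emeasure_eq_measure[OF prob_space.finite_measure[OF prob[OF h(2)]]])
    qed
  qed
  show thesis
    by (rule that[OF N meas nonneg dens prob _ main]) (use W in \<open>auto simp: H_def\<close>)
qed

text \<open>For root-n sequences the squared Hellinger distance is O(1/n), so the second-moment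
  factor is bounded by an exponential that does not depend on \<open>n\<close>. The truncation level
  can thus be fixed first, and the hypothesis on \<open>ths'\<close> used afterwards with that
  level.\<close>

lemma regular_param_contiguity:
  fixes P :: "'p::euclidean_space \<Rightarrow> 'a measure"
  assumes reg: "regular_param M Th P sc" and th0: "th0 \<in> Th"
    and ths: "root_n_seq Th th0 ths" and ths': "root_n_seq Th th0 ths'"
    and A: "\<And>n. Measurable.pred (iid M) (A n)"
    and A_local: "\<And>n X Y. (\<And>i. i < n \<Longrightarrow> X i = Y i) \<Longrightarrow> A n X = A n Y"
    and lim: "(\<lambda>n. measure (iid (P (ths' n))) {X \<in> space (iid (P (ths' n))). A n X}) \<longlonglongrightarrow> 0"
  shows "(\<lambda>n. measure (iid (P (ths n))) {X \<in> space (iid (P (ths n))). A n X}) \<longlonglongrightarrow> 0"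
proof -
  obtain N :: "'a measure" and p H where
    N: "sets N = sets M"
    and meas: "\<And>th. th \<in> Th \<Longrightarrow> p th \<in> borel_measurable N"
    and nonneg: "\<And>th x. th \<in> Th \<Longrightarrow> 0 \<le> p th x"
    and dens: "\<And>th. th \<in> Th \<Longrightarrow> P th = density N (\<lambda>x. ennreal (p th x))"
    and prob: "\<And>th. th \<in> Th \<Longrightarrow> prob_space (P th)"
    and H: "0 \<le> H"
    and loc: "\<And>e. 0 < e \<Longrightarrow> \<exists>d>0. \<forall>h k. norm h < d \<longrightarrow> norm k < d \<longrightarrow> th0 + h \<in> Th \<longrightarrow> th0 + k \<in> Th \<longrightarrow>
       (\<integral>\<^sup>+x. ennreal ((sqrt (p (th0 + h) x) - sqrt (p (th0 + k) x))\<^sup>2) \<partial>N)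
         \<le> ennreal (H * (norm h + norm k)\<^sup>2) \<and>
       measure (P (th0 + h)) {x \<in> space (P (th0 + h)). 4 * p (th0 + k) x < p (th0 + h) x}
         \<le> e * (norm h + norm k)\<^sup>2"
    by (rule regular_param_hellinger_local[OF reg th0], rule that, assumption+)
  obtain C1 C2 where C: "\<And>n. sqrt (real n) * norm (ths n - th0) \<le> C1" "\<And>n. sqrt (real n) * norm (ths' n - th0) \<le> C2"
    and Th: "\<And>n. ths n \<in> Th" "\<And>n. ths' n \<in> Th"
    using ths ths' by (auto simp: root_n_seq_def)
  define C where "C = C1 + C2"
  define r where "r n = norm (ths n - th0) + norm (ths' n - th0)" for n
  have r_nonneg: "0 \<le> r n" for n by (simp add: r_def)
  have Cr: "sqrt (real n) * r n \<le> C" for n using C[of n] by (simp add: C_def r_def distrib_left)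
  have C_nonneg: "0 \<le> C" using Cr[of 0] by simp
  have nr: "real n * (r n)\<^sup>2 \<le> C\<^sup>2" for n
  proof -
    have "(sqrt (real n) * r n)\<^sup>2 \<le> C\<^sup>2"
      using Cr[of n] r_nonneg by (intro power_mono) auto
    then show ?thesis by (simp add: power_mult_distrib)
  qed
  have r_lim: "r \<longlonglongrightarrow> 0"
  proof (rule tendsto_sandwich[of "\<lambda>_. 0" _ _ "\<lambda>n. C / sqrt (real n)"])
    show "eventually (\<lambda>n. r n \<le> C / sqrt (real n)) sequentially"
      using eventually_gt_at_top[of 0]
      by eventually_elim (use Cr in \<open>auto simp: field_simps\<close>)
    show "(\<lambda>n. C / sqrt (real n)) \<longlonglongrightarrow> 0"
      by (intro tendsto_divide_0[OF tendsto_const] filterlim_at_top_imp_at_infinity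
          filterlim_compose[OF sqrt_at_top filterlim_real_sequentially])
  qed (auto simp: r_nonneg)
  show ?thesis
  proof (rule LIMSEQ_I)
    fix \<eta> :: real assume \<eta>: "0 < \<eta>"
    \<comment> \<open>Each of the three error terms is to cost at most \<open>\<eta> / 4\<close>.
      \<open>K\<close> settles the second-moment term for all large \<open>n\<close> at once,
      \<open>e\<close> settles the union bound through \<open>n * r n ^ 2 \<le> C^2\<close>, and the
      remaining term needs a probability below \<open>\<eta> / (4 * K)\<close>.\<close>
    define K where "K = 4 * exp (9 * H * C\<^sup>2) / \<eta>"
    have K: "0 < K" using \<eta> by (simp add: K_def)
    define e where "e = \<eta> / (4 * (C\<^sup>2 + 1))"
    have e: "0 < e" using \<eta> by (auto simp: e_def intro!: divide_pos_pos mult_pos_pos add_nonneg_pos)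
    have eC: "e * C\<^sup>2 \<le> \<eta> / 4"
    proof -
      have "e * C\<^sup>2 \<le> e * (C\<^sup>2 + 1)" using e by simp
      also have "\<dots> = \<eta> / 4"
      proof -
        have "\<eta> / (4 * x) * x = \<eta> / 4" if "x \<noteq> 0" for x
          using that by simp
        moreover have "C\<^sup>2 + 1 \<noteq> 0" using zero_le_power2[of C] by linarith
        ultimately show ?thesis unfolding e_def by blast
      qed
      finally show ?thesis .
    qed
    obtain d where d: "d > 0" and dh: "\<And>h k. norm h < d \<Longrightarrow> norm k < d \<Longrightarrow> th0 + h \<in> Th \<Longrightarrow> th0 + k \<in> Th \<Longrightarrow>
       (\<integral>\<^sup>+x. ennreal ((sqrt (p (th0 + h) x) - sqrt (p (th0 + k) x))\<^sup>2) \<partial>N)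
         \<le> ennreal (H * (norm h + norm k)\<^sup>2) \<and>
       measure (P (th0 + h)) {x \<in> space (P (th0 + h)). 4 * p (th0 + k) x < p (th0 + h) x}
         \<le> e * (norm h + norm k)\<^sup>2" using loc[OF e] by blast
    have "eventually (\<lambda>n. r n < d) sequentially"
      using r_lim d by (intro order_tendstoD) auto
    moreover have "eventually (\<lambda>n. measure (iid (P (ths' n))) {X \<in> space (iid (P (ths' n))). A n X} < \<eta> / (4 * K)) sequentially"
      using lim \<eta> K by (intro order_tendstoD) auto
    ultimately have "eventually (\<lambda>n. norm (measure (iid (P (ths n))) {X \<in> space (iid (P (ths n))). A n X} - 0) < \<eta>) sequentially"
    proof eventually_elim
      case (elim n)
      have n: "norm (ths n - th0) < d" "norm (ths' n - th0) < d"
        using elim(1) by (auto simp: r_def intro: le_less_trans[rotated])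
      have hell: "(\<integral>\<^sup>+x. ennreal ((sqrt (p (ths n) x) - sqrt (p (ths' n) x))\<^sup>2) \<partial>N) \<le> ennreal (H * (r n)\<^sup>2)"
        and bad: "measure (P (ths n)) {x \<in> space (P (ths n)). 4 * p (ths' n) x < p (ths n) x} \<le> e * (r n)\<^sup>2"
        using dh[OF n] Th by (simp_all add: r_def)
      have setsP: "sets (P (ths' n)) = sets M" using N Th dens by simp
      have Am: "Measurable.pred (iid (P (ths' n))) (A n)"
        using A[of n] unfolding measurable_cong_sets[OF sets_iid_cong[OF setsP] refl] .
      define a where "a = measure (iid (P (ths n))) {X \<in> space (iid (P (ths n))). A n X}"
      define a' where "a' = measure (iid (P (ths' n))) {X \<in> space (iid (P (ths' n))). A n X}"
      define b where "b = measure (P (ths n)) {x \<in> space (P (ths n)). 4 * p (ths' n) x < p (ths n) x}"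
      have "a \<le> real n * b + K * a' + (1 + 9 * (H * (r n)\<^sup>2)) ^ n / K"
        unfolding a_def a'_def b_def
        by (rule measure_iid_le_of_hellinger[where A="A n" and n=n and N=N and p="p (ths n)" and q="p (ths' n)"
              and P="P (ths n)" and Q="P (ths' n)" and H="H * (r n)\<^sup>2" and K=K,
              OF meas[OF Th(1)] meas[OF Th(2)] nonneg[OF Th(1)] nonneg[OF Th(2)] dens[OF Th(1)] dens[OF Th(2)]
              prob[OF Th(1)] prob[OF Th(2)] hell mult_nonneg_nonneg[OF H zero_le_power2] Am A_local K])
      also have "real n * b \<le> \<eta> / 4"
      proof -
        have "real n * b \<le> real n * (e * (r n)\<^sup>2)"
          using bad unfolding b_def by (rule mult_left_mono) simp
        also have "\<dots> = e * (real n * (r n)\<^sup>2)" by simp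
        also have "\<dots> \<le> e * C\<^sup>2" using nr[of n] e by (intro mult_left_mono) auto
        finally show ?thesis using eC by simp
      qed
      also have "K * a' \<le> \<eta> / 4"
        using elim(2) K unfolding a'_def[symmetric] by (simp add: field_simps)
      also have "(1 + 9 * (H * (r n)\<^sup>2)) ^ n / K \<le> \<eta> / 4"
      proof -
        have "(1 + 9 * (H * (r n)\<^sup>2)) ^ n \<le> exp (9 * (H * (r n)\<^sup>2)) ^ n"
          using H by (intro power_mono exp_ge_add_one_self) auto
        also have "\<dots> = exp (9 * H * (real n * (r n)\<^sup>2))"
          by (simp add: exp_of_nat_mult[symmetric] mult_ac)
        also have "\<dots> \<le> exp (9 * H * C\<^sup>2)"
          using nr[of n] H by (auto intro: mult_left_mono)
        finally have "(1 + 9 * (H * (r n)\<^sup>2)) ^ n / K \<le> exp (9 * H * C\<^sup>2) / K"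
          using K by (intro divide_right_mono) auto
        also have "\<dots> = \<eta> / 4" using \<eta> by (simp add: K_def)
        finally show ?thesis .
      qed
      finally have "a < \<eta>" using \<eta> by simp
      moreover have "0 \<le> a" unfolding a_def by (rule measure_nonneg)
      ultimately have "norm (a - 0) < \<eta>" by simp
      then show ?case unfolding a_def .
    qed
    then show "\<exists>no. \<forall>n\<ge>no. norm (measure (iid (P (ths n))) {X \<in> space (iid (P (ths n))). A n X} - 0) < \<eta>"
      by (simp add: eventually_sequentially)
  qed
qed

section \<open>Scores of regular parametric models have mean zero\<close>

lemma square_integrable_mult:
  fixes f g :: "'a \<Rightarrow> real"
  assumes [measurable]: "f \<in> borel_measurable N" "g \<in> borel_measurable N"
    and "integrable N (\<lambda>x. (f x)\<^sup>2)" "integrable N (\<lambda>x. (g x)\<^sup>2)"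
  shows "integrable N (\<lambda>x. f x * g x)"
proof (rule Bochner_Integration.integrable_bound[OF Bochner_Integration.integrable_add[OF assms(3,4)]])
  have "2 * (\<bar>a\<bar> * \<bar>b\<bar>) \<le> a\<^sup>2 + b\<^sup>2" for a b :: real
    using sum_squares_bound[of "\<bar>a\<bar>" "\<bar>b\<bar>"] by simp
  moreover have "0 \<le> \<bar>a\<bar> * \<bar>b\<bar>" for a b :: real by simp
  ultimately have "\<bar>a\<bar> * \<bar>b\<bar> \<le> a\<^sup>2 + b\<^sup>2" for a b :: real by (smt (verit))
  then show "AE x in N. norm (f x * g x) \<le> norm ((f x)\<^sup>2 + (g x)\<^sup>2)"
    by (simp add: abs_mult)
qed simp

text \<open>Roots of probability densities lie on the unit sphere of L2, so the derivative of the
  curve, half the score times \<open>sqrt p\<close>, is orthogonal to \<open>sqrt p\<close>; this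
  orthogonality is the claim. Openness of \<open>Th\<close> is what allows a step \<open>h\<close>
  in the direction of the mean itself.\<close>

lemma regular_param_score_mean_zero:
  fixes P :: "'p::euclidean_space \<Rightarrow> 'a measure"
  assumes reg: "regular_param M Th P sc" and th0: "th0 \<in> Th"
  shows "integrable (P th0) (sc th0)" "(\<integral>x. sc th0 x \<partial>P th0) = 0"
proof -
  obtain N :: "'a measure" and p where
    N: "sets N = sets M"
    and meas: "\<And>th. th \<in> Th \<Longrightarrow> p th \<in> borel_measurable N"
    and nonneg: "\<And>th x. th \<in> Th \<Longrightarrow> 0 \<le> p th x"
    and dens: "\<And>th. th \<in> Th \<Longrightarrow> P th = density N (\<lambda>x. ennreal (p th x))"
    and prob: "\<And>th. th \<in> Th \<Longrightarrow> prob_space (P th)"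
    and int: "\<And>th. th \<in> Th \<Longrightarrow> integrable N (p th)"
    and mass: "\<And>th. th \<in> Th \<Longrightarrow> (\<integral>x. p th x \<partial>N) = 1"
    and scm: "sc th0 \<in> borel_measurable N"
    and sc2: "integrable N (\<lambda>x. (norm (sc th0 x))\<^sup>2 * p th0 x)"
    and R: "\<And>e. 0 < e \<Longrightarrow> \<exists>d>0. \<forall>h. norm h < d \<longrightarrow> th0 + h \<in> Th \<longrightarrow>
       integrable N (\<lambda>x. (sqrt (p (th0 + h) x) - sqrt (p th0 x) - (1/2) * (h \<bullet> sc th0 x) * sqrt (p th0 x))\<^sup>2)
       \<and> (\<integral>x. (sqrt (p (th0 + h) x) - sqrt (p th0 x) - (1/2) * (h \<bullet> sc th0 x) * sqrt (p th0 x))\<^sup>2 \<partial>N) \<le> (e * norm h)\<^sup>2"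
    by (rule regular_param_expansion[OF reg th0], rule that, assumption+)
  interpret P0: prob_space "P th0" by (rule prob[OF th0])
  have scP: "sc th0 \<in> borel_measurable (P th0)" using scm dens[OF th0] by simp
  have "integrable (P th0) (\<lambda>x. (norm (sc th0 x))\<^sup>2)"
    unfolding dens[OF th0] using sc2 scm meas[OF th0] nonneg[OF th0]
    by (subst integrable_density) (auto simp: mult.commute)
  moreover have "(\<lambda>x. norm (sc th0 x)) \<in> borel_measurable (P th0)"
    using scP by measurable
  ultimately have "integrable (P th0) (\<lambda>x. norm (sc th0 x))"
    by (rule P0.square_integrable_imp_integrable[rotated])
  then show scint: "integrable (P th0) (sc th0)"
    using scP by (rule integrable_norm_cancel)
  have open_Th: "open Th" using reg by (simp add: regular_param_def)
  define m where "m = (\<integral>x. sc th0 x \<partial>P th0)"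
  define W where "W = (\<integral>x. (norm (sc th0 x))\<^sup>2 * p th0 x \<partial>N)"
  define s0 where "s0 x = sqrt (p th0 x)" for x
  have [measurable]: "s0 \<in> borel_measurable N" using meas[OF th0] unfolding s0_def by measurable
  have s0_sq: "(s0 x)\<^sup>2 = p th0 x" for x using nonneg[OF th0] by (simp add: s0_def)
  have W: "0 \<le> W" unfolding W_def using nonneg[OF th0] by (intro integral_nonneg_AE) auto
  text \<open>With \<open>Q\<close> the remainder of the expansion of \<open>s = sqrt p\<close> and \<open>D\<close> its linear term,
    \<open>1/2 (h \<bullet> m) = \<integral> s0 D = \<integral> s0 (s - s0) - \<integral> s0 Q\<close>, where \<open>\<integral> s0 (s - s0) = - 1/2 \<parallel>s - s0\<parallel>\<^sup>2\<close>
    is quadratic in \<open>h\<close>.\<close>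
  have key: "\<bar>h \<bullet> m\<bar> \<le> 2 * e * norm h + (2 * e\<^sup>2 + W) * (norm h)\<^sup>2"
    if e: "0 < e" and h: "th0 + h \<in> Th" "h \<noteq> 0"
      and Ri: "integrable N (\<lambda>x. (sqrt (p (th0 + h) x) - sqrt (p th0 x) - (1/2) * (h \<bullet> sc th0 x) * sqrt (p th0 x))\<^sup>2)"
      and Rle: "(\<integral>x. (sqrt (p (th0 + h) x) - sqrt (p th0 x) - (1/2) * (h \<bullet> sc th0 x) * sqrt (p th0 x))\<^sup>2 \<partial>N) \<le> (e * norm h)\<^sup>2"
    for e h
  proof -
    define s where "s x = sqrt (p (th0 + h) x)" for x
    define D where "D x = (1/2) * (h \<bullet> sc th0 x) * s0 x" for x
    define Q where "Q x = s x - s0 x - D x" for x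
    have [measurable]: "s \<in> borel_measurable N" using meas[OF h(1)] unfolding s_def by measurable
    have [measurable]: "D \<in> borel_measurable N" using scm unfolding D_def by measurable
    have [measurable]: "Q \<in> borel_measurable N" unfolding Q_def by measurable
    have s_sq: "(s x)\<^sup>2 = p (th0 + h) x" for x using nonneg[OF h(1)] by (simp add: s_def)
    have Qi: "integrable N (\<lambda>x. (Q x)\<^sup>2)" and Qle: "(\<integral>x. (Q x)\<^sup>2 \<partial>N) \<le> (e * norm h)\<^sup>2"
      using Ri Rle by (simp_all add: Q_def s_def s0_def D_def)
    have si: "integrable N (\<lambda>x. (s x)\<^sup>2)" "(\<integral>x. (s x)\<^sup>2 \<partial>N) = 1"
      using int[OF h(1)] mass[OF h(1)] by (simp_all add: s_sq)
    have s0i: "integrable N (\<lambda>x. (s0 x)\<^sup>2)" "(\<integral>x. (s0 x)\<^sup>2 \<partial>N) = 1"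
      using int[OF th0] mass[OF th0] by (simp_all add: s0_sq)
    have Dsq: "(D x)\<^sup>2 \<le> (1/4) * (norm h)\<^sup>2 * ((norm (sc th0 x))\<^sup>2 * p th0 x)" for x
    proof -
      have "(h \<bullet> sc th0 x)\<^sup>2 \<le> (norm h)\<^sup>2 * (norm (sc th0 x))\<^sup>2"
        using Cauchy_Schwarz_ineq[of h "sc th0 x"] by (simp add: power2_norm_eq_inner)
      then have "(h \<bullet> sc th0 x)\<^sup>2 * p th0 x \<le> (norm h)\<^sup>2 * (norm (sc th0 x))\<^sup>2 * p th0 x"
        using nonneg[OF th0] by (rule mult_right_mono)
      moreover have "(D x)\<^sup>2 = (1/4) * ((h \<bullet> sc th0 x)\<^sup>2 * p th0 x)"
        by (simp add: D_def power_mult_distrib power_divide s0_sq)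
      ultimately show ?thesis by (simp add: mult.assoc)
    qed
    have Di: "integrable N (\<lambda>x. (D x)\<^sup>2)"
      by (rule Bochner_Integration.integrable_bound[OF integrable_mult_right[OF sc2, of "(1/4) * (norm h)\<^sup>2"]])
        (use Dsq nonneg[OF th0] in \<open>auto simp: abs_mult\<close>)
    have Dint: "(\<integral>x. (D x)\<^sup>2 \<partial>N) \<le> (1/4) * (norm h)\<^sup>2 * W"
      unfolding W_def integral_mult_right_zero[symmetric]
      by (intro integral_mono Di integrable_mult_right sc2 Dsq)
    have di: "integrable N (\<lambda>x. (s x - s0 x)\<^sup>2)"
    proof -
      have "integrable N (\<lambda>x. (s x)\<^sup>2 + (s0 x)\<^sup>2 - 2 * (s x * s0 x))"
        using si s0i by (intro Bochner_Integration.integrable_diff Bochner_Integration.integrable_add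
          integrable_mult_right square_integrable_mult) auto
      then show ?thesis by (simp add: power2_diff mult.assoc)
    qed
    have "(\<integral>x. (s x - s0 x)\<^sup>2 \<partial>N) \<le> (\<integral>x. 2 * (Q x)\<^sup>2 + 2 * (D x)\<^sup>2 \<partial>N)"
    proof (rule integral_mono[OF di])
      show "(s x - s0 x)\<^sup>2 \<le> 2 * (Q x)\<^sup>2 + 2 * (D x)\<^sup>2" for x
        using sq_add2_le[of "Q x" "D x"] by (simp add: Q_def)
    qed (use Qi Di in auto)
    also have "\<dots> = 2 * (\<integral>x. (Q x)\<^sup>2 \<partial>N) + 2 * (\<integral>x. (D x)\<^sup>2 \<partial>N)" using Qi Di by simp
    also have "\<dots> \<le> 2 * (e * norm h)\<^sup>2 + (1/2) * (norm h)\<^sup>2 * W" using Qle Dint by simp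
    finally have dd: "(\<integral>x. (s x - s0 x)\<^sup>2 \<partial>N) \<le> 2 * (e * norm h)\<^sup>2 + (1/2) * (norm h)\<^sup>2 * W" .
    have s0D: "integrable N (\<lambda>x. s0 x * D x)" and s0Q: "integrable N (\<lambda>x. s0 x * Q x)"
      using s0i Di Qi by (auto intro!: square_integrable_mult)
    have eq1: "(\<integral>x. s0 x * D x \<partial>N) = (1/2) * (h \<bullet> m)"
    proof -
      have "h \<bullet> m = (\<integral>x. h \<bullet> sc th0 x \<partial>P th0)" unfolding m_def using scint by simp
      also have "\<dots> = (\<integral>x. p th0 x * (h \<bullet> sc th0 x) \<partial>N)"
        unfolding dens[OF th0] using scm meas[OF th0] nonneg[OF th0] by (subst integral_density) auto
      also have "\<dots> = (\<integral>x. 2 * (s0 x * D x) \<partial>N)"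
        by (intro Bochner_Integration.integral_cong) (auto simp: D_def s0_sq[symmetric] power2_eq_square)
      finally show ?thesis by simp
    qed
    have pw: "s0 x * D x = (1/2) * ((s x)\<^sup>2 - (s0 x)\<^sup>2 - (s x - s0 x)\<^sup>2) - s0 x * Q x" for x
      by (simp add: Q_def power2_eq_square algebra_simps)
    have eq2: "(\<integral>x. s0 x * D x \<partial>N) = - (1/2) * (\<integral>x. (s x - s0 x)\<^sup>2 \<partial>N) - (\<integral>x. s0 x * Q x \<partial>N)"
      unfolding pw using si s0i di s0Q by simp
    \<comment> \<open>Takes the place of Cauchy-Schwarz: with \<open>c\<close> as weight in the
      arithmetic-geometric inequality both halves come out as at most \<open>c / 2\<close>, since
      \<open>s0\<close> has norm 1 and \<open>Q\<close> has norm at most \<open>c\<close>.\<close>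
    define c where "c = e * norm h"
    have c: "0 < c" using e h(2) by (simp add: c_def)
    have "\<bar>\<integral>x. s0 x * Q x \<partial>N\<bar> \<le> (\<integral>x. (c / 2) * (s0 x)\<^sup>2 + (1 / (2 * c)) * (Q x)\<^sup>2 \<partial>N)"
    proof (rule integral_abs_bound[THEN order_trans], rule integral_mono)
      fix x
      have "2 * (c * \<bar>s0 x\<bar>) * \<bar>Q x\<bar> \<le> (c * \<bar>s0 x\<bar>)\<^sup>2 + \<bar>Q x\<bar>\<^sup>2"
        by (rule sum_squares_bound)
      then have "2 * c * \<bar>s0 x * Q x\<bar> \<le> c\<^sup>2 * (s0 x)\<^sup>2 + (Q x)\<^sup>2"
        by (simp add: abs_mult power_mult_distrib mult.assoc)
      then have "\<bar>s0 x * Q x\<bar> \<le> (c\<^sup>2 * (s0 x)\<^sup>2 + (Q x)\<^sup>2) / (2 * c)"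
        using c by (simp add: pos_le_divide_eq mult.commute)
      also have "\<dots> = (c / 2) * (s0 x)\<^sup>2 + (1 / (2 * c)) * (Q x)\<^sup>2"
        using c by (simp add: add_divide_distrib power2_eq_square)
      finally show "\<bar>s0 x * Q x\<bar> \<le> (c / 2) * (s0 x)\<^sup>2 + (1 / (2 * c)) * (Q x)\<^sup>2" .
    qed (use s0Q s0i Qi in auto)
    also have "\<dots> = c / 2 + (1 / (2 * c)) * (\<integral>x. (Q x)\<^sup>2 \<partial>N)" using s0i Qi by simp
    also have "(1 / (2 * c)) * (\<integral>x. (Q x)\<^sup>2 \<partial>N) \<le> (1 / (2 * c)) * c\<^sup>2"
      using Qle c by (intro mult_left_mono) (auto simp: c_def)
    also have "c / 2 + (1 / (2 * c)) * c\<^sup>2 = c" using c by (simp add: power2_eq_square)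
    finally have "\<bar>\<integral>x. s0 x * Q x \<partial>N\<bar> \<le> c" by simp
    moreover have "0 \<le> (\<integral>x. (s x - s0 x)\<^sup>2 \<partial>N)" by simp
    ultimately have "\<bar>h \<bullet> m\<bar> \<le> 2 * c + (2 * c\<^sup>2 + (1/2) * (norm h)\<^sup>2 * W)"
      using eq1 eq2 dd unfolding c_def[symmetric] by linarith
    also have "\<dots> \<le> 2 * e * norm h + (2 * e\<^sup>2 + W) * (norm h)\<^sup>2"
    proof -
      have "0 \<le> (norm h)\<^sup>2 * W" using W by simp
      then show ?thesis by (simp add: c_def power_mult_distrib algebra_simps)
    qed
    finally show ?thesis .
  qed
  show "(\<integral>x. sc th0 x \<partial>P th0) = 0"
  proof (rule ccontr)
    assume "(\<integral>x. sc th0 x \<partial>P th0) \<noteq> 0"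
    then have m: "0 < norm m" by (simp add: m_def)
    \<comment> \<open>For \<open>h\<close> of length \<open>t\<close> along \<open>m\<close>,
      \<open>key\<close> divided by \<open>t\<close> gives
      \<open>norm m \<le> 2 * e + B * t\<close>. The choice of \<open>e\<close> makes the first term
      \<open>norm m / 4\<close> and the choice of \<open>t\<close> keeps the second below
      \<open>norm m / 2\<close>, a contradiction.\<close>
    define e where "e = norm m / 8"
    have e: "0 < e" using m by (simp add: e_def)
    obtain d where d: "d > 0" and dR: "\<And>h. norm h < d \<Longrightarrow> th0 + h \<in> Th \<Longrightarrow>
       integrable N (\<lambda>x. (sqrt (p (th0 + h) x) - sqrt (p th0 x) - (1/2) * (h \<bullet> sc th0 x) * sqrt (p th0 x))\<^sup>2)
       \<and> (\<integral>x. (sqrt (p (th0 + h) x) - sqrt (p th0 x) - (1/2) * (h \<bullet> sc th0 x) * sqrt (p th0 x))\<^sup>2 \<partial>N) \<le> (e * norm h)\<^sup>2"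
      using R[OF e] by blast
    obtain b where b: "b > 0" "ball th0 b \<subseteq> Th" using open_Th th0 openE by blast
    define B where "B = 2 * e\<^sup>2 + W + 1"
    have B: "B > 0" using W by (auto simp: B_def intro!: add_nonneg_pos)
    define t where "t = min (min d b) (norm m / (2 * B)) / 2"
    have t: "0 < t" "t < d" "t < b" "t < norm m / (2 * B)" 
  proof -
      have "0 < min (min d b) (norm m / (2 * B))" using d b(1) m B by simp
      moreover have "x / 2 < d \<and> x / 2 < b \<and> x / 2 < y" if "0 < x" "x = min (min d b) y" for x y
        using that by (simp add: min_def split: if_splits)
      ultimately show "0 < t" "t < d" "t < b" "t < norm m / (2 * B)"
        unfolding t_def by (blast intro: half_gt_zero)+
    qed
    define h where "h = (t / norm m) *\<^sub>R m"
    have nh: "norm h = t" using t m by (simp add: h_def)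
    have h: "th0 + h \<in> Th" "h \<noteq> 0" "norm h < d"
      using b(2) nh t by (auto simp: subset_iff dist_norm)
    have "h \<bullet> m = t * norm m"
      using m by (simp add: h_def power2_norm_eq_inner[symmetric] power2_eq_square)
    then have "t * norm m \<le> 2 * e * t + (2 * e\<^sup>2 + W) * t\<^sup>2"
      using key[OF e h(1,2)] dR[OF h(3,1)] t m by (simp add: nh)
    also have "\<dots> \<le> 2 * e * t + B * t\<^sup>2" by (simp add: B_def mult_right_mono)
    also have "\<dots> = t * (2 * e + B * t)" by (simp add: algebra_simps power2_eq_square)
    finally have "norm m \<le> 2 * e + B * t" using t by simp
    moreover have "B * t < norm m / 2" using t(4) B by (simp add: field_simps)
    ultimately show False using m by (simp add: e_def)
  qed
qed

section \<open>The efficient influence function has mean zero\<close>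

text \<open>On a probability space the mean is continuous in L2, so its kernel is a closed subspace;
  it contains \<open>T\<close>.\<close>

lemma L2_closed_span_mean_zero:
  assumes N: "prob_space N" and f: "f \<in> L2_closed_span N T"
    and T: "\<And>h. h \<in> T \<Longrightarrow> integrable N h \<and> (\<integral>x. h x \<partial>N) = 0"
  shows "integrable N f" "(\<integral>x. f x \<partial>N) = 0"
proof -
  interpret prob_space N by fact
  have fm: "f \<in> borel_measurable N" and f2: "(\<integral>\<^sup>+x. ennreal ((f x)\<^sup>2) \<partial>N) < \<infinity>"
    using f by (auto simp: L2_closed_span_def L2_def)
  have "integrable N (\<lambda>x. (f x)\<^sup>2)"
    using fm f2 by (intro integrableI_bounded) auto
  then show fi: "integrable N f"
    by (rule square_integrable_imp_integrable[rotated]) (rule fm)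
  have "\<bar>\<integral>x. f x \<partial>N\<bar> \<le> e" if e: "0 < e" for e
  proof -
    have "0 < e\<^sup>2" using e by simp
    then obtain F c where F: "finite F" "F \<subseteq> T"
      and le: "(\<integral>\<^sup>+x. ennreal ((f x - (\<Sum>h\<in>F. c h * h x))\<^sup>2) \<partial>N) < ennreal (e\<^sup>2)"
      using f unfolding L2_closed_span_def by blast
    define u where "u x = f x - (\<Sum>h\<in>F. c h * h x)" for x
    have gi: "integrable N (\<lambda>x. \<Sum>h\<in>F. c h * h x)"
      using T F by (intro Bochner_Integration.integrable_sum integrable_mult_right) auto
    have ui: "integrable N u" unfolding u_def by (intro Bochner_Integration.integrable_diff fi gi)
    have um: "u \<in> borel_measurable N" using ui by simp
    have u2: "integrable N (\<lambda>x. (u x)\<^sup>2)"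
    proof (rule integrableI_bounded)
      show "(\<lambda>x. (u x)\<^sup>2) \<in> borel_measurable N" using um by measurable
      show "(\<integral>\<^sup>+x. ennreal (norm ((u x)\<^sup>2)) \<partial>N) < \<infinity>"
        using less_trans[OF le ennreal_less_top] by (simp add: u_def)
    qed
    have u2le: "(\<integral>x. (u x)\<^sup>2 \<partial>N) \<le> e\<^sup>2"
    proof -
      have "ennreal (\<integral>x. (u x)\<^sup>2 \<partial>N) = (\<integral>\<^sup>+x. ennreal ((u x)\<^sup>2) \<partial>N)"
        by (rule nn_integral_eq_integral[symmetric, OF u2]) simp
      also have "\<dots> \<le> ennreal (e\<^sup>2)" using le by (simp add: u_def)
      finally show ?thesis by simp
    qed
    have "(\<integral>x. (\<Sum>h\<in>F. c h * h x) \<partial>N) = (\<Sum>h\<in>F. \<integral>x. c h * h x \<partial>N)"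
      using T F by (intro Bochner_Integration.integral_sum integrable_mult_right) auto
    also have "\<dots> = 0" using T F by (intro sum.neutral) auto
    finally have "(\<integral>x. f x \<partial>N) = (\<integral>x. u x \<partial>N)"
      unfolding u_def using fi gi by simp
    \<comment> \<open>The arithmetic-geometric inequality with weight \<open>e\<close> replaces the
      comparison of the L1 and L2 norms and returns exactly \<open>e\<close>.\<close>
    also have "\<bar>\<dots>\<bar> \<le> (\<integral>x. e / 2 + (1 / (2 * e)) * (u x)\<^sup>2 \<partial>N)"
    proof (rule integral_abs_bound[THEN order_trans], rule integral_mono)
      fix x
      have "2 * e * \<bar>u x\<bar> \<le> e\<^sup>2 + \<bar>u x\<bar>\<^sup>2" by (rule sum_squares_bound)
      then have "\<bar>u x\<bar> \<le> (e\<^sup>2 + (u x)\<^sup>2) / (2 * e)"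
        using e by (simp add: pos_le_divide_eq mult.commute)
      then show "\<bar>u x\<bar> \<le> e / 2 + (1 / (2 * e)) * (u x)\<^sup>2"
        using e by (simp add: add_divide_distrib power2_eq_square)
    qed (use ui u2 in auto)
    also have "\<dots> = e / 2 + (1 / (2 * e)) * (\<integral>x. (u x)\<^sup>2 \<partial>N)"
      using u2 by (simp add: prob_space)
    also have "\<dots> \<le> e / 2 + (1 / (2 * e)) * e\<^sup>2"
      using u2le e by (intro add_left_mono mult_left_mono) auto
    also have "\<dots> = e" using e by (simp add: power2_eq_square)
    finally show ?thesis .
  qed
  then show "(\<integral>x. f x \<partial>N) = 0"
    using field_le_epsilon[of "\<bar>\<integral>x. f x \<partial>N\<bar>" 0] by auto
qed

text \<open>The efficient score is the score of the parametric submodel minus an element of the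
  tangent space. The first has mean zero by \<open>regular_param_score_mean_zero\<close>; the second
  because the same lemma, in dimension one, applies to every generator of that space. Multiplication
  by the inverse information matrix preserves mean zero and square integrability.\<close>

lemma eff_infl_mean_zero:
  fixes P :: "real^'k \<Rightarrow> 'a measure"
  assumes reg: "regular_param M Th P sc" and th: "th \<in> Th"
    and eff: "eff_infl M Ps (P th) (sc th) eif"
  shows "eif \<in> borel_measurable (P th)" "integrable (P th) (\<lambda>x. (norm (eif x))\<^sup>2)" "(\<integral>x. eif x \<partial>P th) = 0"
proof -
  have N: "prob_space (P th)" "sets (P th) = sets M"
    using reg th unfolding regular_param_def by (blast, metis sets_density)
  interpret prob_space "P th" by fact
  obtain ls A where es: "eff_score M Ps (P th) (sc th) ls"
    and eif: "\<And>x. x \<in> space M \<Longrightarrow> eif x = A *v ls x"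
    using eff unfolding eff_infl_def Let_def by blast
  have ls: "ls \<in> borel_measurable (P th)" "(\<integral>\<^sup>+x. ennreal ((norm (ls x))\<^sup>2) \<partial>P th) < \<infinity>"
    using es by (auto simp: eff_score_def L2v_def)
  have ls2: "integrable (P th) (\<lambda>x. (norm (ls x))\<^sup>2)"
    using ls by (intro integrableI_bounded) auto
  have lsn: "(\<lambda>x. norm (ls x)) \<in> borel_measurable (P th)"
    using ls(1) by measurable
  have "integrable (P th) (\<lambda>x. norm (ls x))"
    by (rule square_integrable_imp_integrable[rotated, OF ls2 lsn])
  then have lsi: "integrable (P th) ls" using ls(1) by (rule integrable_norm_cancel)
  have tang: "integrable (P th) h \<and> (\<integral>x. h x \<partial>P th) = 0" if "h \<in> submodel_scores M Ps (P th)" for h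
  proof -
    obtain U Q sc' eta0 where "eta0 \<in> U" "Q eta0 = P th" "regular_param M U Q sc'" "h = sc' eta0"
      using \<open>h \<in> _\<close> unfolding submodel_scores_def by blast
    then show ?thesis using regular_param_score_mean_zero[of M U Q sc' eta0] by simp
  qed
  have comp: "bounded_linear (\<lambda>v::real^'k. v $ i)" for i by (rule bounded_linear_vec_nth)
  have "(\<integral>x. ls x \<partial>P th) $ i = 0" for i
  proof -
    have span: "(\<lambda>x. sc th x $ i - ls x $ i) \<in> L2_closed_span (P th) (submodel_scores M Ps (P th))"
      using es by (simp add: eff_score_def)
    have sci: "integrable (P th) (\<lambda>x. sc th x $ i)" "(\<integral>x. sc th x $ i \<partial>P th) = 0"
      using integrable_bounded_linear[OF comp, of "P th" "sc th" i] integral_bounded_linear[OF comp, of "P th" "sc th" i]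
        regular_param_score_mean_zero[OF reg th] by simp_all
    have lsii: "integrable (P th) (\<lambda>x. ls x $ i)" "(\<integral>x. ls x $ i \<partial>P th) = (\<integral>x. ls x \<partial>P th) $ i"
      using integrable_bounded_linear[OF comp lsi] integral_bounded_linear[OF comp lsi] by simp_all
    show ?thesis
      using L2_closed_span_mean_zero(2)[OF N(1) span tang] sci lsii by simp
  qed
  then have ls0: "(\<integral>x. ls x \<partial>P th) = 0" by (simp add: vec_eq_iff)
  have sp: "space (P th) = space M" using N(2) by (rule sets_eq_imp_space_eq)
  have lin: "bounded_linear ((*v) A)" by (rule matrix_vector_mul_bounded_linear)
  have Am: "(\<lambda>x. A *v ls x) \<in> borel_measurable (P th)"
    using integrable_bounded_linear[OF lin lsi] by simp
  show em: "eif \<in> borel_measurable (P th)"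
    by (rule measurable_cong[THEN iffD2, OF _ Am]) (simp add: eif sp)
  have "(\<integral>x. eif x \<partial>P th) = (\<integral>x. A *v ls x \<partial>P th)"
    by (rule Bochner_Integration.integral_cong) (simp_all add: eif sp)
  also have "\<dots> = A *v (\<integral>x. ls x \<partial>P th)" by (rule integral_bounded_linear[OF lin lsi])
  finally show "(\<integral>x. eif x \<partial>P th) = 0" by (simp add: ls0)
  obtain K where K: "\<And>v. norm (A *v v) \<le> norm v * K" using bounded_linear.bounded[OF lin] by blast
  show "integrable (P th) (\<lambda>x. (norm (eif x))\<^sup>2)"
  proof (rule Bochner_Integration.integrable_bound[OF integrable_mult_right[OF ls2, of "K\<^sup>2"]])
    show "(\<lambda>x. (norm (eif x))\<^sup>2) \<in> borel_measurable (P th)" using em by measurable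
    show "AE x in P th. norm ((norm (eif x))\<^sup>2) \<le> norm (K\<^sup>2 * (norm (ls x))\<^sup>2)"
    proof (rule AE_I2)
      fix x assume "x \<in> space (P th)"
      then have "(norm (eif x))\<^sup>2 \<le> (norm (ls x) * K)\<^sup>2"
        using K[of "ls x"] by (intro power_mono) (auto simp: eif sp)
      then show "norm ((norm (eif x))\<^sup>2) \<le> norm (K\<^sup>2 * (norm (ls x))\<^sup>2)"
        by (simp add: power_mult_distrib mult.commute)
    qed
  qed
qed

section \<open>Uniformity from sequences\<close>

text \<open>Choosing at every \<open>n\<close> a point of \<open>S n\<close> that violates the
  bound, whenever there is one, gives a single sequence to which the hypothesis applies.
  \<open>s0\<close> supplies a point at the other indices.\<close>

lemma eventually_ball_lessI:
  fixes f :: "nat \<Rightarrow> 'b \<Rightarrow> real"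
  assumes seq: "\<And>s. (\<And>n. s n \<in> S n) \<Longrightarrow> (\<lambda>n. f n (s n)) \<longlonglongrightarrow> 0"
    and ne: "\<And>n. s0 n \<in> S n" and e: "0 < e"
  shows "eventually (\<lambda>n. \<forall>x\<in>S n. f n x < e) sequentially"
proof -
  define s where "s n = (if \<exists>x\<in>S n. e \<le> f n x then SOME x. x \<in> S n \<and> e \<le> f n x else s0 n)" for n
  have s: "s n \<in> S n \<and> ((\<exists>x\<in>S n. e \<le> f n x) \<longrightarrow> e \<le> f n (s n))" for n
  proof (cases "\<exists>x\<in>S n. e \<le> f n x")
    case True
    then have "\<exists>x. x \<in> S n \<and> e \<le> f n x" by blast
    from someI_ex[OF this] True show ?thesis by (simp add: s_def)
  qed (simp add: s_def ne)
  have "(\<lambda>n. f n (s n)) \<longlonglongrightarrow> 0" by (rule seq) (use s in blast)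
  then have "eventually (\<lambda>n. f n (s n) < e) sequentially"
    using e by (rule order_tendstoD(2))
  then show ?thesis by eventually_elim (use s in \<open>meson not_le\<close>)
qed

text \<open>Here the threshold \<open>K\<close> must be uniform too. If no \<open>K\<close> works,
  every threshold is violated at infinitely many \<open>n\<close>; a sequence that at each
  \<open>n\<close> violates the largest available threshold keeps the limsup above \<open>e\<close>
  for all \<open>K\<close>, by antitonicity in \<open>K\<close>.\<close>

lemma eventually_ball_tight:
  fixes f :: "nat \<Rightarrow> real \<Rightarrow> 'b \<Rightarrow> real"
  assumes seq: "\<And>s. (\<And>n. s n \<in> S n) \<Longrightarrow>
      ((\<lambda>K. limsup (\<lambda>n. ereal (f n K (s n)))) \<longlongrightarrow> 0) at_top"
    and anti: "\<And>n K L x. K \<le> L \<Longrightarrow> f n L x \<le> f n K x"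
    and ne: "\<And>n. s0 n \<in> S n" and e: "0 < e"
  shows "\<exists>K>0. eventually (\<lambda>n. \<forall>x\<in>S n. f n K x < e) sequentially"
proof (rule ccontr)
  assume neg: "\<not> ?thesis"
  have freq: "frequently (\<lambda>n. \<exists>x\<in>S n. e \<le> f n K x) sequentially" if "0 < K" for K
    using neg that unfolding frequently_def by (simp add: not_le)
  \<comment> \<open>The restriction \<open>j \<le> n\<close> keeps \<open>J n\<close> finite, so a
    maximum exists. Every fixed \<open>j\<close> still belongs to infinitely many
    \<open>J n\<close>.\<close>
  define J where "J n = {j. j \<le> n \<and> (\<exists>x\<in>S n. e \<le> f n (real j) x)}" for n
  have J_fin: "finite (J n)" for n by (rule finite_subset[of _ "{..n}"]) (auto simp: J_def)
  define s where "s n = (if J n = {} then s0 n else SOME x. x \<in> S n \<and> e \<le> f n (real (Max (J n))) x)" for n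
  have s: "s n \<in> S n \<and> (J n \<noteq> {} \<longrightarrow> e \<le> f n (real (Max (J n))) (s n))" for n
  proof (cases "J n = {}")
    case False
    then have "Max (J n) \<in> J n" using J_fin by (intro Max_in)
    then have "\<exists>x. x \<in> S n \<and> e \<le> f n (real (Max (J n))) x" by (auto simp: J_def)
    from someI_ex[OF this] False show ?thesis by (simp add: s_def)
  qed (simp add: s_def ne)
  have ge: "ereal e \<le> limsup (\<lambda>n. ereal (f n K (s n)))" for K
  proof (rule ccontr)
    assume "\<not> ereal e \<le> limsup (\<lambda>n. ereal (f n K (s n)))"
    then have "eventually (\<lambda>n. ereal (f n K (s n)) < ereal e) sequentially"
      by (intro Limsup_lessD) simp
    then have ev: "eventually (\<lambda>n. f n K (s n) < e) sequentially" by simp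
    obtain j :: nat where j: "max K 1 \<le> real j" using real_arch_simple by blast
    have "frequently (\<lambda>n. \<exists>x\<in>S n. e \<le> f n (real j) x) sequentially"
      using j by (intro freq) simp
    then have "frequently (\<lambda>n. (f n K (s n) < e \<and> j \<le> n) \<and> (\<exists>x\<in>S n. e \<le> f n (real j) x)) sequentially"
      by (rule frequently_eventually_conj) (intro eventually_conj ev eventually_ge_at_top)
    then obtain n where n: "\<exists>x\<in>S n. e \<le> f n (real j) x" "f n K (s n) < e" "j \<le> n"
      using frequently_ex by blast
    then have "j \<in> J n" by (simp add: J_def)
    then have "j \<le> Max (J n)" "J n \<noteq> {}" using J_fin by auto
    then have "e \<le> f n (real (Max (J n))) (s n)" "K \<le> real (Max (J n))" using s j by auto
    then have "e \<le> f n K (s n)" using anti order_trans by blast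
    with n(2) show False by simp
  qed
  have "((\<lambda>K. limsup (\<lambda>n. ereal (f n K (s n)))) \<longlongrightarrow> 0) at_top" by (rule seq) (use s in blast)
  then have "ereal e \<le> 0"
    by (rule tendsto_lowerbound) (auto simp: ge)
  then show False using e by simp
qed

section \<open>The sample-splitting estimator\<close>

abbreviation iid_prob :: "'a measure \<Rightarrow> ((nat \<Rightarrow> 'a) \<Rightarrow> bool) \<Rightarrow> real" where
  "iid_prob Q A \<equiv> measure (iid Q) {X \<in> space (iid Q). A X}"

lemma iid_prob_le_add:
  assumes Q: "prob_space Q" and B: "Measurable.pred (iid Q) B" "Measurable.pred (iid Q) C"
    and sub: "\<And>X. X \<in> space (iid Q) \<Longrightarrow> A X \<Longrightarrow> B X \<or> C X"
  shows "iid_prob Q A \<le> iid_prob Q B + iid_prob Q C"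
proof -
  interpret P: prob_space "iid Q" by (intro prob_space_PiM Q)
  have "iid_prob Q A \<le> measure (iid Q) ({X \<in> space (iid Q). B X} \<union> {X \<in> space (iid Q). C X})"
    using sub by (intro P.finite_measure_mono sets.Un predE B) auto
  also have "\<dots> \<le> iid_prob Q B + iid_prob Q C"
    by (intro measure_Un_le predE B)
  finally show ?thesis .
qed

lemma iid_prob_mono:
  assumes Q: "prob_space Q" and B: "Measurable.pred (iid Q) B"
    and sub: "\<And>X. X \<in> space (iid Q) \<Longrightarrow> A X \<Longrightarrow> B X"
  shows "iid_prob Q A \<le> iid_prob Q B"
proof -
  interpret P: prob_space "iid Q" by (intro prob_space_PiM Q)
  show ?thesis using sub by (intro P.finite_measure_mono predE B) auto
qed

text \<open>The setting at one fixed nuisance value and one fixed limit \<open>th0\<close>. The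
  efficient influence function enters only through measurability, square integrability and mean
  zero, so tangent spaces do not appear from here on.\<close>

locale one_step_model =
  fixes M :: "'a measure" and Th :: "'p::euclidean_space set" and P :: "'p \<Rightarrow> 'a measure"
    and sc eif :: "'p \<Rightarrow> 'a \<Rightarrow> 'p" and t :: "nat \<Rightarrow> (nat \<Rightarrow> 'a) \<Rightarrow> 'p"
    and ell :: "nat \<Rightarrow> 'a \<Rightarrow> 'p \<Rightarrow> (nat \<Rightarrow> 'a) \<Rightarrow> 'p" and th0 :: 'p
  assumes reg: "regular_param M Th P sc" and th0: "th0 \<in> Th"
    and eif_meas: "\<And>th. th \<in> Th \<Longrightarrow> eif th \<in> borel_measurable M"
    and eif_sq: "\<And>th. th \<in> Th \<Longrightarrow> integrable (P th) (\<lambda>x. (norm (eif th x))\<^sup>2)"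
    and eif_mean: "\<And>th. th \<in> Th \<Longrightarrow> (\<integral>x. eif th x \<partial>P th) = 0"
    and t_local: "\<And>n X Y. (\<And>i. i < n \<Longrightarrow> X i = Y i) \<Longrightarrow> t n X = t n Y"
    and t_meas: "\<And>n. t n \<in> borel_measurable (iid M)"
    and ell_local: "\<And>n x th X Y. (\<And>i. i < n \<Longrightarrow> X i = Y i) \<Longrightarrow> ell n x th X = ell n x th Y"
    and ell_meas: "\<And>n. (\<lambda>(x, th, X). ell n x th X) \<in> borel_measurable (M \<Otimes>\<^sub>M borel \<Otimes>\<^sub>M iid M)"
    and root_n_consistent: "\<And>ths. root_n_seq Th th0 ths \<Longrightarrow>
        ((\<lambda>K::real. limsup (\<lambda>n. ereal (iid_prob (P (ths n)) (\<lambda>X. K < norm (sqrt (real n) *\<^sub>R (t n X - ths n))))))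
          \<longlongrightarrow> 0) at_top"
    and ell_L2_consistent: "\<And>ths. root_n_seq Th th0 ths \<Longrightarrow> oP_enn (\<lambda>n. P (ths n))
        (\<lambda>n X. \<integral>\<^sup>+x. ennreal ((norm (ell n x (ths n) X - eif (ths n) x))\<^sup>2) \<partial>(P (ths n)))"
    and ell_bias: "\<And>ths. root_n_seq Th th0 ths \<Longrightarrow>
        oP (\<lambda>n. P (ths n)) (\<lambda>n X. sqrt (real n) *\<^sub>R (\<integral>x. ell n x (ths n) X \<partial>(P (ths n))))"
    and eif_expansion: "\<And>ths. root_n_seq Th th0 ths \<Longrightarrow>
        oP (\<lambda>n. P th0) (\<lambda>n X. sqrt (real n) *\<^sub>R (ths n - th0
          + (1 / real n) *\<^sub>R (\<Sum>i<n. eif (ths n) (X i)) - (1 / real n) *\<^sub>R (\<Sum>i<n. eif th0 (X i))))"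
begin

lemma sets_P: "sets (P th) = sets M" if "th \<in> Th"
  using reg that unfolding regular_param_def by (metis sets_density)

lemma prob_P: "prob_space (P th)" if "th \<in> Th"
  using reg that unfolding regular_param_def by blast

lemma pred_iid_P: "Measurable.pred (iid M) A \<Longrightarrow> Measurable.pred (iid (P th)) A" if "th \<in> Th"
  unfolding measurable_cong_sets[OF sets_iid_cong[OF sets_P[OF that]] refl] .

section \<open>The assumptions made uniform over root-n neighbourhoods\<close>

definition nbhd :: "real \<Rightarrow> nat \<Rightarrow> 'p set" where
  "nbhd C n = {th \<in> Th. sqrt (real n) * norm (th - th0) \<le> C}"

lemma root_n_seq_nbhd: "root_n_seq Th th0 s" if "\<And>n. s n \<in> nbhd C n"
  using that by (auto simp: root_n_seq_def nbhd_def)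

lemma th0_nbhd: "0 \<le> C \<Longrightarrow> th0 \<in> nbhd C n"
  using th0 by (simp add: nbhd_def)

lemma root_n_seq_th0: "root_n_seq Th th0 (\<lambda>_. th0)"
  using th0 by (auto simp: root_n_seq_def intro: exI[of _ 0])

lemma ell_meas_fix: "(\<lambda>x. ell n x th y) \<in> borel_measurable M" if "y \<in> space (iid M)"
  using measurable_compose[OF _ ell_meas[of n], of "\<lambda>x. (x, th, y)" M] that by simp

lemma ell_meas_pair: "(\<lambda>(y, x). ell n x th y) \<in> borel_measurable (iid M \<Otimes>\<^sub>M Q)" if "sets Q = sets M"
proof -
  have "(\<lambda>z. (snd z, th, fst z)) \<in> measurable (iid M \<Otimes>\<^sub>M Q) (Q \<Otimes>\<^sub>M borel \<Otimes>\<^sub>M iid M)"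
    by (intro measurable_Pair measurable_fst measurable_snd measurable_const) auto
  then have "(\<lambda>z. (snd z, th, fst z)) \<in> measurable (iid M \<Otimes>\<^sub>M Q) (M \<Otimes>\<^sub>M borel \<Otimes>\<^sub>M iid M)"
    unfolding measurable_cong_sets[OF refl sets_pair_measure_cong[OF that refl]] .
  from measurable_compose[OF this ell_meas[of n]] show ?thesis by (simp add: split_beta')
qed

definition ell_error :: "nat \<Rightarrow> 'p \<Rightarrow> (nat \<Rightarrow> 'a) \<Rightarrow> ennreal" where
  "ell_error n th y = (\<integral>\<^sup>+x. ennreal ((norm (ell n x th y - eif th x))\<^sup>2) \<partial>P th)"

definition ell_mean :: "nat \<Rightarrow> 'p \<Rightarrow> (nat \<Rightarrow> 'a) \<Rightarrow> 'p" where
  "ell_mean n th y = sqrt (real n) *\<^sub>R (\<integral>x. ell n x th y \<partial>P th)"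

lemma ell_error_meas: "ell_error n th \<in> borel_measurable (iid M)" if th: "th \<in> Th"
proof -
  interpret prob_space "P th" by (rule prob_P[OF th])
  have e: "eif th \<in> borel_measurable (P th)"
    using eif_meas[OF th] unfolding measurable_cong_sets[OF sets_P[OF th] refl] .
  have "(\<lambda>z. ell n (snd z) th (fst z)) \<in> borel_measurable (iid M \<Otimes>\<^sub>M P th)"
    using ell_meas_pair[OF sets_P[OF th], of n th] by (simp add: split_beta')
  moreover have "(\<lambda>z. eif th (snd z)) \<in> borel_measurable (iid M \<Otimes>\<^sub>M P th)"
    using e by simp
  ultimately have "(\<lambda>z. ennreal ((norm (ell n (snd z) th (fst z) - eif th (snd z)))\<^sup>2)) \<in> borel_measurable (iid M \<Otimes>\<^sub>M P th)"
    by measurable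
  then show ?thesis
    unfolding ell_error_def by (intro borel_measurable_nn_integral) (simp add: split_beta')
qed

lemma ell_mean_meas: "ell_mean n th \<in> borel_measurable (iid M)" if th: "th \<in> Th"
proof -
  interpret prob_space "P th" by (rule prob_P[OF th])
  show ?thesis
    unfolding ell_mean_def
    by (intro borel_measurable_scaleR borel_measurable_const borel_measurable_lebesgue_integral
        ell_meas_pair[OF sets_P[OF th]])
qed

lemma ell_error_local: "ell_error n th X = ell_error n th Y"
  and ell_mean_local: "ell_mean n th X = ell_mean n th Y" if "\<And>i. i < n \<Longrightarrow> X i = Y i"
proof -
  have "ell n x th X = ell n x th Y" for x by (rule ell_local) (use that in blast)
  then show "ell_error n th X = ell_error n th Y" "ell_mean n th X = ell_mean n th Y"
    by (simp_all add: ell_error_def ell_mean_def)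
qed

lemma eventually_ell_error:
  assumes "0 < e" "0 < d" "0 \<le> C"
  shows "eventually (\<lambda>n. \<forall>th\<in>nbhd C n. iid_prob (P th) (\<lambda>X. ennreal e < ell_error n th X) < d) sequentially"
proof (rule eventually_ball_lessI[where ?s0.0="\<lambda>_. th0"])
  fix s assume s: "\<And>n. s n \<in> nbhd C n"
  show "(\<lambda>n. iid_prob (P (s n)) (\<lambda>X. ennreal e < ell_error n (s n) X)) \<longlonglongrightarrow> 0"
    using ell_L2_consistent[OF root_n_seq_nbhd[OF s]] assms(1) unfolding oP_enn_def ell_error_def by blast
qed (use assms th0_nbhd in auto)

lemma eventually_ell_mean:
  assumes "0 < e" "0 < d" "0 \<le> C"
  shows "eventually (\<lambda>n. \<forall>th\<in>nbhd C n. iid_prob (P th) (\<lambda>X. e < norm (ell_mean n th X)) < d) sequentially"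
proof (rule eventually_ball_lessI[where ?s0.0="\<lambda>_. th0"])
  fix s assume s: "\<And>n. s n \<in> nbhd C n"
  show "(\<lambda>n. iid_prob (P (s n)) (\<lambda>X. e < norm (ell_mean n (s n) X))) \<longlonglongrightarrow> 0"
    using ell_bias[OF root_n_seq_nbhd[OF s]] assms(1) unfolding oP_def ell_mean_def by blast
qed (use assms th0_nbhd in auto)

definition expansion_error :: "nat \<Rightarrow> 'p \<Rightarrow> (nat \<Rightarrow> 'a) \<Rightarrow> 'p" where
  "expansion_error n th X = sqrt (real n) *\<^sub>R (th - th0
      + (1 / real n) *\<^sub>R (\<Sum>i<n. eif th (X i)) - (1 / real n) *\<^sub>R (\<Sum>i<n. eif th0 (X i)))"

lemma eif_coord_meas: "(\<lambda>X. eif th (X i)) \<in> borel_measurable (iid M)" if "th \<in> Th"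
  by (rule measurable_compose[OF measurable_component_singleton[of i UNIV "\<lambda>_. M"] eif_meas[OF that]]) simp

lemma expansion_error_meas: "expansion_error n th \<in> borel_measurable (iid M)" if "th \<in> Th"
  unfolding expansion_error_def
  by (intro borel_measurable_scaleR borel_measurable_diff borel_measurable_add borel_measurable_const
      borel_measurable_sum eif_coord_meas that th0)

lemma eventually_expansion_error:
  assumes "0 < e" "0 < d" "0 \<le> C"
  shows "eventually (\<lambda>n. \<forall>th\<in>nbhd C n. iid_prob (P th0) (\<lambda>X. e < norm (expansion_error n th X)) < d) sequentially"
proof (rule eventually_ball_lessI[where ?s0.0="\<lambda>_. th0"])
  fix s assume s: "\<And>n. s n \<in> nbhd C n"
  show "(\<lambda>n. iid_prob (P th0) (\<lambda>X. e < norm (expansion_error n (s n) X))) \<longlonglongrightarrow> 0"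
    using eif_expansion[OF root_n_seq_nbhd[OF s]] assms(1) unfolding oP_def expansion_error_def by blast
qed (use assms th0_nbhd in auto)

lemma eventually_root_n_tight:
  assumes "0 < d" "0 \<le> C"
  shows "\<exists>K>0. eventually (\<lambda>n. \<forall>th\<in>nbhd C n.
    iid_prob (P th) (\<lambda>X. K < norm (sqrt (real n) *\<^sub>R (t n X - th))) < d) sequentially"
proof -
  \<comment> \<open>\<open>eventually_ball_tight\<close> asks for antitonicity at every
    \<open>th\<close>, while monotonicity of \<open>P th\<close> on these events is available only
    for \<open>th\<close> in \<open>Th\<close>; hence the value 0 elsewhere.\<close>
  define f where "f n K th = (if th \<in> Th then iid_prob (P th) (\<lambda>X. K < norm (sqrt (real n) *\<^sub>R (t n X - th))) else 0)" for n K th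
  have f: "f n K th = iid_prob (P th) (\<lambda>X. K < norm (sqrt (real n) *\<^sub>R (t n X - th)))" if "th \<in> Th" for n K th
    using that by (simp add: f_def)
  have "\<exists>K>0. eventually (\<lambda>n. \<forall>th\<in>nbhd C n. f n K th < d) sequentially"
  proof (rule eventually_ball_tight[where ?s0.0="\<lambda>_. th0"])
    fix s assume s: "\<And>n. s n \<in> nbhd C n"
    have "s n \<in> Th" for n using s by (auto simp: nbhd_def)
    then show "((\<lambda>K. limsup (\<lambda>n. ereal (f n K (s n)))) \<longlongrightarrow> 0) at_top"
      using root_n_consistent[OF root_n_seq_nbhd[OF s]] by (simp add: f)
  next
    fix n and K L :: real and th assume KL: "K \<le> L"
    show "f n L th \<le> f n K th"
    proof (cases "th \<in> Th")
      case True
      have "(\<lambda>X. norm (sqrt (real n) *\<^sub>R (t n X - th))) \<in> borel_measurable (iid M)"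
        using t_meas[of n] by measurable
      then have "Measurable.pred (iid M) (\<lambda>X. K < norm (sqrt (real n) *\<^sub>R (t n X - th)))"
        by (intro borel_measurable_pred_less) auto
      then show ?thesis
        unfolding f[OF True] using KL by (intro iid_prob_mono prob_P pred_iid_P True) auto
    qed (simp add: f_def)
  qed (use assms th0_nbhd in auto)
  moreover have "(\<forall>th\<in>nbhd C n. f n K th < d) = (\<forall>th\<in>nbhd C n.
    iid_prob (P th) (\<lambda>X. K < norm (sqrt (real n) *\<^sub>R (t n X - th))) < d)" for n K
    by (intro ball_cong refl) (simp add: f nbhd_def)
  ultimately show ?thesis by simp
qed

section \<open>The noise caused by estimating the influence function\<close>

definition noise :: "nat set \<Rightarrow> nat \<Rightarrow> nat \<Rightarrow> 'p \<Rightarrow> (nat \<Rightarrow> 'a) \<Rightarrow> 'p" where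
  "noise I c b th X = (\<Sum>i\<in>I. ell b (X i) th (\<lambda>j. X (c + j)) - eif th (X i))"

text \<open>Given the observations in the block \<open>{c..<c + b}\<close>, the noise is a sum of i.i.d. terms
  whose second moment is \<open>ell_error\<close> and whose mean is \<open>ell_mean\<close> up to a factor.\<close>

lemma noise_bound:
  assumes th: "th \<in> Th" and I: "finite I" "I \<inter> {c..<c + b} = {}" and b: "0 < b" and d: "0 < d" and e: "0 < e"
  shows "iid_prob (P th) (\<lambda>X. e < norm (noise I c b th X))
    \<le> (real (card I) * d\<^sup>2 + (real (card I))\<^sup>2 * (d\<^sup>2 / real b)) / e\<^sup>2
      + (iid_prob (P th) (\<lambda>X. ennreal (d\<^sup>2) < ell_error b th X) + iid_prob (P th) (\<lambda>X. d < norm (ell_mean b th X)))"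
proof -
  interpret Q: prob_space "P th" by (rule prob_P[OF th])
  have sQ: "sets (P th) = sets M" by (rule sets_P[OF th])
  have sI: "sets (iid (P th)) = sets (iid M)" by (rule sets_iid_cong[OF sQ])
  have eifm: "eif th \<in> borel_measurable (P th)"
    using eif_meas[OF th] unfolding measurable_cong_sets[OF sQ refl] .
  have eif2: "integrable (P th) (\<lambda>x. (norm (eif th x))\<^sup>2)" by (rule eif_sq[OF th])
  have L1: "integrable (P th) f" if "f \<in> borel_measurable (P th)" "integrable (P th) (\<lambda>x. (norm (f x))\<^sup>2)"
    for f :: "'a \<Rightarrow> 'p"
  proof -
    have "(\<lambda>x. norm (f x)) \<in> borel_measurable (P th)" using that(1) by measurable
    from Q.square_integrable_imp_integrable[OF this that(2)] that(1) show ?thesis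
      by (rule integrable_norm_cancel)
  qed
  \<comment> \<open>\<open>T\<close> agrees with the shift on the first \<open>b\<close> coordinates but depends on \<open>X\<close> only through the block.\<close>
  define T where "T X j = X (c + (if j < b then j else 0))" for X :: "nat \<Rightarrow> 'a" and j
  have T_meas: "T \<in> measurable (iid (P th)) (iid M)"
    unfolding measurable_cong_sets[OF sI refl] T_def[abs_def]
    by (rule measurable_PiM_single') (auto simp: space_PiM PiE_def Pi_def)
  define A where "A X y \<longleftrightarrow> e < norm (\<Sum>i\<in>I. ell b (X i) th y - eif th (X i))" for X y
  \<comment> \<open>The block values at which both parts of (b) hold up to \<open>d\<close>. The
    first part bounds the second moment of a summand, the second its mean.\<close>
  define B where "B y \<longleftrightarrow> ell_error b th y \<le> ennreal (d\<^sup>2) \<and> norm (ell_mean b th y) \<le> d" for y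
  have p1: "Measurable.pred (iid M) (\<lambda>y. ennreal (d\<^sup>2) < ell_error b th y)"
    using ell_error_meas[OF th, of b] by measurable
  have p2: "Measurable.pred (iid M) (\<lambda>y. d < norm (ell_mean b th y))"
    using ell_mean_meas[OF th, of b] by measurable
  have B_alt: "B = (\<lambda>y. \<not> (ennreal (d\<^sup>2) < ell_error b th y) \<and> \<not> (d < norm (ell_mean b th y)))"
    by (simp add: B_def fun_eq_iff not_less)
  have B_meas: "Measurable.pred (iid M) B"
    unfolding B_alt by (intro pred_intros_logic(2,3) p1 p2)
  have A_meas: "Measurable.pred (iid (P th) \<Otimes>\<^sub>M iid M) (\<lambda>(X, y). A X y)"
  proof -
    have summand: "(\<lambda>z. ell b (fst z i) th (snd z) - eif th (fst z i)) \<in> borel_measurable (iid (P th) \<Otimes>\<^sub>M iid M)" for i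
    proof -
      have ci: "(\<lambda>z. fst z i) \<in> measurable (iid (P th) \<Otimes>\<^sub>M iid M) (P th)"
        by (rule measurable_compose[OF measurable_fst measurable_component_singleton[of i UNIV "\<lambda>_. P th"]]) simp
      have ciM: "(\<lambda>z. fst z i) \<in> measurable (iid (P th) \<Otimes>\<^sub>M iid M) M"
        using ci unfolding measurable_cong_sets[OF refl sQ] .
      have "(\<lambda>z. (fst z i, th, snd z)) \<in> measurable (iid (P th) \<Otimes>\<^sub>M iid M) (M \<Otimes>\<^sub>M borel \<Otimes>\<^sub>M iid M)"
        by (intro measurable_Pair ciM measurable_snd measurable_const) auto
      from measurable_compose[OF this ell_meas[of b]] measurable_compose[OF ciM eif_meas[OF th]]
      show ?thesis by (intro borel_measurable_diff) simp_all
    qed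
    have "(\<lambda>z. \<Sum>i\<in>I. ell b (fst z i) th (snd z) - eif th (fst z i)) \<in> borel_measurable (iid (P th) \<Otimes>\<^sub>M iid M)"
      by (intro borel_measurable_sum summand)
    then have "Measurable.pred (iid (P th) \<Otimes>\<^sub>M iid M) (\<lambda>z. e < norm (\<Sum>i\<in>I. ell b (fst z i) th (snd z) - eif th (fst z i)))"
      by measurable
    then show ?thesis by (simp add: A_def split_beta')
  qed
  have ell_T: "ell b x th (T X) = ell b x th (\<lambda>j. X (c + j))" for x X
    by (rule ell_local) (simp add: T_def)
  have noise_A: "e < norm (noise I c b th X) \<longleftrightarrow> A X (T X)" for X
    by (simp add: noise_def A_def ell_T)
  have BT: "B (T X) \<longleftrightarrow> B (\<lambda>j. X (c + j))" for X
    using ell_error_local[of b "T X" "\<lambda>j. X (c + j)" th] ell_mean_local[of b "T X" "\<lambda>j. X (c + j)" th]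
    by (simp add: B_def T_def)
  have "iid_prob (P th) (\<lambda>X. A X (T X))
      \<le> (real (card I) * d\<^sup>2 + (real (card I))\<^sup>2 * (d\<^sup>2 / real b)) / e\<^sup>2 + iid_prob (P th) (\<lambda>X. \<not> B (T X))"
  proof (rule measure_iid_plugin[OF Q.prob_space_axioms A_meas T_meas B_meas, of "{c..<c + b}"])
    fix X X' :: "nat \<Rightarrow> 'a" and y assume "\<And>i. i \<notin> {c..<c + b} \<Longrightarrow> X i = X' i"
    then have "X i = X' i" if "i \<in> I" for i using that I(2) by blast
    then show "A X y = A X' y" unfolding A_def by (metis (no_types, lifting) sum.cong)
  next
    fix X X' :: "nat \<Rightarrow> 'a" assume eq: "\<And>i. i \<in> {c..<c + b} \<Longrightarrow> X i = X' i"
    show "T X = T X'" using eq b by (auto simp: T_def fun_eq_iff)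
  next
    fix y assume y: "y \<in> space (iid M)" and By: "B y"
    define f where "f x = ell b x th y - eif th x" for x
    have em: "(\<lambda>x. ell b x th y) \<in> borel_measurable (P th)"
      using ell_meas_fix[OF y] unfolding measurable_cong_sets[OF sQ refl] .
    have fm: "f \<in> borel_measurable (P th)"
      unfolding f_def using em eifm by (rule borel_measurable_diff)
    have err: "(\<integral>\<^sup>+x. ennreal ((norm (f x))\<^sup>2) \<partial>P th) \<le> ennreal (d\<^sup>2)"
      using By by (simp add: B_def ell_error_def f_def)
    have f2: "integrable (P th) (\<lambda>x. (norm (f x))\<^sup>2)"
    proof (rule integrableI_bounded)
      show "(\<lambda>x. (norm (f x))\<^sup>2) \<in> borel_measurable (P th)" using fm by measurable
      show "(\<integral>\<^sup>+x. ennreal (norm ((norm (f x))\<^sup>2)) \<partial>P th) < \<infinity>"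
        using le_less_trans[OF err ennreal_less_top] by simp
    qed
    have f2le: "(\<integral>x. (norm (f x))\<^sup>2 \<partial>P th) \<le> d\<^sup>2"
    proof -
      have "ennreal (\<integral>x. (norm (f x))\<^sup>2 \<partial>P th) \<le> ennreal (d\<^sup>2)"
        using nn_integral_eq_integral[OF f2] err by simp
      then show ?thesis by simp
    qed
    have fi: "integrable (P th) f" by (rule L1[OF fm f2])
    have ei: "integrable (P th) (eif th)" by (rule L1[OF eifm eif2])
    \<comment> \<open>Since the true influence function has mean zero under \<open>P th\<close>, the
      error \<open>f\<close> has the same mean as the estimated influence function, and this mean is
      what the second part of (b) controls.\<close>
    have "(\<integral>x. ell b x th y \<partial>P th) = (\<integral>x. f x + eif th x \<partial>P th)" by (simp add: f_def)
    also have "\<dots> = (\<integral>x. f x \<partial>P th)" using fi ei eif_mean[OF th] by simp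
    finally have "sqrt (real b) * norm (\<integral>x. f x \<partial>P th) \<le> d"
      using By by (simp add: B_def ell_mean_def)
    then have "(sqrt (real b) * norm (\<integral>x. f x \<partial>P th))\<^sup>2 \<le> d\<^sup>2"
      by (intro power_mono) auto
    then have mean: "(norm (\<integral>x. f x \<partial>P th))\<^sup>2 \<le> d\<^sup>2 / real b"
      using b by (simp add: power_mult_distrib pos_le_divide_eq mult.commute)
    have "iid_prob (P th) (\<lambda>X. A X y) = iid_prob (P th) (\<lambda>X. e < norm (\<Sum>i\<in>I. f (X i)))"
      by (simp add: A_def f_def)
    also have "\<dots> \<le> (real (card I) * (\<integral>x. (norm (f x))\<^sup>2 \<partial>P th)
        + (real (card I))\<^sup>2 * (norm (\<integral>x. f x \<partial>P th))\<^sup>2) / e\<^sup>2"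
      by (rule measure_iid_norm_sum_gt_le[OF Q.prob_space_axioms fm f2 I(1) e])
    also have "\<dots> \<le> (real (card I) * d\<^sup>2 + (real (card I))\<^sup>2 * (d\<^sup>2 / real b)) / e\<^sup>2"
      using f2le mean by (intro divide_right_mono add_mono mult_left_mono) auto
    finally show "iid_prob (P th) (\<lambda>X. A X y)
      \<le> (real (card I) * d\<^sup>2 + (real (card I))\<^sup>2 * (d\<^sup>2 / real b)) / e\<^sup>2" .
  qed (auto intro!: divide_nonneg_nonneg add_nonneg_nonneg)
  also have "iid_prob (P th) (\<lambda>X. \<not> B (T X)) = iid_prob (P th) (\<lambda>X. \<not> B X)"
    unfolding BT by (rule measure_iid_shift[OF Q.prob_space_axioms pred_iid_P[OF th pred_intros_logic(2)[OF B_meas]]])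
  also have "\<dots> \<le> iid_prob (P th) (\<lambda>X. ennreal (d\<^sup>2) < ell_error b th X) + iid_prob (P th) (\<lambda>X. d < norm (ell_mean b th X))"
    by (rule iid_prob_le_add[OF Q.prob_space_axioms pred_iid_P[OF th p1] pred_iid_P[OF th p2]])
      (auto simp: B_def not_le)
  finally show ?thesis by (simp add: noise_A)
qed

end

lemma tendsto_zeroI_nonneg:
  fixes f :: "nat \<Rightarrow> real"
  assumes "\<And>n. 0 \<le> f n" and "\<And>e. 0 < e \<Longrightarrow> eventually (\<lambda>n. f n < e) sequentially"
  shows "f \<longlonglongrightarrow> 0"
  by (rule tendstoI) (use assms in \<open>simp add: dist_norm\<close>)

lemma eventually_compose_linear:
  assumes "0 < \<kappa>" and "eventually (\<lambda>n. \<kappa> * real n \<le> real (b n)) sequentially"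
    and "eventually Q sequentially"
  shows "eventually (\<lambda>n. Q (b n)) sequentially"
proof -
  obtain N where N: "\<And>m. N \<le> m \<Longrightarrow> Q m"
    using assms(3) by (auto simp: eventually_sequentially)
  have "eventually (\<lambda>n. real N / \<kappa> \<le> real n) sequentially"
    using filterlim_real_sequentially by (auto simp: filterlim_at_top)
  then show ?thesis
    using assms(2)
  proof eventually_elim
    case (elim n)
    then have "real N \<le> \<kappa> * real n" using assms(1) by (simp add: pos_divide_le_eq mult.commute)
    then show ?case using elim(2) by (intro N) linarith
  qed
qed

context one_step_model
begin

text \<open>A block of \<open>k\<close> observations uses the assumptions at sample size
  \<open>k\<close>. A parameter that is root-n close at the full sample size lies in the larger ball
  for \<open>k\<close>, with the same \<open>C\<close>.\<close>

lemma nbhd_mono: "th \<in> nbhd C k" if "th \<in> nbhd C n" "k \<le> n"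
proof -
  have "sqrt (real k) * norm (th - th0) \<le> sqrt (real n) * norm (th - th0)"
    using that(2) by (intro mult_right_mono) auto
  then show ?thesis using that(1) unfolding nbhd_def by simp
qed

lemma nbhd_Th: "th \<in> nbhd C n \<Longrightarrow> th \<in> Th"
  by (simp add: nbhd_def)

text \<open>The blocks lie inside the first \<open>n\<close> observations only for large
  \<open>n\<close>, whereas \<open>regular_param_contiguity\<close> wants locality at every
  \<open>n\<close>. Conjunction with \<open>good n\<close> makes the event empty at the exceptional
  indices and leaves the limit unchanged.\<close>

lemma contiguity_eventually:
  assumes s: "root_n_seq Th th0 s" "root_n_seq Th th0 s'"
    and good: "eventually good sequentially"
    and A: "\<And>n. good n \<Longrightarrow> Measurable.pred (iid M) (A n)"
    and A_local: "\<And>n X Y. good n \<Longrightarrow> (\<And>i. i < n \<Longrightarrow> X i = Y i) \<Longrightarrow> A n X = A n Y"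
    and lim: "(\<lambda>n. iid_prob (P (s' n)) (A n)) \<longlonglongrightarrow> 0"
  shows "(\<lambda>n. iid_prob (P (s n)) (A n)) \<longlonglongrightarrow> 0"
proof -
  have ev: "eventually (\<lambda>n. iid_prob (P (r n)) (\<lambda>X. good n \<and> A n X) = iid_prob (P (r n)) (A n)) sequentially" for r
    using good by eventually_elim simp
  have "(\<lambda>n. iid_prob (P (s' n)) (\<lambda>X. good n \<and> A n X)) \<longlonglongrightarrow> 0"
    using lim tendsto_cong[OF ev] by blast
  then have "(\<lambda>n. iid_prob (P (s n)) (\<lambda>X. good n \<and> A n X)) \<longlonglongrightarrow> 0"
  proof (rule regular_param_contiguity[OF reg th0 s, rotated -1])
    show "Measurable.pred (iid M) (\<lambda>X. good n \<and> A n X)" for n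
      using A[of n] by (cases "good n") simp_all
    show "(good n \<and> A n X) = (good n \<and> A n Y)" if "\<And>i. i < n \<Longrightarrow> X i = Y i" for n X Y
      using A_local[of n X Y] that by blast
  qed
  then show ?thesis using tendsto_cong[OF ev] by blast
qed

text \<open>The law is taken at the very parameter that is plugged in, because (b) and the mean zero
  of the influence function refer to that law.\<close>

lemma noise_negligible:
  assumes ths: "\<And>n. ths n \<in> nbhd C n" and C: "0 \<le> C" and \<kappa>: "0 < \<kappa>" and e: "0 < e"
    and blocks: "eventually (\<lambda>n. finite (I n) \<and> I n \<inter> {c n..<c n + b n} = {} \<and> card (I n) \<le> n
      \<and> \<kappa> * real n \<le> real (b n) \<and> b n \<le> n) sequentially"
  shows "(\<lambda>n. iid_prob (P (ths n)) (\<lambda>X. e * sqrt (real n) < norm (noise (I n) (c n) (b n) (ths n) X))) \<longlonglongrightarrow> 0"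
proof (rule tendsto_zeroI_nonneg)
  fix \<eta> :: real assume \<eta>: "0 < \<eta>"
  \<comment> \<open>With \<open>card (I n) \<le> n\<close> and
    \<open>b n \<ge> \<kappa> * n\<close>, the Chebyshev numerator is at most
    \<open>n * d^2 * (1 + 1 / \<kappa>)\<close>. After division by \<open>e^2 * n\<close>, the
    choice of \<open>d\<close> leaves \<open>\<eta> / 6\<close>; the two probabilities from (b) take
    \<open>\<eta> / 3\<close> each.\<close>
  define K where "K = 1 + 1 / \<kappa>"
  have K: "0 < K" using \<kappa> by (auto simp: K_def intro: add_pos_pos)
  define d where "d = e * sqrt (\<eta> / (6 * K))"
  have d: "0 < d" using e \<eta> K by (simp add: d_def)
  have d2: "d\<^sup>2 * K / e\<^sup>2 = \<eta> / 6"
    using e \<eta> K by (simp add: d_def power_mult_distrib)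
  have lin: "eventually (\<lambda>n. \<kappa> * real n \<le> real (b n)) sequentially"
    using blocks by eventually_elim simp
  have "eventually (\<lambda>n. \<forall>th\<in>nbhd C (b n). iid_prob (P th) (\<lambda>X. ennreal (d\<^sup>2) < ell_error (b n) th X) < \<eta> / 3) sequentially"
    using d \<eta> C by (intro eventually_compose_linear[OF \<kappa> lin] eventually_ell_error) auto
  moreover have "eventually (\<lambda>n. \<forall>th\<in>nbhd C (b n). iid_prob (P th) (\<lambda>X. d < norm (ell_mean (b n) th X)) < \<eta> / 3) sequentially"
    using d \<eta> C by (intro eventually_compose_linear[OF \<kappa> lin] eventually_ell_mean) auto
  ultimately show "eventually (\<lambda>n. iid_prob (P (ths n)) (\<lambda>X. e * sqrt (real n) < norm (noise (I n) (c n) (b n) (ths n) X)) < \<eta>) sequentially"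
    using blocks eventually_gt_at_top[of 0]
  proof eventually_elim
    case (elim n)
    have n: "0 < real n" using elim(4) by simp
    have mem: "ths n \<in> nbhd C (b n)" using nbhd_mono[OF ths] elim(3) by blast
    have "0 < \<kappa> * real n" using \<kappa> n by simp
    then have b: "0 < real (b n)" using elim(3) by linarith
    define k where "k = real (card (I n))"
    have k: "0 \<le> k" "k \<le> real n" using elim(3) by (auto simp: k_def)
    have "d\<^sup>2 / real (b n) \<le> d\<^sup>2 / (\<kappa> * real n)"
      using elim(3) \<kappa> n b by (intro divide_left_mono mult_pos_pos) auto
    then have "k * d\<^sup>2 + k\<^sup>2 * (d\<^sup>2 / real (b n)) \<le> real n * d\<^sup>2 + (real n)\<^sup>2 * (d\<^sup>2 / (\<kappa> * real n))"
      using k \<kappa> d by (intro add_mono mult_mono power_mono) auto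
    also have "\<dots> = real n * (d\<^sup>2 * K)"
      using n \<kappa> by (simp add: K_def field_simps power2_eq_square)
    finally have "(k * d\<^sup>2 + k\<^sup>2 * (d\<^sup>2 / real (b n))) / (e * sqrt (real n))\<^sup>2 \<le> (real n * (d\<^sup>2 * K)) / (e * sqrt (real n))\<^sup>2"
      by (rule divide_right_mono) simp
    also have "\<dots> = d\<^sup>2 * K / e\<^sup>2"
      using n by (simp add: power_mult_distrib)
    finally have "(k * d\<^sup>2 + k\<^sup>2 * (d\<^sup>2 / real (b n))) / (e * sqrt (real n))\<^sup>2 \<le> \<eta> / 6"
      unfolding d2 .
    moreover have "iid_prob (P (ths n)) (\<lambda>X. e * sqrt (real n) < norm (noise (I n) (c n) (b n) (ths n) X))
      \<le> (k * d\<^sup>2 + k\<^sup>2 * (d\<^sup>2 / real (b n))) / (e * sqrt (real n))\<^sup>2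
      + (iid_prob (P (ths n)) (\<lambda>X. ennreal (d\<^sup>2) < ell_error (b n) (ths n) X)
         + iid_prob (P (ths n)) (\<lambda>X. d < norm (ell_mean (b n) (ths n) X)))"
      unfolding k_def by (rule noise_bound) (use nbhd_Th[OF ths] elim(3) b d e n in auto)
    moreover have "iid_prob (P (ths n)) (\<lambda>X. ennreal (d\<^sup>2) < ell_error (b n) (ths n) X) < \<eta> / 3"
      "iid_prob (P (ths n)) (\<lambda>X. d < norm (ell_mean (b n) (ths n) X)) < \<eta> / 3"
      using elim(1,2) mem by blast+
    ultimately show ?case using \<eta> by linarith
  qed
qed (rule measure_nonneg)

section \<open>The drift, and its combination with the noise along fixed sequences\<close>

definition drift :: "nat \<Rightarrow> nat set \<Rightarrow> 'p \<Rightarrow> 'p \<Rightarrow> (nat \<Rightarrow> 'a) \<Rightarrow> 'p" where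
  "drift n I th th' X = sqrt (real n) *\<^sub>R ((real (card I) / real n) *\<^sub>R (th - th')
      + (1 / real n) *\<^sub>R (\<Sum>i\<in>I. eif th (X i) - eif th' (X i)))"

lemma sum_block_shift: "(\<Sum>i\<in>{a..<a + k}. g i) = (\<Sum>i<k. g (a + i :: nat))"
  by (rule sum.reindex_bij_witness[of _ "\<lambda>i. a + i" "\<lambda>i. i - a"]) auto

text \<open>The drift compares two parameters, (c) compares one parameter with \<open>th0\<close>.
  In the difference of two instances of (c) on the same block \<open>th0\<close> cancels; the
  factor, at most 1 for \<open>k \<le> n\<close>, converts the normalisation from block size to
  sample size.\<close>

lemma drift_eq:
  assumes "0 < k" "0 < n"
  shows "drift n {a..<a + k} th th' X = sqrt (real k / real n) *\<^sub>R
    (expansion_error k th (\<lambda>i. X (a + i)) - expansion_error k th' (\<lambda>i. X (a + i)))"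
proof -
  have c: "sqrt (real k / real n) * sqrt (real k) = sqrt (real n) * (real k / real n)"
  proof -
    have "sqrt (real k / real n) * sqrt (real k) = real k / sqrt (real n)"
      by (simp add: real_sqrt_divide)
    also have "\<dots> = sqrt (real n) * (real k / real n)"
      using assms by (simp add: field_simps)
    finally show ?thesis .
  qed
  define u where "u = (\<Sum>i<k. eif th (X (a + i)))"
  define u' where "u' = (\<Sum>i<k. eif th' (X (a + i)))"
  have "sqrt (real k / real n) *\<^sub>R
      (expansion_error k th (\<lambda>i. X (a + i)) - expansion_error k th' (\<lambda>i. X (a + i)))
    = (sqrt (real k / real n) * sqrt (real k)) *\<^sub>R (th - th' + (1 / real k) *\<^sub>R (u - u'))"
    by (simp add: expansion_error_def u_def u'_def algebra_simps)
  also have "\<dots> = sqrt (real n) *\<^sub>R ((real k / real n) *\<^sub>R (th - th' + (1 / real k) *\<^sub>R (u - u')))"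
    unfolding c by simp
  also have "(real k / real n) *\<^sub>R (th - th' + (1 / real k) *\<^sub>R (u - u'))
      = (real k / real n) *\<^sub>R (th - th') + (1 / real n) *\<^sub>R (u - u')"
    using assms by (simp add: scaleR_add_right)
  finally show ?thesis
    by (simp add: drift_def sum_block_shift u_def u'_def sum_subtractf)
qed

lemma drift_meas: "drift n I th th' \<in> borel_measurable (iid M)" if "th \<in> Th" "th' \<in> Th"
  unfolding drift_def
  by (intro borel_measurable_scaleR borel_measurable_diff borel_measurable_add borel_measurable_const
      borel_measurable_sum eif_coord_meas that)

text \<open>Assumption (c) concerns only the law at \<open>th0\<close>. Under it both expansion
  errors in \<open>drift_eq\<close> vanish, after shifting the block to the origin; contiguity then
  carries the result to the law at \<open>ths'\<close>.\<close>

lemma drift_negligible: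
  assumes ths: "\<And>n. ths n \<in> nbhd C n" "\<And>n. ths' n \<in> nbhd C n" and C: "0 \<le> C" and \<kappa>: "0 < \<kappa>" and e: "0 < e"
    and blocks: "eventually (\<lambda>n. a n + k n \<le> n \<and> \<kappa> * real n \<le> real (k n)) sequentially"
  shows "(\<lambda>n. iid_prob (P (ths' n)) (\<lambda>X. e < norm (drift n {a n..<a n + k n} (ths n) (ths' n) X))) \<longlonglongrightarrow> 0"
proof (rule contiguity_eventually[where s'="\<lambda>_. th0" and good="\<lambda>n. a n + k n \<le> n"])
  show "root_n_seq Th th0 ths'" by (rule root_n_seq_nbhd[OF ths(2)])
  show "eventually (\<lambda>n. a n + k n \<le> n) sequentially" using blocks by eventually_elim simp
  show "Measurable.pred (iid M) (\<lambda>X. e < norm (drift n {a n..<a n + k n} (ths n) (ths' n) X))" for n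
    using drift_meas[OF nbhd_Th[OF ths(1)] nbhd_Th[OF ths(2)]] by measurable
  show "(e < norm (drift n {a n..<a n + k n} (ths n) (ths' n) X)) = (e < norm (drift n {a n..<a n + k n} (ths n) (ths' n) Y))"
    if "a n + k n \<le> n" "\<And>i. i < n \<Longrightarrow> X i = Y i" for n X Y
  proof -
    have "(\<Sum>i\<in>{a n..<a n + k n}. eif (ths n) (X i) - eif (ths' n) (X i))
        = (\<Sum>i\<in>{a n..<a n + k n}. eif (ths n) (Y i) - eif (ths' n) (Y i))"
      using that by (intro sum.cong) auto
    then show ?thesis by (simp add: drift_def)
  qed
  show "(\<lambda>n. iid_prob (P th0) (\<lambda>X. e < norm (drift n {a n..<a n + k n} (ths n) (ths' n) X))) \<longlonglongrightarrow> 0"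
  proof (rule tendsto_zeroI_nonneg)
    fix \<eta> :: real assume \<eta>: "0 < \<eta>"
    have lin: "eventually (\<lambda>n. \<kappa> * real n \<le> real (k n)) sequentially"
      using blocks by eventually_elim simp
    have "eventually (\<lambda>n. \<forall>th\<in>nbhd C (k n). iid_prob (P th0) (\<lambda>X. e / 2 < norm (expansion_error (k n) th X)) < \<eta> / 2) sequentially"
      using e \<eta> C by (intro eventually_compose_linear[OF \<kappa> lin] eventually_expansion_error) auto
    then show "eventually (\<lambda>n. iid_prob (P th0) (\<lambda>X. e < norm (drift n {a n..<a n + k n} (ths n) (ths' n) X)) < \<eta>) sequentially"
      using blocks eventually_gt_at_top[of 0]
    proof eventually_elim
      case (elim n)
      have n: "0 < real n" using elim(3) by simp
      have "0 < \<kappa> * real n" using \<kappa> n by simp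
      then have k: "0 < k n" using elim(2) by linarith
      have mem: "ths n \<in> nbhd C (k n)" "ths' n \<in> nbhd C (k n)" using nbhd_mono[OF ths(1)] nbhd_mono[OF ths(2)] elim(2) by auto
      have pE: "Measurable.pred (iid (P th0)) (\<lambda>X. e / 2 < norm (expansion_error (k n) th X))" if "th \<in> Th" for th
      proof -
        have "Measurable.pred (iid M) (\<lambda>X. e / 2 < norm (expansion_error (k n) th X))"
          using expansion_error_meas[OF that, of "k n"] by measurable
        then show ?thesis by (rule pred_iid_P[OF th0])
      qed
      have pS: "Measurable.pred (iid (P th0)) (\<lambda>X. e / 2 < norm (expansion_error (k n) th (\<lambda>i. X (a n + i))))" if "th \<in> Th" for th
        by (rule measurable_compose[OF measurable_iid_shift pE[OF that]])
      have "iid_prob (P th0) (\<lambda>X. e < norm (drift n {a n..<a n + k n} (ths n) (ths' n) X))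
        \<le> iid_prob (P th0) (\<lambda>X. e / 2 < norm (expansion_error (k n) (ths n) (\<lambda>i. X (a n + i))))
          + iid_prob (P th0) (\<lambda>X. e / 2 < norm (expansion_error (k n) (ths' n) (\<lambda>i. X (a n + i))))"
      proof (rule iid_prob_le_add[OF prob_P[OF th0] pS[OF nbhd_Th[OF ths(1)]] pS[OF nbhd_Th[OF ths(2)]]])
        fix X assume big: "e < norm (drift n {a n..<a n + k n} (ths n) (ths' n) X)"
        define x where "x = expansion_error (k n) (ths n) (\<lambda>i. X (a n + i))"
        define y where "y = expansion_error (k n) (ths' n) (\<lambda>i. X (a n + i))"
        have "norm (drift n {a n..<a n + k n} (ths n) (ths' n) X) = sqrt (real (k n) / real n) * norm (x - y)"
          using drift_eq[of "k n" n "a n" "ths n" "ths' n" X] k n by (simp add: x_def y_def)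
        also have "\<dots> \<le> 1 * norm (x - y)"
          using elim(2) n by (intro mult_right_mono) (auto simp: divide_le_eq_1)
        also have "\<dots> \<le> norm x + norm y" using norm_triangle_ineq4[of x y] by simp
        finally have "e < norm x + norm y" using big by linarith
        then show "e / 2 < norm (expansion_error (k n) (ths n) (\<lambda>i. X (a n + i)))
          \<or> e / 2 < norm (expansion_error (k n) (ths' n) (\<lambda>i. X (a n + i)))"
          unfolding x_def[symmetric] y_def[symmetric] by linarith
      qed
      also have "\<dots> = iid_prob (P th0) (\<lambda>X. e / 2 < norm (expansion_error (k n) (ths n) X))
          + iid_prob (P th0) (\<lambda>X. e / 2 < norm (expansion_error (k n) (ths' n) X))"
        unfolding measure_iid_shift[OF prob_P[OF th0] pE[OF nbhd_Th[OF ths(1)[of n]]], where a="a n"]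
          measure_iid_shift[OF prob_P[OF th0] pE[OF nbhd_Th[OF ths(2)[of n]]], where a="a n"] ..
      also have "\<dots> < \<eta> / 2 + \<eta> / 2"
        using elim(1) mem by (intro add_strict_mono) blast+
      finally show ?case by simp
    qed
  qed (rule measure_nonneg)
qed (rule root_n_seq_th0)

text \<open>The share of one half of the sample, summed over \<open>I\<close>, in the error of the
  estimator: \<open>th\<close> is the value plugged in, \<open>th'\<close> the true parameter, and
  \<open>{c..<c + b}\<close> the block that yields the estimated influence function. Adding and
  subtracting the true influence function at \<open>th\<close> splits it into drift and
  noise.\<close>

definition split_error :: "nat \<Rightarrow> nat set \<Rightarrow> nat \<Rightarrow> nat \<Rightarrow> 'p \<Rightarrow> 'p \<Rightarrow> (nat \<Rightarrow> 'a) \<Rightarrow> 'p" where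
  "split_error n I c b th' th X = sqrt (real n) *\<^sub>R ((real (card I) / real n) *\<^sub>R (th - th')
      + (1 / real n) *\<^sub>R (\<Sum>i\<in>I. ell b (X i) th (\<lambda>j. X (c + j)) - eif th' (X i)))"

lemma split_error_eq:
  assumes "0 < n"
  shows "split_error n I c b th' th X = drift n I th th' X + (1 / sqrt (real n)) *\<^sub>R noise I c b th X"
proof -
  have "sqrt (real n) * (1 / real n) = 1 / sqrt (real n)"
    using assms by (simp add: field_simps)
  then have c: "sqrt (real n) *\<^sub>R ((1 / real n) *\<^sub>R v) = (1 / sqrt (real n)) *\<^sub>R v" for v :: 'p
    by (simp only: scaleR_scaleR)
  have s: "(\<Sum>i\<in>I. ell b (X i) th (\<lambda>j. X (c + j)) - eif th' (X i))
      = (\<Sum>i\<in>I. eif th (X i) - eif th' (X i)) + noise I c b th X"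
    unfolding noise_def sum.distrib[symmetric] by (rule sum.cong) auto
  show ?thesis
    by (simp only: split_error_def drift_def s scaleR_add_right c add.assoc)
qed

lemma split_summand_meas: "(\<lambda>z. ell b (fst z i) (snd z) (\<lambda>j. fst z (c + j)) - eif th' (fst z i))
    \<in> borel_measurable (iid M \<Otimes>\<^sub>M borel)" if "th' \<in> Th"
proof -
  have ci: "(\<lambda>z. fst z i) \<in> measurable (iid M \<Otimes>\<^sub>M borel) M"
    by (rule measurable_compose[OF measurable_fst measurable_component_singleton[of i UNIV "\<lambda>_. M"]]) simp
  have sh: "(\<lambda>z j. fst z (c + j)) \<in> measurable (iid M \<Otimes>\<^sub>M borel) (iid M)"
    by (rule measurable_compose[OF measurable_fst measurable_iid_shift])
  have "(\<lambda>z. (fst z i, snd z, \<lambda>j. fst z (c + j))) \<in> measurable (iid M \<Otimes>\<^sub>M borel) (M \<Otimes>\<^sub>M borel \<Otimes>\<^sub>M iid M)"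
    by (intro measurable_Pair ci sh measurable_snd)
  from measurable_compose[OF this ell_meas[of b]] measurable_compose[OF ci eif_meas[OF that]]
  show ?thesis by (intro borel_measurable_diff) simp_all
qed

lemma split_error_meas: "(\<lambda>z. split_error n I c b th' (snd z) (fst z)) \<in> borel_measurable (iid M \<Otimes>\<^sub>M borel)"
  if "th' \<in> Th"
proof -
  have "(\<lambda>z. \<Sum>i\<in>I. ell b (fst z i) (snd z) (\<lambda>j. fst z (c + j)) - eif th' (fst z i)) \<in> borel_measurable (iid M \<Otimes>\<^sub>M borel)"
    by (intro borel_measurable_sum split_summand_meas that)
  then show ?thesis unfolding split_error_def
    by (intro borel_measurable_scaleR borel_measurable_diff borel_measurable_add borel_measurable_const measurable_snd)
qed

lemma noise_meas: "noise I c b th \<in> borel_measurable (iid M)" if "th \<in> Th"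
proof -
  have "(\<lambda>X. (X, th)) \<in> measurable (iid M) (iid M \<Otimes>\<^sub>M borel)" by simp
  from measurable_compose[OF this split_summand_meas[OF that]]
  have "(\<lambda>X. ell b (X i) th (\<lambda>j. X (c + j)) - eif th (X i)) \<in> borel_measurable (iid M)" for i
    by simp
  then show ?thesis unfolding noise_def by (intro borel_measurable_sum)
qed

text \<open>Here \<open>ths\<close> is plugged in and \<open>ths'\<close> is the truth. The noise
  vanishes first under the law at \<open>ths\<close> and is moved to \<open>ths'\<close> by
  contiguity; the drift is already available under \<open>ths'\<close>.\<close>

lemma split_error_negligible:
  assumes ths: "\<And>n. ths n \<in> nbhd C n" "\<And>n. ths' n \<in> nbhd C n" and C: "0 \<le> C" and \<kappa>: "0 < \<kappa>" and e: "0 < e"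
    and blocks: "eventually (\<lambda>n. a n + k n \<le> n \<and> c n + b n \<le> n \<and> {a n..<a n + k n} \<inter> {c n..<c n + b n} = {}
       \<and> \<kappa> * real n \<le> real (k n) \<and> \<kappa> * real n \<le> real (b n)) sequentially"
  shows "(\<lambda>n. iid_prob (P (ths' n)) (\<lambda>X. e < norm (split_error n {a n..<a n + k n} (c n) (b n) (ths' n) (ths n) X))) \<longlonglongrightarrow> 0"
proof -
  let ?I = "\<lambda>n. {a n..<a n + k n}"
  have "(\<lambda>n. iid_prob (P (ths n)) (\<lambda>X. e / 2 * sqrt (real n) < norm (noise (?I n) (c n) (b n) (ths n) X))) \<longlonglongrightarrow> 0"
    by (rule noise_negligible[OF ths(1) C \<kappa>]) (use e blocks in \<open>auto elim!: eventually_mono\<close>)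
  then have noise: "(\<lambda>n. iid_prob (P (ths' n)) (\<lambda>X. e / 2 * sqrt (real n) < norm (noise (?I n) (c n) (b n) (ths n) X))) \<longlonglongrightarrow> 0"
  proof (rule contiguity_eventually[OF root_n_seq_nbhd[OF ths(2)] root_n_seq_nbhd[OF ths(1)],
        where good="\<lambda>n. a n + k n \<le> n \<and> c n + b n \<le> n", rotated -1])
    show "eventually (\<lambda>n. a n + k n \<le> n \<and> c n + b n \<le> n) sequentially" using blocks by eventually_elim simp
    show "Measurable.pred (iid M) (\<lambda>X. e / 2 * sqrt (real n) < norm (noise (?I n) (c n) (b n) (ths n) X))" for n
      using noise_meas[OF nbhd_Th[OF ths(1)]] by measurable
    show "(e / 2 * sqrt (real n) < norm (noise (?I n) (c n) (b n) (ths n) X)) = (e / 2 * sqrt (real n) < norm (noise (?I n) (c n) (b n) (ths n) Y))"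
      if "a n + k n \<le> n \<and> c n + b n \<le> n" "\<And>i. i < n \<Longrightarrow> X i = Y i" for n X Y
    proof -
      have "ell (b n) x (ths n) (\<lambda>j. X (c n + j)) = ell (b n) x (ths n) (\<lambda>j. Y (c n + j))" for x
        by (rule ell_local) (use that in auto)
      then have "noise (?I n) (c n) (b n) (ths n) X = noise (?I n) (c n) (b n) (ths n) Y"
        unfolding noise_def using that by (intro sum.cong) auto
      then show ?thesis by simp
    qed
  qed
  have drift: "(\<lambda>n. iid_prob (P (ths' n)) (\<lambda>X. e / 2 < norm (drift n (?I n) (ths n) (ths' n) X))) \<longlonglongrightarrow> 0"
    by (rule drift_negligible[OF ths C \<kappa>]) (use e blocks in \<open>auto elim!: eventually_mono\<close>)
  show ?thesis
  proof (rule tendsto_sandwich[OF _ _ tendsto_const])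
    show "eventually (\<lambda>n. iid_prob (P (ths' n)) (\<lambda>X. e < norm (split_error n (?I n) (c n) (b n) (ths' n) (ths n) X))
      \<le> iid_prob (P (ths' n)) (\<lambda>X. e / 2 < norm (drift n (?I n) (ths n) (ths' n) X))
        + iid_prob (P (ths' n)) (\<lambda>X. e / 2 * sqrt (real n) < norm (noise (?I n) (c n) (b n) (ths n) X))) sequentially"
      using eventually_gt_at_top[of 0]
    proof eventually_elim
      case (elim n)
      show ?case
      proof (rule iid_prob_le_add[OF prob_P[OF nbhd_Th[OF ths(2)]]])
        have "Measurable.pred (iid M) (\<lambda>X. e / 2 < norm (drift n (?I n) (ths n) (ths' n) X))"
          using drift_meas[OF nbhd_Th[OF ths(1)] nbhd_Th[OF ths(2)]] by measurable
        then show "Measurable.pred (iid (P (ths' n))) (\<lambda>X. e / 2 < norm (drift n (?I n) (ths n) (ths' n) X))"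
          by (rule pred_iid_P[OF nbhd_Th[OF ths(2)]])
        have "Measurable.pred (iid M) (\<lambda>X. e / 2 * sqrt (real n) < norm (noise (?I n) (c n) (b n) (ths n) X))"
          using noise_meas[OF nbhd_Th[OF ths(1)]] by measurable
        then show "Measurable.pred (iid (P (ths' n))) (\<lambda>X. e / 2 * sqrt (real n) < norm (noise (?I n) (c n) (b n) (ths n) X))"
          by (rule pred_iid_P[OF nbhd_Th[OF ths(2)]])
        fix X assume big: "e < norm (split_error n (?I n) (c n) (b n) (ths' n) (ths n) X)"
        define x where "x = drift n (?I n) (ths n) (ths' n) X"
        define y where "y = noise (?I n) (c n) (b n) (ths n) X"
        have "norm (split_error n (?I n) (c n) (b n) (ths' n) (ths n) X) \<le> norm x + norm ((1 / sqrt (real n)) *\<^sub>R y)"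
          unfolding split_error_eq[OF elim] x_def y_def by (rule norm_triangle_ineq)
        also have "norm ((1 / sqrt (real n)) *\<^sub>R y) = norm y / sqrt (real n)" by simp
        finally have "e < norm x + norm y / sqrt (real n)" using big by linarith
        then have "e / 2 < norm x \<or> e / 2 < norm y / sqrt (real n)" by linarith
        then show "e / 2 < norm (drift n (?I n) (ths n) (ths' n) X)
          \<or> e / 2 * sqrt (real n) < norm (noise (?I n) (c n) (b n) (ths n) X)"
          unfolding x_def[symmetric] y_def[symmetric] using elim by (simp add: pos_less_divide_eq)
      qed
    qed
    show "(\<lambda>n. iid_prob (P (ths' n)) (\<lambda>X. e / 2 < norm (drift n (?I n) (ths n) (ths' n) X))
        + iid_prob (P (ths' n)) (\<lambda>X. e / 2 * sqrt (real n) < norm (noise (?I n) (c n) (b n) (ths n) X))) \<longlonglongrightarrow> 0"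
      using tendsto_add[OF drift noise] by simp
  qed (simp add: measure_nonneg)
qed

section \<open>Plugging in the preliminary estimator\<close>

lemma nbhd_borel: "Measurable.pred borel (\<lambda>th. th \<in> nbhd C n)"
proof -
  have "Th \<in> sets borel" using reg by (simp add: regular_param_def)
  then have 1: "Measurable.pred borel (\<lambda>th. th \<in> Th)" by measurable
  have 2: "Measurable.pred borel (\<lambda>th::'p. sqrt (real n) * norm (th - th0) \<le> C)" by measurable
  show ?thesis unfolding nbhd_def mem_Collect_eq by (intro pred_intros_logic(3) 1 2)
qed

lemma split_error_plugin_meas:
  "Measurable.pred (iid M) (\<lambda>X. e < norm (split_error n I c b th' (t b' (\<lambda>j. X (c' + j))) X))" if "th' \<in> Th"
proof -
  have "(\<lambda>X. t b' (\<lambda>j. X (c' + j))) \<in> borel_measurable (iid M)"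
    by (rule measurable_compose[OF measurable_iid_shift t_meas])
  then have "(\<lambda>X. (X, t b' (\<lambda>j. X (c' + j)))) \<in> measurable (iid M) (iid M \<Otimes>\<^sub>M borel)"
    by (intro measurable_Pair measurable_ident_sets refl)
  from measurable_compose[OF this split_error_meas[OF that]]
  have "(\<lambda>X. split_error n I c b th' (t b' (\<lambda>j. X (c' + j))) X) \<in> borel_measurable (iid M)" by simp
  then show ?thesis by measurable
qed

text \<open>Three disjoint blocks are involved: \<open>a\<close>, \<open>k\<close> for the
  summation, \<open>c\<close>, \<open>b\<close> for the influence function, \<open>c'\<close>,
  \<open>b'\<close> for the preliminary estimator. The first two avoid the third, so the estimate
  may be frozen by \<open>measure_iid_plugin\<close>; it lies in a root-n ball with high
  probability, on which the deterministic bound holds uniformly.\<close>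

lemma split_error_plugin_negligible:
  assumes ths': "\<And>n. ths' n \<in> nbhd C0 n" and C0: "0 \<le> C0" and \<kappa>: "0 < \<kappa>" and e: "0 < e"
    and blocks: "eventually (\<lambda>n. a n + k n \<le> n \<and> c n + b n \<le> n \<and> b' n \<le> n
       \<and> {a n..<a n + k n} \<inter> {c n..<c n + b n} = {}
       \<and> {a n..<a n + k n} \<inter> {c' n..<c' n + b' n} = {}
       \<and> {c n..<c n + b n} \<inter> {c' n..<c' n + b' n} = {}
       \<and> \<kappa> * real n \<le> real (k n) \<and> \<kappa> * real n \<le> real (b n) \<and> \<kappa> * real n \<le> real (b' n)) sequentially"
  shows "(\<lambda>n. iid_prob (P (ths' n)) (\<lambda>X. e < norm (split_error n {a n..<a n + k n} (c n) (b n) (ths' n)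
    (t (b' n) (\<lambda>j. X (c' n + j))) X))) \<longlonglongrightarrow> 0"
proof (rule tendsto_zeroI_nonneg)
  fix \<eta> :: real assume \<eta>: "0 < \<eta>"
  let ?I = "\<lambda>n. {a n..<a n + k n}"
  obtain K where K: "0 < K" and tight: "eventually (\<lambda>n. \<forall>th\<in>nbhd C0 n.
      iid_prob (P th) (\<lambda>X. K < norm (sqrt (real n) *\<^sub>R (t n X - th))) < \<eta> / 2) sequentially"
    using eventually_root_n_tight[of "\<eta> / 2" C0] \<eta> C0 by auto
  \<comment> \<open>The estimate uses \<open>b' n \<ge> \<kappa> * n\<close> observations, so
    distance \<open>K / sqrt (b' n)\<close> from the truth is at most
    \<open>K / sqrt \<kappa>\<close> on the root-n scale; the truth is itself within
    \<open>C0\<close> of \<open>th0\<close> on that scale.\<close>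
  define C where "C = K / sqrt \<kappa> + C0"
  have C: "0 \<le> C" "C0 \<le> C" using K \<kappa> C0 by (simp_all add: C_def)
  have ths'C: "ths' n \<in> nbhd C n" for n using ths'[of n] C by (auto simp: nbhd_def)
  \<comment> \<open>The estimator is not assumed to take values in \<open>Th\<close>. Openness
    supplies this once the root-n ball is small enough.\<close>
  obtain r where r: "0 < r" "ball th0 r \<subseteq> Th"
    using reg th0 openE unfolding regular_param_def by metis
  have lin: "eventually (\<lambda>n. \<kappa> * real n \<le> real (b' n)) sequentially"
    using blocks by eventually_elim simp
  have unif: "eventually (\<lambda>n. \<forall>th\<in>nbhd C n. iid_prob (P (ths' n))
      (\<lambda>X. e < norm (split_error n (?I n) (c n) (b n) (ths' n) th X)) < \<eta> / 2) sequentially"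
  proof (rule eventually_ball_lessI[where ?s0.0="\<lambda>_. th0"])
    fix s assume s: "\<And>n. s n \<in> nbhd C n"
    show "(\<lambda>n. iid_prob (P (ths' n)) (\<lambda>X. e < norm (split_error n (?I n) (c n) (b n) (ths' n) (s n) X))) \<longlonglongrightarrow> 0"
      by (rule split_error_negligible[OF s ths'C C(1) \<kappa> e]) (use blocks in \<open>auto elim!: eventually_mono\<close>)
  qed (use \<eta> C th0_nbhd in auto)
  have "((\<lambda>n. C / sqrt (real n)) \<longlongrightarrow> 0) sequentially"
    by (intro tendsto_divide_0[OF tendsto_const] filterlim_at_top_imp_at_infinity
        filterlim_compose[OF sqrt_at_top filterlim_real_sequentially])
  then have rad: "eventually (\<lambda>n. C / sqrt (real n) < r) sequentially"
    using r(1) by (rule order_tendstoD(2))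
  show "eventually (\<lambda>n. iid_prob (P (ths' n)) (\<lambda>X. e < norm (split_error n (?I n) (c n) (b n) (ths' n)
    (t (b' n) (\<lambda>j. X (c' n + j))) X)) < \<eta>) sequentially"
    using unif eventually_compose_linear[OF \<kappa> lin tight] rad blocks eventually_gt_at_top[of 0]
  proof eventually_elim
    case (elim n)
    have n: "0 < real n" using elim(5) by simp
    have Th: "ths' n \<in> Th" by (rule nbhd_Th[OF ths'])
    have Q: "prob_space (P (ths' n))" by (rule prob_P[OF Th])
    have sI: "sets (iid (P (ths' n))) = sets (iid M)" by (rule sets_iid_cong[OF sets_P[OF Th]])
    have "0 < \<kappa> * real n" using \<kappa> n by simp
    then have b': "0 < real (b' n)" using elim(4) by linarith
    \<comment> \<open>Written so that \<open>T\<close> visibly depends on the block alone; the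
      filler index 0 stays inside the block because \<open>b' n > 0\<close>.\<close>
    define T where "T X = t (b' n) (\<lambda>j. X (c' n + (if j < b' n then j else 0)))" for X :: "nat \<Rightarrow> 'a"
    have T_eq: "T X = t (b' n) (\<lambda>j. X (c' n + j))" for X
      unfolding T_def by (rule t_local) simp
    have T_meas: "T \<in> borel_measurable (iid (P (ths' n)))"
      unfolding measurable_cong_sets[OF sI refl] T_eq[abs_def]
      by (rule measurable_compose[OF measurable_iid_shift t_meas])
    define A where "A X th \<longleftrightarrow> e < norm (split_error n (?I n) (c n) (b n) (ths' n) th X)" for X th
    have A_meas: "Measurable.pred (iid (P (ths' n)) \<Otimes>\<^sub>M borel) (\<lambda>(X, th). A X th)"
    proof -
      have "Measurable.pred (iid M \<Otimes>\<^sub>M borel) (\<lambda>z. e < norm (split_error n (?I n) (c n) (b n) (ths' n) (snd z) (fst z)))"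
        using split_error_meas[OF Th] by measurable
      then show ?thesis
        unfolding measurable_cong_sets[OF sets_pair_measure_cong[OF sI refl] refl] by (simp add: A_def split_beta')
    qed
    have "iid_prob (P (ths' n)) (\<lambda>X. A X (T X)) \<le> \<eta> / 2 + iid_prob (P (ths' n)) (\<lambda>X. T X \<notin> nbhd C n)"
    proof (rule measure_iid_plugin[OF Q A_meas T_meas nbhd_borel, of "{c' n..<c' n + b' n}"])
      fix X X' :: "nat \<Rightarrow> 'a" and th
      assume eq: "\<And>i. i \<notin> {c' n..<c' n + b' n} \<Longrightarrow> X i = X' i"
      have 1: "X i = X' i" if "i \<in> ?I n" for i using that elim(4) by (intro eq) blast
      have 2: "X (c n + j) = X' (c n + j)" if "j < b n" for j
      proof -
        have "c n + j \<in> {c n..<c n + b n}" using that by simp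
        then show ?thesis using elim(4) by (intro eq) blast
      qed
      have "ell (b n) x th (\<lambda>j. X (c n + j)) = ell (b n) x th (\<lambda>j. X' (c n + j))" for x
        by (rule ell_local) (rule 2)
      then have "(\<Sum>i\<in>?I n. ell (b n) (X i) th (\<lambda>j. X (c n + j)) - eif (ths' n) (X i))
          = (\<Sum>i\<in>?I n. ell (b n) (X' i) th (\<lambda>j. X' (c n + j)) - eif (ths' n) (X' i))"
        by (intro sum.cong refl) (simp only: 1)
      then have "split_error n (?I n) (c n) (b n) (ths' n) th X = split_error n (?I n) (c n) (b n) (ths' n) th X'"
        unfolding split_error_def by simp
      then show "A X th = A X' th" by (simp add: A_def)
    next
      fix X X' :: "nat \<Rightarrow> 'a" assume eq: "\<And>i. i \<in> {c' n..<c' n + b' n} \<Longrightarrow> X i = X' i"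
      have "X (c' n + (if j < b' n then j else 0)) = X' (c' n + (if j < b' n then j else 0))" for j
        using b' by (intro eq) auto
      then show "T X = T X'" unfolding T_def by simp
    next
      fix th assume "th \<in> nbhd C n"
      then have "iid_prob (P (ths' n)) (\<lambda>X. e < norm (split_error n (?I n) (c n) (b n) (ths' n) th X)) < \<eta> / 2"
        using elim(1) by blast
      then show "iid_prob (P (ths' n)) (\<lambda>X. A X th) \<le> \<eta> / 2" by (simp add: A_def)
    qed (use \<eta> in simp)
    also have "iid_prob (P (ths' n)) (\<lambda>X. T X \<notin> nbhd C n) < \<eta> / 2"
    proof -
      have pK: "Measurable.pred (iid (P (ths' n))) (\<lambda>X. K < norm (sqrt (real (b' n)) *\<^sub>R (t (b' n) X - ths' n)))"
      proof (rule pred_iid_P[OF Th])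
        have "(\<lambda>X. norm (sqrt (real (b' n)) *\<^sub>R (t (b' n) X - ths' n))) \<in> borel_measurable (iid M)"
          using t_meas[of "b' n"] by measurable
        then show "Measurable.pred (iid M) (\<lambda>X. K < norm (sqrt (real (b' n)) *\<^sub>R (t (b' n) X - ths' n)))"
          by measurable
      qed
      have "iid_prob (P (ths' n)) (\<lambda>X. T X \<notin> nbhd C n)
        \<le> iid_prob (P (ths' n)) (\<lambda>X. K < norm (sqrt (real (b' n)) *\<^sub>R (t (b' n) (\<lambda>j. X (c' n + j)) - ths' n)))"
      proof (rule iid_prob_mono[OF Q])
        show "Measurable.pred (iid (P (ths' n))) (\<lambda>X. K < norm (sqrt (real (b' n)) *\<^sub>R (t (b' n) (\<lambda>j. X (c' n + j)) - ths' n)))"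
          by (rule measurable_compose[OF measurable_iid_shift pK])
        fix X assume notin: "T X \<notin> nbhd C n"
        show "K < norm (sqrt (real (b' n)) *\<^sub>R (t (b' n) (\<lambda>j. X (c' n + j)) - ths' n))"
        proof (rule ccontr)
          assume "\<not> K < norm (sqrt (real (b' n)) *\<^sub>R (t (b' n) (\<lambda>j. X (c' n + j)) - ths' n))"
          then have le: "sqrt (real (b' n)) * norm (T X - ths' n) \<le> K" by (simp add: T_eq)
          have "sqrt \<kappa> * sqrt (real n) \<le> sqrt (real (b' n))"
            using elim(4) by (simp add: real_sqrt_mult[symmetric])
          then have "sqrt \<kappa> * sqrt (real n) * norm (T X - ths' n) \<le> sqrt (real (b' n)) * norm (T X - ths' n)"
            by (rule mult_right_mono) simp
          then have "sqrt \<kappa> * (sqrt (real n) * norm (T X - ths' n)) \<le> K"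
            using le by simp
          then have 1: "sqrt (real n) * norm (T X - ths' n) \<le> K / sqrt \<kappa>"
            using \<kappa> by (simp add: pos_le_divide_eq mult.commute)
          have 2: "sqrt (real n) * norm (ths' n - th0) \<le> C0" using ths'[of n] by (simp add: nbhd_def)
          have "norm (T X - th0) \<le> norm (T X - ths' n) + norm (ths' n - th0)"
            using norm_triangle_ineq[of "T X - ths' n" "ths' n - th0"] by simp
          then have "sqrt (real n) * norm (T X - th0) \<le> sqrt (real n) * (norm (T X - ths' n) + norm (ths' n - th0))"
            by (rule mult_left_mono) simp
          also have "\<dots> \<le> C" using 1 2 by (simp add: distrib_left C_def)
          finally have 3: "sqrt (real n) * norm (T X - th0) \<le> C" .
          then have "norm (T X - th0) \<le> C / sqrt (real n)"
            using n by (simp add: pos_le_divide_eq mult.commute)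
          then have "norm (T X - th0) < r" using elim(3) by linarith
          then have "T X \<in> Th" using r(2) by (auto simp: dist_norm norm_minus_commute)
          with 3 notin show False by (simp add: nbhd_def)
        qed
      qed
      also have "\<dots> = iid_prob (P (ths' n)) (\<lambda>X. K < norm (sqrt (real (b' n)) *\<^sub>R (t (b' n) X - ths' n)))"
        by (rule measure_iid_shift[OF Q pK])
      also have "\<dots> < \<eta> / 2"
        using elim(2,4) nbhd_mono[OF ths'] by blast
      finally show ?thesis .
    qed
    finally show ?case unfolding A_def T_eq by simp
  qed
qed (rule measure_nonneg)

text \<open>The weights of the two halves cancel the divisors of their averages to a common
  \<open>1 / n\<close>, and since they sum to one the centring at \<open>th'\<close> splits
  accordingly. The forms \<open>0 + mu n\<close> and \<open>mu n + (n - mu n)\<close> match the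
  block pattern of \<open>split_error_plugin_negligible\<close>.\<close>

lemma theta_hat_eq:
  assumes "0 < lam n" "lam n < mu n" "mu n < nu n" "nu n < n"
  shows "sqrt (real n) *\<^sub>R (theta_hat t ell lam mu nu n X - th' - (1 / real n) *\<^sub>R (\<Sum>i<n. eif th' (X i)))
    = split_error n {0..<0 + mu n} (nu n) (n - nu n) th' (t (nu n - mu n) (\<lambda>j. X (mu n + j))) X
      + split_error n {mu n..<mu n + (n - mu n)} (lam n) (mu n - lam n) th' (t (lam n) (\<lambda>j. X (0 + j))) X"
proof -
  define th1 where "th1 = t (lam n) X"
  define th2 where "th2 = t (nu n - mu n) (\<lambda>j. X (mu n + j))"
  define s1 where "s1 = (\<Sum>i\<in>{mu n..<n}. ell (mu n - lam n) (X i) th1 (\<lambda>j. X (lam n + j)))"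
  define s2 where "s2 = (\<Sum>i<mu n. ell (n - nu n) (X i) th2 (\<lambda>j. X (nu n + j)))"
  define u1 where "u1 = (\<Sum>i\<in>{mu n..<n}. eif th' (X i))"
  define u2 where "u2 = (\<Sum>i<mu n. eif th' (X i))"
  define \<alpha> where "\<alpha> = real (mu n) / real n"
  define \<beta> where "\<beta> = real (n - mu n) / real n"
  have \<alpha>\<beta>: "\<alpha> + \<beta> = 1" using assms by (simp add: \<alpha>_def \<beta>_def add_divide_distrib[symmetric] of_nat_diff)
  have "(\<Sum>i<n. eif th' (X i)) = u2 + u1"
    using assms unfolding u1_def u2_def lessThan_atLeast0 by (intro sum.atLeastLessThan_concat[symmetric]) auto
  moreover have "theta_hat t ell lam mu nu n X = (\<alpha> *\<^sub>R th2 + (1 / real n) *\<^sub>R s2) + (\<beta> *\<^sub>R th1 + (1 / real n) *\<^sub>R s1)"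
  proof -
    have "\<alpha> * (1 / real (mu n)) = 1 / real n" "\<beta> * (1 / real (n - mu n)) = 1 / real n"
      using assms by (simp_all add: \<alpha>_def \<beta>_def)
    then show ?thesis
      unfolding theta_hat_def Let_def \<alpha>_def[symmetric] \<beta>_def[symmetric]
      by (simp add: scaleR_add_right s1_def s2_def th1_def th2_def)
  qed
  moreover have "th' = \<alpha> *\<^sub>R th' + \<beta> *\<^sub>R th'"
    using \<alpha>\<beta> by (simp add: scaleR_add_left[symmetric])
  ultimately have "theta_hat t ell lam mu nu n X - th' - (1 / real n) *\<^sub>R (\<Sum>i<n. eif th' (X i))
    = (\<alpha> *\<^sub>R (th2 - th') + (1 / real n) *\<^sub>R (s2 - u2)) + (\<beta> *\<^sub>R (th1 - th') + (1 / real n) *\<^sub>R (s1 - u1))"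
    by (simp add: algebra_simps)
  moreover have "split_error n {0..<0 + mu n} (nu n) (n - nu n) th' th2 X
      = sqrt (real n) *\<^sub>R (\<alpha> *\<^sub>R (th2 - th') + (1 / real n) *\<^sub>R (s2 - u2))"
    by (simp add: split_error_def \<alpha>_def s2_def u2_def sum_subtractf lessThan_atLeast0)
  moreover have "split_error n {mu n..<mu n + (n - mu n)} (lam n) (mu n - lam n) th' th1 X
      = sqrt (real n) *\<^sub>R (\<beta> *\<^sub>R (th1 - th') + (1 / real n) *\<^sub>R (s1 - u1))"
    using assms by (simp add: split_error_def \<beta>_def s1_def u1_def sum_subtractf)
  ultimately show ?thesis
    by (simp only: scaleR_add_right th1_def th2_def add_0)
qed

lemma theta_hat_asymptotically_linear:
  assumes order: "\<forall>\<^sub>F n in sequentially. 0 < lam n \<and> lam n < mu n \<and> mu n < nu n \<and> nu n < n"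
    and lim_lam: "(\<lambda>n. real (lam n) / real n) \<longlonglongrightarrow> l"
    and lim_mu: "(\<lambda>n. real (mu n) / real n) \<longlonglongrightarrow> m"
    and lim_nu: "(\<lambda>n. real (nu n) / real n) \<longlonglongrightarrow> v"
    and lmv: "0 < l" "l < m" "m < v" "v < 1"
    and ths: "root_n_seq Th th0 ths"
  shows "oP (\<lambda>n. P (ths n))
           (\<lambda>n X. sqrt (real n) *\<^sub>R (theta_hat t ell lam mu nu n X - ths n
                    - (1 / real n) *\<^sub>R (\<Sum>i<n. eif (ths n) (X i))))"
proof -
  obtain C where C: "\<And>n. ths n \<in> nbhd C n"
    using ths by (auto simp: root_n_seq_def nbhd_def)
  have C0: "0 \<le> C" using C[of 0] by (simp add: nbhd_def)
  \<comment> \<open>Half the smallest limiting fraction among the four blocks, so that each of them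
    eventually holds at least \<open>\<kappa> * n\<close> observations.\<close>
  define \<kappa> where "\<kappa> = Min {l, m - l, v - m, 1 - v} / 2"
  have \<kappa>: "0 < \<kappa>" "\<kappa> < l" "\<kappa> < m - l" "\<kappa> < v - m" "\<kappa> < 1 - v"
    using lmv by (auto simp: \<kappa>_def min_def)
  have "eventually (\<lambda>n. \<kappa> < real (lam n) / real n) sequentially"
    using lim_lam \<kappa> by (intro order_tendstoD) auto
  moreover have "eventually (\<lambda>n. \<kappa> < real (mu n) / real n - real (lam n) / real n) sequentially"
    by (rule order_tendstoD(1)[OF tendsto_diff[OF lim_mu lim_lam] \<kappa>(3)])
  moreover have "eventually (\<lambda>n. \<kappa> < real (nu n) / real n - real (mu n) / real n) sequentially"
    by (rule order_tendstoD(1)[OF tendsto_diff[OF lim_nu lim_mu] \<kappa>(4)])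
  moreover have "eventually (\<lambda>n. \<kappa> < 1 - real (nu n) / real n) sequentially"
    by (rule order_tendstoD(1)[OF tendsto_diff[OF tendsto_const lim_nu] \<kappa>(5)])
  ultimately have sizes: "eventually (\<lambda>n. \<kappa> * real n \<le> real (lam n) \<and> \<kappa> * real n \<le> real (mu n - lam n)
      \<and> \<kappa> * real n \<le> real (nu n - mu n) \<and> \<kappa> * real n \<le> real (n - nu n)) sequentially"
    using order
  proof eventually_elim
    case (elim n)
    have n: "0 < real n" using elim(5) by simp
    have "\<kappa> * real n < real (lam n)" using elim(1) n by (simp add: pos_less_divide_eq)
    moreover have "\<kappa> * real n < real (mu n) - real (lam n)"
      using elim(2) n by (simp add: diff_divide_distrib[symmetric] pos_less_divide_eq)
    moreover have "\<kappa> * real n < real (nu n) - real (mu n)"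
      using elim(3) n by (simp add: diff_divide_distrib[symmetric] pos_less_divide_eq)
    moreover have "\<kappa> * real n < real n - real (nu n)"
    proof -
      have "\<kappa> < (real n - real (nu n)) / real n"
        using elim(4) n by (simp add: diff_divide_distrib)
      then show ?thesis using n by (simp add: pos_less_divide_eq)
    qed
    ultimately show ?case using elim(5) by (simp add: of_nat_diff)
  qed
  show ?thesis
    unfolding oP_def
  proof (intro allI impI)
    fix e :: real assume e: "0 < e"
    \<comment> \<open>The first half is served by the two blocks after \<open>mu n\<close>, the
      second half by the two blocks before it: no half contributes to its own estimators.\<close>
    define E2 where "E2 n X = split_error n {0..<0 + mu n} (nu n) (n - nu n) (ths n)
        (t (nu n - mu n) (\<lambda>j. X (mu n + j))) X" for n X
    define E1 where "E1 n X = split_error n {mu n..<mu n + (n - mu n)} (lam n) (mu n - lam n) (ths n)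
        (t (lam n) (\<lambda>j. X (0 + j))) X" for n X
    have lim2: "(\<lambda>n. iid_prob (P (ths n)) (\<lambda>X. e / 2 < norm (E2 n X))) \<longlonglongrightarrow> 0"
      unfolding E2_def
    proof (rule split_error_plugin_negligible[OF C C0 \<kappa>(1)])
      show "eventually (\<lambda>n. 0 + mu n \<le> n \<and> nu n + (n - nu n) \<le> n \<and> nu n - mu n \<le> n
         \<and> {0..<0 + mu n} \<inter> {nu n..<nu n + (n - nu n)} = {}
         \<and> {0..<0 + mu n} \<inter> {mu n..<mu n + (nu n - mu n)} = {}
         \<and> {nu n..<nu n + (n - nu n)} \<inter> {mu n..<mu n + (nu n - mu n)} = {}
         \<and> \<kappa> * real n \<le> real (mu n) \<and> \<kappa> * real n \<le> real (n - nu n) \<and> \<kappa> * real n \<le> real (nu n - mu n)) sequentially"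
        using sizes order by eventually_elim (auto simp: Int_def)
    qed (use e in simp)
    have lim1: "(\<lambda>n. iid_prob (P (ths n)) (\<lambda>X. e / 2 < norm (E1 n X))) \<longlonglongrightarrow> 0"
      unfolding E1_def
    proof (rule split_error_plugin_negligible[OF C C0 \<kappa>(1)])
      show "eventually (\<lambda>n. mu n + (n - mu n) \<le> n \<and> lam n + (mu n - lam n) \<le> n \<and> lam n \<le> n
         \<and> {mu n..<mu n + (n - mu n)} \<inter> {lam n..<lam n + (mu n - lam n)} = {}
         \<and> {mu n..<mu n + (n - mu n)} \<inter> {0..<0 + lam n} = {}
         \<and> {lam n..<lam n + (mu n - lam n)} \<inter> {0..<0 + lam n} = {}
         \<and> \<kappa> * real n \<le> real (n - mu n) \<and> \<kappa> * real n \<le> real (mu n - lam n) \<and> \<kappa> * real n \<le> real (lam n)) sequentially"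
        using sizes order
      proof eventually_elim
        case (elim n)
        have "real (n - nu n) \<le> real (n - mu n)" using elim(2) by simp
        then have "\<kappa> * real n \<le> real (n - mu n)" using elim(1) by linarith
        then show ?case using elim by (auto simp: Int_def)
      qed
    qed (use e in simp)
    show "(\<lambda>n. measure (iid (P (ths n))) {X \<in> space (iid (P (ths n))). e < norm (sqrt (real n) *\<^sub>R
        (theta_hat t ell lam mu nu n X - ths n - (1 / real n) *\<^sub>R (\<Sum>i<n. eif (ths n) (X i))))}) \<longlonglongrightarrow> 0"
    proof (rule tendsto_sandwich[OF _ _ tendsto_const])
      show "eventually (\<lambda>n. iid_prob (P (ths n)) (\<lambda>X. e < norm (sqrt (real n) *\<^sub>R
          (theta_hat t ell lam mu nu n X - ths n - (1 / real n) *\<^sub>R (\<Sum>i<n. eif (ths n) (X i)))))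
        \<le> iid_prob (P (ths n)) (\<lambda>X. e / 2 < norm (E2 n X)) + iid_prob (P (ths n)) (\<lambda>X. e / 2 < norm (E1 n X))) sequentially"
        using order
      proof eventually_elim
        case (elim n)
        have Th: "ths n \<in> Th" by (rule nbhd_Th[OF C])
        show ?case
        proof (rule iid_prob_le_add[OF prob_P[OF Th]])
          show "Measurable.pred (iid (P (ths n))) (\<lambda>X. e / 2 < norm (E2 n X))"
            unfolding E2_def by (rule pred_iid_P[OF Th split_error_plugin_meas[OF Th]])
          show "Measurable.pred (iid (P (ths n))) (\<lambda>X. e / 2 < norm (E1 n X))"
            unfolding E1_def by (rule pred_iid_P[OF Th split_error_plugin_meas[OF Th]])
          fix X assume big: "e < norm (sqrt (real n) *\<^sub>R
            (theta_hat t ell lam mu nu n X - ths n - (1 / real n) *\<^sub>R (\<Sum>i<n. eif (ths n) (X i))))"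
          have "e < norm (E2 n X + E1 n X)"
            using big theta_hat_eq[of lam n mu nu X "ths n"] elim by (simp only: E1_def E2_def)
          also have "\<dots> \<le> norm (E2 n X) + norm (E1 n X)" by (rule norm_triangle_ineq)
          finally show "e / 2 < norm (E2 n X) \<or> e / 2 < norm (E1 n X)" by linarith
        qed
      qed
      show "(\<lambda>n. iid_prob (P (ths n)) (\<lambda>X. e / 2 < norm (E2 n X)) + iid_prob (P (ths n)) (\<lambda>X. e / 2 < norm (E1 n X))) \<longlonglongrightarrow> 0"
        using tendsto_add[OF lim2 lim1] by simp
    qed (simp add: measure_nonneg)
  qed
qed

end

theorem theorem8p3:
  fixes M :: "'a measure" and Th :: "(real^'k) set" and GG :: "'g set"
    and P :: "real^'k \<Rightarrow> 'g \<Rightarrow> 'a measure"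
    and sc :: "'g \<Rightarrow> real^'k \<Rightarrow> 'a \<Rightarrow> real^'k"
    and eif :: "real^'k \<Rightarrow> 'g \<Rightarrow> 'a \<Rightarrow> real^'k"
    and t :: "nat \<Rightarrow> (nat \<Rightarrow> 'a) \<Rightarrow> real^'k"
    and ell :: "nat \<Rightarrow> 'a \<Rightarrow> real^'k \<Rightarrow> (nat \<Rightarrow> 'a) \<Rightarrow> real^'k"
    and lam mu nu :: "nat \<Rightarrow> nat" and l m v :: real
    and th :: "real^'k" and G :: 'g and ths :: "nat \<Rightarrow> real^'k"
  assumes open_Th: "open Th"
    and regular: "\<forall>G\<in>GG. regular_param M Th (\<lambda>th. P th G) (sc G)"
    and eif: "\<forall>th\<in>Th. \<forall>G\<in>GG. eff_infl M {P th G' | G'. G' \<in> GG} (P th G) (sc G th) (eif th G)"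
    and t_local: "\<forall>n X Y. (\<forall>i<n. X i = Y i) \<longrightarrow> t n X = t n Y"
    and t_meas: "\<forall>n. t n \<in> borel_measurable (\<Pi>\<^sub>M i\<in>(UNIV::nat set). M)"
    and ell_local: "\<forall>n x th X Y. (\<forall>i<n. X i = Y i) \<longrightarrow> ell n x th X = ell n x th Y"
    and ell_meas: "\<forall>n. (\<lambda>(x, th, X). ell n x th X)
                        \<in> borel_measurable (M \<Otimes>\<^sub>M borel \<Otimes>\<^sub>M (\<Pi>\<^sub>M i\<in>(UNIV::nat set). M))"
    and a: "\<forall>th\<in>Th. \<forall>G\<in>GG. \<forall>ths. root_n_seq Th th ths \<longrightarrow>
              ((\<lambda>Mb::real. limsup (\<lambda>n. ereal (measure (iid (P (ths n) G))
                   {X \<in> space (iid (P (ths n) G)). Mb < norm (sqrt (real n) *\<^sub>R (t n X - ths n))})))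
                \<longlongrightarrow> 0) at_top"
    and b1: "\<forall>th\<in>Th. \<forall>G\<in>GG. \<forall>ths. root_n_seq Th th ths \<longrightarrow>
              oP_enn (\<lambda>n. P (ths n) G)
                (\<lambda>n X. \<integral>\<^sup>+x. ennreal ((norm (ell n x (ths n) X - eif (ths n) G x))\<^sup>2) \<partial>(P (ths n) G))"
    and b2: "\<forall>th\<in>Th. \<forall>G\<in>GG. \<forall>ths. root_n_seq Th th ths \<longrightarrow>
              oP (\<lambda>n. P (ths n) G)
                (\<lambda>n X. sqrt (real n) *\<^sub>R (\<integral>x. ell n x (ths n) X \<partial>(P (ths n) G)))"
    and c: "\<forall>th\<in>Th. \<forall>G\<in>GG. \<forall>ths. root_n_seq Th th ths \<longrightarrow>
              oP (\<lambda>n. P th G)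
                (\<lambda>n X. sqrt (real n) *\<^sub>R (ths n - th
                    + (1 / real n) *\<^sub>R (\<Sum>i<n. eif (ths n) G (X i))
                    - (1 / real n) *\<^sub>R (\<Sum>i<n. eif th G (X i))))"
    and order: "\<forall>\<^sub>F n in sequentially. 0 < lam n \<and> lam n < mu n \<and> mu n < nu n \<and> nu n < n"
    and lim_lam: "(\<lambda>n. real (lam n) / real n) \<longlonglongrightarrow> l"
    and lim_mu: "(\<lambda>n. real (mu n) / real n) \<longlonglongrightarrow> m"
    and lim_nu: "(\<lambda>n. real (nu n) / real n) \<longlonglongrightarrow> v"
    and lmv: "0 < l" "l < m" "m < v" "v < 1"
    and th: "th \<in> Th" and G: "G \<in> GG" and ths: "root_n_seq Th th ths"
  shows "oP (\<lambda>n. P (ths n) G)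
           (\<lambda>n X. sqrt (real n) *\<^sub>R (theta_hat t ell lam mu nu n X - ths n
                    - (1 / real n) *\<^sub>R (\<Sum>i<n. eif (ths n) G (X i))))"
proof -
  have reg: "regular_param M Th (\<lambda>th. P th G) (sc G)" using regular G by blast
  have sets_P: "sets (P th' G) = sets M" if "th' \<in> Th" for th'
    using reg that unfolding regular_param_def by (metis sets_density)
  note infl = eff_infl_mean_zero[OF reg _ eif[rule_format, OF _ G]]
  interpret one_step_model M Th "\<lambda>th. P th G" "sc G" "\<lambda>th. eif th G" t ell th
  proof
    show "eif th' G \<in> borel_measurable M" if "th' \<in> Th" for th'
      using infl(1)[OF that that] unfolding measurable_cong_sets[OF sets_P[OF that] refl] .
    show "t n X = t n Y" if "\<And>i. i < n \<Longrightarrow> X i = Y i" for n X Y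
      using t_local that by blast
    show "ell n x th' X = ell n x th' Y" if "\<And>i. i < n \<Longrightarrow> X i = Y i" for n x th' X Y
      using ell_local that by blast
  qed (use reg th G infl t_meas ell_meas a b1 b2 c in auto)
  show ?thesis
    by (rule theta_hat_asymptotically_linear[OF order lim_lam lim_mu lim_nu lmv ths])
qed

end
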